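(* Let $f$ be an entire function which has two critical values and no asymptotic values, and suppose that $f$ has a periodic (i.e., not necessarily invariant) Siegel disk $U$ such that, for all $j\geq 0$, the boundary $\partial f^j(U)$ contains no critical values of $f$. Then $U$ is bounded.
   Context: Boundaries are taken in $\mathbb{C}$. "Two critical values and no asymptotic values" means that $f$ has exactly two critical values and no finite asymptotic values. An (invariant) Siegel disk of an entire function $g$ is a simply connected component $V$ of the Fatou set of $g$ with $g(V)=V$ such that $g|_V$ is conformally conjugate to an irrational rotation. A periodic Siegel disk of $f$ is a component of the Fatou set of $f$ which is an invariant Siegel disk for some iterate $f^n$, $n\geq 1$. *)

theory Defs
  imports "HOL-Complex_Analysis.Complex_Analysis"
begin

definition critical_values :: "(complex \<Rightarrow> complex) \<Rightarrow> complex set" where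
  "critical_values f = f ` {z. deriv f z = 0}"

definition finite_asymptotic_values :: "(complex \<Rightarrow> complex) \<Rightarrow> complex set" where
  "finite_asymptotic_values f =
     {a. \<exists>\<gamma> :: real \<Rightarrow> complex. continuous_on {0..} \<gamma> \<and>
           filterlim \<gamma> at_infinity at_top \<and> ((\<lambda>t. f (\<gamma> t)) \<longlongrightarrow> a) at_top}"

text \<open>
  Normality in the sense of Montel, with the limit function identically infinity allowed.
  This form agrees with locally uniform convergence in the spherical metric only on a
  connected set \<open>W\<close>; the definition of the Fatou set below uses it only there.
\<close>

definition normal_family_on :: "complex set \<Rightarrow> (complex \<Rightarrow> complex) set \<Rightarrow> bool" where
  "normal_family_on W F \<longleftrightarrow>
     (\<forall>s :: nat \<Rightarrow> complex \<Rightarrow> complex. range s \<subseteq> F \<longrightarrow>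
        (\<exists>r :: nat \<Rightarrow> nat. strict_mono r \<and>
           ((\<exists>g. g holomorphic_on W \<and>
               (\<forall>K. compact K \<and> K \<subseteq> W \<longrightarrow> uniform_limit K (\<lambda>n. s (r n)) g sequentially)) \<or>
            (\<forall>K B. compact K \<and> K \<subseteq> W \<longrightarrow>
               (\<forall>\<^sub>F n in sequentially. \<forall>z\<in>K. B < norm (s (r n) z))))))"

definition fatou_set :: "(complex \<Rightarrow> complex) \<Rightarrow> complex set" where
  "fatou_set f =
     {z. \<exists>W. open W \<and> connected W \<and> z \<in> W \<and> normal_family_on W (range (\<lambda>n. f ^^ n))}"

definition invariant_siegel_disk :: "(complex \<Rightarrow> complex) \<Rightarrow> complex set \<Rightarrow> bool" where
  "invariant_siegel_disk g V \<longleftrightarrow>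
     V \<in> components (fatou_set g) \<and> simply_connected V \<and> g ` V = V \<and>
     (\<exists>\<phi> (\<theta> :: real). \<phi> holomorphic_on V \<and> bij_betw \<phi> V (ball 0 1) \<and> \<theta> \<notin> \<rat> \<and>
        (\<forall>z\<in>V. \<phi> (g z) = cis (2 * pi * \<theta>) * \<phi> z))"

definition periodic_siegel_disk :: "(complex \<Rightarrow> complex) \<Rightarrow> complex set \<Rightarrow> bool" where
  "periodic_siegel_disk f U \<longleftrightarrow>
     U \<in> components (fatou_set f) \<and> (\<exists>n\<ge>1. invariant_siegel_disk (f ^^ n) U)"

end

(* One of the two critical values, b, lies in the Julia set: otherwise rescaled inverse branches of
   iterates along suitably chosen postcritical orbit points near the boundary of U would have a
   nonconstant limit whose range avoids the Siegel disks, although disks around Julia points are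
   blown up to meet them.  If f is a polynomial, orbits near infinity escape.  Otherwise f has tracts
   over |z - b| > R; in the coordinate log (z - b) the inverse branches G of f there contract (Bloch)
   and so do their translates G + 2 pi i m, whose invariant sets give disjoint forward invariant
   connected unbounded sets (hairs).  Pulled back to b they separate the plane into simply connected
   pieces containing the Siegel disks.  On those pieces log (z - b) and, by the lack of asymptotic
   values, inverse branches of f are defined and under control over bounded sets.  With psi_j the
   conjugacies of the cycle, so that psi_(j+1) = f o psi_j, this gives
   |log (psi_j - b)| <= 1/2 |log (psi_(j+1) - b)| + C, and taking the maximum over the cycle bounds U. *)

theory Submission
  imports Defs
begin

section \<open>Entire functions without asymptotic values\<close>

text \<open>Near a point \<open>w\<close> of its frontier a Siegel disk may have infinitely many
  pieces, and branches of \<open>ln (z - b)\<close> or of the inverse of \<open>f\<close> carried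
  along the disk could differ from piece to piece without bound. So branches defined only near
  \<open>w\<close> are of no use: one branch must be valid near \<open>w\<close> and on the whole
  disk at once. The barriers serve this purpose, since a component of the complement of a closed,
  connected, unbounded set through \<open>b\<close> is simply connected and omits \<open>b\<close>.
  A barrier may itself pass through \<open>w\<close>; hence two hairs, whose preimages are disjoint.
  The barriers go through \<open>b\<close> only, because only \<open>b\<close> is known to lie in
  the Julia set and therefore, by the boundary hypothesis, off the closures of the disks. The other
  critical value \<open>a\<close> may lie in such a piece, even in a Siegel disk; there the inverse
  of \<open>f\<close> is controlled on a punctured disk instead. The factor 1/2 in the final
  inequality bounds its maximum over the cycle of closed concentric subdisks independently of their
  radius.\<close>

lemma bounded_subsequence:
  fixes x :: "nat \<Rightarrow> complex"
  assumes "\<And>n. norm (x n) \<le> B"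
  obtains l r where "strict_mono (r :: nat \<Rightarrow> nat)" "(\<lambda>n. x (r n)) \<longlonglongrightarrow> l"
proof -
  have "bounded (range x)" using assms by (auto simp: bounded_iff)
  then show ?thesis
    using bounded_imp_convergent_subsequence[of x] that by (auto simp: o_def)
qed

locale tame_entire =
  fixes f :: "complex \<Rightarrow> complex"
  assumes hol: "f holomorphic_on UNIV"
    and finite_crit: "finite (critical_values f)"
    and no_asymptotic: "finite_asymptotic_values f = {}"
    and nonconst: "\<not> f constant_on UNIV"
begin

lemma hol_on [simp, intro]: "f holomorphic_on S"
  using hol holomorphic_on_subset by blast

lemma cont_on [simp, intro]: "continuous_on S f"
  by (simp add: holomorphic_on_imp_continuous_on)

lemma isCont_f [simp]: "isCont f z"
  using cont_on[of UNIV] continuous_on_eq_continuous_at[OF open_UNIV] by blast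

lemma isolated_preimage:
  assumes "\<epsilon> > 0"
  obtains r where "0 < r" "r < \<epsilon>" "\<And>z. z \<in> cball x r \<Longrightarrow> z \<noteq> x \<Longrightarrow> f z \<noteq> f x"
proof -
  obtain \<beta> where \<beta>: "f \<beta> \<noteq> f x"
    using nonconst unfolding constant_on_def by blast
  obtain r where r: "0 < r" "\<And>z. z \<in> ball x r - {x} \<Longrightarrow> f z - f x \<noteq> 0"
    using \<beta> by (rule_tac isolated_zeros[of "\<lambda>z. f z - f x" UNIV x \<beta>]) (auto intro!: holomorphic_intros)
  show ?thesis
  proof (rule that[of "min (r/2) (\<epsilon>/2)"])
    show "f z \<noteq> f x" if "z \<in> cball x (min (r/2) (\<epsilon>/2))" "z \<noteq> x" for z
      using r(2)[of z] that r(1) by (auto simp: dist_commute)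
  qed (use r assms in auto)
qed

lemma isolating_sphere:
  assumes "\<epsilon> > 0"
  obtains r \<mu> where "0 < r" "r < \<epsilon>" "\<And>z. z \<in> cball x r \<Longrightarrow> z \<noteq> x \<Longrightarrow> f z \<noteq> f x"
    "0 < \<mu>" "\<And>z. z \<in> sphere x r \<Longrightarrow> \<mu> \<le> dist (f z) (f x)"
proof -
  obtain r where r: "0 < r" "r < \<epsilon>" "\<And>z. z \<in> cball x r \<Longrightarrow> z \<noteq> x \<Longrightarrow> f z \<noteq> f x"
    using isolated_preimage[OF assms] by blast
  have "continuous_on (sphere x r) (\<lambda>y. dist (f y) (f x))" by (intro continuous_intros cont_on)
  moreover have "sphere x r \<noteq> {}" using r(1) by simp
  ultimately obtain y where y: "y \<in> sphere x r" "\<And>z. z \<in> sphere x r \<Longrightarrow> dist (f y) (f x) \<le> dist (f z) (f x)"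
    using continuous_attains_inf[OF compact_sphere] by blast
  have "f y \<noteq> f x" using r(1) r(3)[of y] y(1) by auto
  then show ?thesis using that[OF r, of "dist (f y) (f x)"] y(2) by simp
qed

lemma finite_preimage:
  assumes "compact K"
  shows "finite {z \<in> K. f z = u}"
proof (rule ccontr)
  assume inf: "infinite {z \<in> K. f z = u}"
  then obtain x where x: "x \<in> K" "x islimpt {z \<in> K. f z = u}"
    using Heine_Borel_imp_Bolzano_Weierstrass[OF assms inf] by blast
  have "closed {z. f z = u}"
    using continuous_closed_preimage_constant[of UNIV f u] by auto
  then have "f x = u"
    using x(2) closed_limpt islimpt_subset[of x "{z \<in> K. f z = u}" "{z. f z = u}"] by blast
  moreover obtain r where r: "0 < r" "\<And>z. z \<in> cball x r \<Longrightarrow> z \<noteq> x \<Longrightarrow> f z \<noteq> f x"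
    using isolated_preimage[of 1 x] by auto
  ultimately show False
    using x(2) unfolding islimpt_approachable by (force simp: dist_commute)
qed

text \<open>The connected image of \<open>C\<close> would have to meet the circle of radius
  \<open>r\<close> about \<open>x\<close>, where \<open>f\<close> is at distance at least
  \<open>\<mu>\<close> from \<open>u\<close>. This turns closeness of values of \<open>f\<close>
  into closeness of arguments, once one argument is known to be close.\<close>

lemma trapped:
  assumes "connected C" "continuous_on C \<gamma>" "\<And>t. t \<in> C \<Longrightarrow> dist (f (\<gamma> t)) u < \<mu>"
    and "\<And>z. z \<in> sphere x r \<Longrightarrow> \<mu> \<le> dist (f z) u"
    and "t \<in> C" "\<gamma> t \<in> ball x r" "s \<in> C"
  shows "\<gamma> s \<in> ball x r"
proof (rule ccontr)
  assume "\<gamma> s \<notin> ball x r"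
  moreover have "connected (\<gamma> ` C)"
    using assms by (simp add: connected_continuous_image)
  ultimately have "\<gamma> ` C \<inter> frontier (ball x r) \<noteq> {}"
    using assms by (intro connected_Int_frontier) auto
  moreover have "r > 0" using assms(6) by (smt (verit) mem_ball zero_le_dist)
  ultimately show False
    using assms by (force simp: frontier_ball)
qed

text \<open>The curve has a finite accumulation point \<open>x\<close>, as \<open>u\<close> is no asymptotic value, and it cannot cross
  the small circles around \<open>x\<close>, on which \<open>f\<close> stays away from \<open>u\<close>.\<close>

lemma landing:
  fixes \<gamma> :: "real \<Rightarrow> complex"
  assumes cont: "continuous_on {0..} \<gamma>" and lim: "((\<lambda>t. f (\<gamma> t)) \<longlongrightarrow> u) at_top"
  obtains z where "(\<gamma> \<longlongrightarrow> z) at_top" "f z = u"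
proof -
  have "\<not> filterlim \<gamma> at_infinity at_top"
    using no_asymptotic cont lim unfolding finite_asymptotic_values_def by blast
  then obtain B where B: "\<not> (\<forall>\<^sub>F t in at_top. B \<le> norm (\<gamma> t))"
    unfolding filterlim_at_infinity[of 0, simplified] by auto
  then have "\<exists>t\<ge>real n. norm (\<gamma> t) < B" for n
    unfolding eventually_at_top_linorder by (auto simp: not_le)
  then obtain t where t: "\<And>n. t n \<ge> real n" "\<And>n. norm (\<gamma> (t n)) < B" by metis
  then have "norm (\<gamma> (t n)) \<le> B" for n by (simp add: less_imp_le)
  then obtain x r where r: "strict_mono r" "(\<lambda>n. \<gamma> (t (r n))) \<longlonglongrightarrow> x"
    by (rule bounded_subsequence)
  have "filterlim t at_top sequentially"
    by (rule filterlim_at_top_mono[OF filterlim_real_sequentially]) (use t in auto)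
  then have tr: "filterlim (\<lambda>n. t (r n)) at_top sequentially"
    using r(1) filterlim_compose filterlim_subseq by blast
  have fx: "f x = u"
  proof (rule LIMSEQ_unique)
    show "(\<lambda>n. f (\<gamma> (t (r n)))) \<longlonglongrightarrow> f x"
      using isCont_tendsto_compose[OF isCont_f r(2)] .
    show "(\<lambda>n. f (\<gamma> (t (r n)))) \<longlonglongrightarrow> u"
      by (rule filterlim_compose[OF lim tr])
  qed
  have "(\<gamma> \<longlongrightarrow> x) at_top"
  proof (rule tendstoI)
    fix \<epsilon> :: real assume "\<epsilon> > 0"
    then obtain \<rho> \<mu> where \<rho>: "0 < \<rho>" "\<rho> < \<epsilon>" "0 < \<mu>"
        "\<And>z. z \<in> sphere x \<rho> \<Longrightarrow> \<mu> \<le> dist (f z) u"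
      using isolating_sphere[of \<epsilon> x] unfolding fx by metis
    have "\<forall>\<^sub>F t in at_top. dist (f (\<gamma> t)) u < \<mu>"
      using lim \<rho>(3) tendstoD by blast
    then obtain T where T: "\<And>t. t \<ge> T \<Longrightarrow> dist (f (\<gamma> t)) u < \<mu>"
      by (auto simp: eventually_at_top_linorder)
    have "\<forall>\<^sub>F n in sequentially. dist (\<gamma> (t (r n))) x < \<rho> \<and> t (r n) \<ge> max T 0"
      using tendstoD[OF r(2) \<rho>(1)] tr by (simp add: eventually_conj_iff filterlim_at_top)
    then obtain n where n: "dist (\<gamma> (t (r n))) x < \<rho>" "t (r n) \<ge> max T 0"
      by (auto simp: eventually_sequentially)
    have "dist (\<gamma> s) x < \<epsilon>" if "s \<ge> max T 0" for s
    proof -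
      have "\<gamma> s \<in> ball x \<rho>"
        by (rule trapped[of "{max T 0..}" \<gamma> u \<mu> x \<rho> "t (r n)" s])
          (use that n \<rho>(4) T in \<open>auto simp: dist_commute intro: continuous_on_subset[OF cont]\<close>)
      then show ?thesis using \<rho>(2) by (simp add: dist_commute)
    qed
    then show "\<forall>\<^sub>F t in at_top. dist (\<gamma> t) x < \<epsilon>"
      by (rule eventually_at_top_linorderI)
  qed
  then show ?thesis using that fx by blast
qed

lemma not_crit: "f z \<notin> critical_values f \<Longrightarrow> deriv f z \<noteq> 0"
  unfolding critical_values_def by auto

lemma locally_injective:
  assumes "deriv f z \<noteq> 0"
  obtains e where "e > 0" "inj_on f (ball z e)"
proof -
  obtain r where "r > 0" "inj_on f (ball z r)"
    using has_complex_derivative_locally_injective[of f UNIV z] assms by auto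
  then show ?thesis using that by blast
qed

end

section \<open>Lifting along the function\<close>

context tame_entire begin

text \<open>The set of agreement is closed by continuity and open because \<open>f\<close> is
  injective near each \<open>g1 y\<close>. The domain is any connected set, so that lifts can also
  be compared along segments.\<close>

lemma lift_unique:
  assumes T: "connected T" and c1: "continuous_on T g1" and c2: "continuous_on T g2"
    and eq: "\<And>x. x \<in> T \<Longrightarrow> f (g1 x) = f (g2 x)" and nz: "\<And>x. x \<in> T \<Longrightarrow> deriv f (g1 x) \<noteq> 0"
    and a: "a \<in> T" "g1 a = g2 a" and x: "x \<in> T"
  shows "g1 x = g2 x"
proof -
  let ?S = "{x \<in> T. g1 x - g2 x = 0}"
  have "closedin (top_of_set T) ?S"
    by (intro continuous_closedin_preimage_constant continuous_intros c1 c2)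
  moreover have "openin (top_of_set T) ?S"
  proof (subst openin_subopen, safe)
    fix y assume y: "y \<in> T" "g1 y - g2 y = 0"
    obtain e where e: "e > 0" "inj_on f (ball (g1 y) e)"
      using locally_injective nz y(1) by metis
    let ?N = "(T \<inter> g1 -` ball (g1 y) e) \<inter> (T \<inter> g2 -` ball (g1 y) e)"
    show "\<exists>N. openin (top_of_set T) N \<and> y \<in> N \<and> N \<subseteq> ?S"
    proof (intro exI conjI)
      show "openin (top_of_set T) ?N"
        by (intro openin_Int continuous_openin_preimage_gen c1 c2) auto
      show "y \<in> ?N" using y e by auto
      show "?N \<subseteq> ?S"
        using e(2) eq by (auto dest: inj_onD)
    qed
  qed
  ultimately have "?S = {} \<or> ?S = T"
    using T unfolding connected_clopen by blast
  then show ?thesis using a x by auto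
qed

lemma local_inverse:
  assumes "deriv f z \<noteq> 0"
  obtains e k where "e > 0" "k holomorphic_on ball (f z) e" "k (f z) = z"
    "\<And>x. x \<in> ball (f z) e \<Longrightarrow> f (k x) = x"
proof -
  obtain r where r: "r > 0" "open (f ` ball z r)" "inj_on f (ball z r)"
    using has_complex_derivative_locally_invertible[of f UNIV z] assms by auto
  obtain k where k: "k holomorphic_on (f ` ball z r)" "\<And>x. x \<in> ball z r \<Longrightarrow> k (f x) = x"
    using holomorphic_has_inverse[OF hol_on open_ball r(3)] by metis
  have "f z \<in> f ` ball z r" using r(1) by simp
  then obtain e where e: "e > 0" "ball (f z) e \<subseteq> f ` ball z r"
    using r(2) open_contains_ball by metis
  show ?thesis
  proof (rule that[of e k])
    show "f (k x) = x" if "x \<in> ball (f z) e" for x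
      using that e k(2) by auto
  qed (use e k r in \<open>auto intro: holomorphic_on_subset\<close>)
qed

definition section_on :: "(complex \<Rightarrow> complex) \<Rightarrow> complex set \<Rightarrow> bool" where
  "section_on g B \<longleftrightarrow> g holomorphic_on B \<and> (\<forall>x\<in>B. f (g x) = x)"

lemma section_unique:
  assumes "section_on g B" "section_on h B" "connected B" "B \<inter> critical_values f = {}"
    "a \<in> B" "g a = h a" "x \<in> B"
  shows "g x = h x"
proof (rule lift_unique[of B g h a x, OF assms(3)])
  show "deriv f (g y) \<noteq> 0" if "y \<in> B" for y
    using assms(1,4) that by (intro not_crit) (auto simp: section_on_def)
qed (use assms in \<open>auto simp: section_on_def holomorphic_on_imp_continuous_on\<close>)

lemma section_on_subset: "section_on g B \<Longrightarrow> A \<subseteq> B \<Longrightarrow> section_on g A"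
  by (auto simp: section_on_def intro: holomorphic_on_subset)

lemma section_glue:
  assumes sec: "\<And>k B. (k, B) \<in> P \<Longrightarrow> open B \<and> section_on k B"
    and agree: "\<And>k B k' B' x. (k, B) \<in> P \<Longrightarrow> (k', B') \<in> P \<Longrightarrow> x \<in> B \<Longrightarrow> x \<in> B' \<Longrightarrow> k x = k' x"
  shows "\<exists>h. section_on h (\<Union>p\<in>P. snd p) \<and> (\<forall>k B x. (k, B) \<in> P \<longrightarrow> x \<in> B \<longrightarrow> h x = k x)"
proof -
  define h where "h = (\<lambda>x. fst (SOME p. p \<in> P \<and> x \<in> snd p) x)"
  have h: "h x = k x" if kB: "(k, B) \<in> P" "x \<in> B" for k B x
  proof -
    define p where "p = (SOME p. p \<in> P \<and> x \<in> snd p)"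
    have "p \<in> P \<and> x \<in> snd p"
      unfolding p_def by (rule someI[of _ "(k, B)"]) (use kB in simp)
    then show ?thesis using agree[of "fst p" "snd p" k B x] kB by (simp add: h_def p_def)
  qed
  have "section_on h (\<Union>p\<in>P. snd p)"
    unfolding section_on_def
  proof (intro conjI ballI)
    show "h holomorphic_on (\<Union>p\<in>P. snd p)"
    proof (rule holomorphic_on_UN_open)
      show "open (snd p)" if "p \<in> P" for p using sec[of "fst p" "snd p"] that by simp
      show "h holomorphic_on snd p" if "p \<in> P" for p
        using sec[of "fst p" "snd p"] h[of "fst p" "snd p"] that
        by (auto simp: section_on_def intro: holomorphic_transform[of "fst p"])
    qed
    fix x assume "x \<in> (\<Union>p\<in>P. snd p)"
    then obtain k B where "(k, B) \<in> P" "x \<in> B" by fastforce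
    then show "f (h x) = x" using h sec by (simp add: section_on_def)
  qed
  then show ?thesis using h by blast
qed

text \<open>Along the radius towards \<open>u\<close> the values of \<open>g\<close> form a curve
  whose image under \<open>f\<close> tends to \<open>u\<close>. The curve lands at a preimage of
  \<open>u\<close>, which is not critical, and a local inverse there continues
  \<open>g\<close>.\<close>

lemma section_at_boundary:
  assumes g: "section_on g (ball w \<rho>)" and \<rho>: "\<rho> > 0" and u: "u \<in> sphere w \<rho>"
    "u \<notin> critical_values f" and nc: "ball w \<rho> \<inter> critical_values f = {}"
  obtains e k where "e > 0" "section_on k (ball u e)" "\<And>x. x \<in> ball u e \<inter> ball w \<rho> \<Longrightarrow> k x = g x"
proof -
  \<comment> \<open>The factor \<open>s / (1 + s)\<close> runs through [0, 1), so the radius becomes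
    a curve over the nonnegative reals, the form in which \<open>landing\<close> takes
    curves.\<close>
  define p where "p = (\<lambda>s::real. w + of_real (s / (1 + s)) * (u - w))"
  have nu: "norm (u - w) = \<rho>" using u(1) by (simp add: dist_norm norm_minus_commute)
  have pb: "p s \<in> ball w \<rho>" if "s \<ge> 0" for s
  proof -
    have "norm (p s - w) = norm (of_real (s / (1 + s)) :: complex) * norm (u - w)"
      unfolding p_def by (simp only: add_diff_cancel_left' norm_mult)
    then have "dist w (p s) = s / (1 + s) * \<rho>"
      using that by (simp only: norm_of_real nu dist_norm norm_minus_commute) simp
    also have "\<dots> < 1 * \<rho>" using that \<rho> by (intro mult_strict_right_mono) auto
    finally show ?thesis by simp
  qed
  have contp: "continuous_on {0..} p"
    unfolding p_def by (intro continuous_intros) auto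
  have "((\<lambda>s::real. s / (1 + s)) \<longlongrightarrow> 1) at_top" by real_asymp
  then have "((\<lambda>s. w + of_real (s / (1 + s)) * (u - w)) \<longlongrightarrow> w + of_real 1 * (u - w)) at_top"
    by (intro tendsto_intros)
  then have plim: "(p \<longlongrightarrow> u) at_top" by (simp add: p_def)
  have "continuous_on {0..} (\<lambda>s. g (p s))"
  proof (rule continuous_on_compose2[of "ball w \<rho>" g])
    show "continuous_on (ball w \<rho>) g"
      using g by (auto simp: section_on_def holomorphic_on_imp_continuous_on)
  qed (use contp pb in auto)
  moreover have "((\<lambda>s. f (g (p s))) \<longlongrightarrow> u) at_top"
  proof (rule Lim_transform_eventually[OF plim])
    show "\<forall>\<^sub>F s in at_top. p s = f (g (p s))"
      using g pb by (intro eventually_at_top_linorderI[of 0]) (auto simp: section_on_def)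
  qed
  ultimately obtain z where z: "((\<lambda>s. g (p s)) \<longlongrightarrow> z) at_top" "f z = u"
    by (rule landing)
  have dz: "deriv f z \<noteq> 0" using not_crit u(2) z(2) by auto
  obtain e k where k: "e > 0" "k holomorphic_on ball u e" "k u = z" "\<And>x. x \<in> ball u e \<Longrightarrow> f (k x) = x"
    using local_inverse[OF dz] z(2) by metis
  have sk: "section_on k (ball u e)" using k by (auto simp: section_on_def)
  obtain d where d: "d > 0" "inj_on f (ball z d)" using locally_injective[OF dz] .
  have "isCont k u"
    using k(1,2) by (meson centre_in_ball continuous_on_eq_continuous_at holomorphic_on_imp_continuous_on open_ball)
  then have "((\<lambda>s. k (p s)) \<longlongrightarrow> z) at_top"
    using isCont_tendsto_compose[OF _ plim, of k] k(3) by simp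
  then have "\<forall>\<^sub>F s in at_top. dist (k (p s)) z < d" using d(1) tendstoD by blast
  moreover have "\<forall>\<^sub>F s in at_top. dist (g (p s)) z < d" using z(1) d(1) tendstoD by blast
  moreover have "\<forall>\<^sub>F s in at_top. dist (p s) u < e" using plim k(1) tendstoD by blast
  moreover have "\<forall>\<^sub>F s in at_top. s \<ge> (0::real)" by (rule eventually_ge_at_top)
  ultimately have "\<forall>\<^sub>F s in at_top. dist (k (p s)) z < d \<and> dist (g (p s)) z < d \<and> dist (p s) u < e \<and> s \<ge> 0"
    by eventually_elim simp
  then obtain s where s: "dist (k (p s)) z < d" "dist (g (p s)) z < d" "dist (p s) u < e" "s \<ge> 0"
    using eventually_happens'[of at_top] by force
  have ps: "p s \<in> ball u e \<inter> ball w \<rho>" using s pb by (auto simp: dist_commute)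
  \<comment> \<open>Both values lie in a disk about \<open>z\<close> on which \<open>f\<close> is
    injective, so the branches agree at one point; the intersection of their domains is convex,
    which spreads the agreement.\<close>
  have "f (k (p s)) = f (g (p s))"
    using ps g sk by (simp add: section_on_def)
  then have eq: "k (p s) = g (p s)"
    using d(2) s by (auto simp: dist_commute dest: inj_onD)
  show ?thesis
  proof (rule that[OF k(1) sk])
    fix x assume x: "x \<in> ball u e \<inter> ball w \<rho>"
    show "k x = g x"
    proof (rule section_unique[of k "ball u e \<inter> ball w \<rho>" g "p s"])
      show "connected (ball u e \<inter> ball w \<rho>)"
        by (intro convex_connected convex_Int) auto
    qed (use x ps eq sk g nc in \<open>auto intro: section_on_subset\<close>)
  qed
qed

lemma section_extend:
  assumes g: "section_on g (ball w \<rho>)" and \<rho>: "\<rho> > 0" "\<rho> < r"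
    and nc: "ball w r \<inter> critical_values f = {}"
  obtains \<rho>' h where "\<rho>' > \<rho>" "section_on h (ball w \<rho>')" "h w = g w"
proof -
  have "ball w \<rho> \<subseteq> ball w r" "sphere w \<rho> \<subseteq> ball w r"
    using \<rho> by auto
  then have nc': "ball w \<rho> \<inter> critical_values f = {}" "sphere w \<rho> \<inter> critical_values f = {}"
    using nc by blast+
  have "\<exists>e k. e > 0 \<and> section_on k (ball u e) \<and> (\<forall>x\<in>ball u e \<inter> ball w \<rho>. k x = g x)"
    if "u \<in> sphere w \<rho>" for u
    using section_at_boundary[OF g \<rho>(1) that _ nc'(1)] nc'(2) that by (metis disjoint_iff)
  then obtain E where E: "\<And>u. u \<in> sphere w \<rho> \<Longrightarrow> E u > 0 \<and>
      (\<exists>k. section_on k (ball u (E u)) \<and> (\<forall>x\<in>ball u (E u) \<inter> ball w \<rho>. k x = g x))"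
    by metis
  \<comment> \<open>A Lebesgue number of this cover makes the radius of continuation the same at all
    boundary points; equal radii are needed for the midpoint argument below.\<close>
  have "sphere w \<rho> \<subseteq> \<Union>((\<lambda>u. ball u (E u)) ` sphere w \<rho>)"
    using E by force
  then obtain e0 where e0: "e0 > 0" "\<And>x. x \<in> sphere w \<rho> \<Longrightarrow>
      \<exists>G\<in>(\<lambda>u. ball u (E u)) ` sphere w \<rho>. ball x e0 \<subseteq> G"
    by (rule Heine_Borel_lemma[OF compact_sphere]) auto
  define e where "e = min e0 (r - \<rho>)"
  have epos: "e > 0" using e0 \<rho> by (simp add: e_def)
  have "\<exists>k. section_on k (ball x e) \<and> (\<forall>y\<in>ball x e \<inter> ball w \<rho>. k y = g y)"
    if xs: "x \<in> sphere w \<rho>" for x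
  proof -
    obtain u where u: "u \<in> sphere w \<rho>" "ball x e0 \<subseteq> ball u (E u)" using e0(2)[OF xs] by auto
    then have "ball x e \<subseteq> ball u (E u)" by (auto simp: e_def)
    then show ?thesis using E[OF u(1)] by (blast intro: section_on_subset)
  qed
  then obtain K where K: "\<And>x. x \<in> sphere w \<rho> \<Longrightarrow> section_on (K x) (ball x e)"
      "\<And>x y. x \<in> sphere w \<rho> \<Longrightarrow> y \<in> ball x e \<inter> ball w \<rho> \<Longrightarrow> K x y = g y"
    by metis
  have ncs: "ball u e \<inter> critical_values f = {}" if "u \<in> sphere w \<rho>" for u
  proof -
    have "ball u e \<subseteq> ball w r"
    proof
      fix x assume "x \<in> ball u e"
      then show "x \<in> ball w r"
        using that dist_triangle[of w x u] by (auto simp: e_def)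
    qed
    then show ?thesis using nc by blast
  qed
  have KK: "K u y = K v y" if uv: "u \<in> sphere w \<rho>" "v \<in> sphere w \<rho>"
    and y: "y \<in> ball u e \<inter> ball v e" for u v y
  proof (cases "u = v")
    case False
    \<comment> \<open>Two overlapping disks of radius \<open>e\<close> about points of the circle
      share the midpoint of their centres, and this point lies in \<open>ball w \<rho>\<close>,
      where both continuations equal \<open>g\<close>.\<close>
    define q where "q = midpoint u v"
    have "dist u v < 2 * e" using y dist_triangle[of u v y] by (simp add: dist_commute)
    then have q: "q \<in> ball u e" "q \<in> ball v e" by (simp_all add: q_def dist_midpoint)
    have "q \<in> open_segment u v" using False by (simp add: q_def)
    then have qw: "q \<in> ball w \<rho>" using dist_decreases_open_segment[of q u v w] uv by auto
    show ?thesis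
    proof (rule section_unique[of "K u" "ball u e \<inter> ball v e" "K v" q])
      show "connected (ball u e \<inter> ball v e)" by (intro convex_connected convex_Int) auto
      show "K u q = K v q" using K(2)[of u q] K(2)[of v q] uv q qw by auto
    qed (use K(1) uv y ncs q in \<open>auto intro: section_on_subset\<close>)
  qed simp
  define P where "P = insert (g, ball w \<rho>) ((\<lambda>u. (K u, ball u e)) ` sphere w \<rho>)"
  have sec: "open B \<and> section_on k B" if "(k, B) \<in> P" for k B
    using that g K(1) by (auto simp: P_def)
  have agree: "k x = k' x" if "(k, B) \<in> P" "(k', B') \<in> P" "x \<in> B" "x \<in> B'" for k B k' B' x
  proof -
    have cases: "k = g \<and> B = ball w \<rho> \<or> (\<exists>u\<in>sphere w \<rho>. k = K u \<and> B = ball u e)" if "(k, B) \<in> P" for k B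
      using that by (auto simp: P_def)
    show ?thesis
      using cases[OF that(1)] cases[OF that(2)]
    proof (elim disjE bexE conjE)
      fix u v assume "u \<in> sphere w \<rho>" "v \<in> sphere w \<rho>" "k = K u" "k' = K v" "B = ball u e" "B' = ball v e"
      then show ?thesis using KK[of u v x] that(3,4) by blast
    next
      fix u assume "u \<in> sphere w \<rho>" "k = g" "k' = K u" "B = ball w \<rho>" "B' = ball u e"
      then show ?thesis using K(2)[of u x] that(3,4) by simp
    next
      fix u assume "u \<in> sphere w \<rho>" "k = K u" "k' = g" "B = ball u e" "B' = ball w \<rho>"
      then show ?thesis using K(2)[of u x] that(3,4) by simp
    qed simp
  qed
  have "\<exists>h. section_on h (\<Union>p\<in>P. snd p) \<and> (\<forall>k B x. (k, B) \<in> P \<longrightarrow> x \<in> B \<longrightarrow> h x = k x)"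
    by (rule section_glue) (erule sec, erule (3) agree)
  then obtain h where h: "section_on h (\<Union>p\<in>P. snd p)" "\<And>k B x. (k, B) \<in> P \<Longrightarrow> x \<in> B \<Longrightarrow> h x = k x"
    by blast
  have "ball w (\<rho> + e) \<subseteq> (\<Union>p\<in>P. snd p)"
  proof
    fix x assume x: "x \<in> ball w (\<rho> + e)"
    show "x \<in> (\<Union>p\<in>P. snd p)"
    proof (cases "x \<in> ball w \<rho>")
      case False
      define N where "N = norm (x - w)"
      define u where "u = w + of_real (\<rho> / N) * (x - w)"
      have N: "\<rho> \<le> N" "N < \<rho> + e" "N > 0"
        using x False \<rho> by (auto simp: N_def dist_norm norm_minus_commute)
      have u: "u \<in> sphere w \<rho>"
        using N \<rho> by (simp add: u_def dist_norm norm_mult norm_divide flip: N_def)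
      have "x - u = of_real ((N - \<rho>) / N) * (x - w)"
        using N by (simp add: u_def field_simps)
      then have "norm (x - u) = \<bar>(N - \<rho>) / N\<bar> * N"
        by (simp only: norm_mult norm_of_real N_def)
      also have "\<dots> = N - \<rho>" using N by simp
      finally have "x \<in> ball u e" using N by (simp add: dist_norm norm_minus_commute)
      then show ?thesis using u by (auto simp: P_def)
    qed (auto simp: P_def)
  qed
  then have "section_on h (ball w (\<rho> + e))" using h(1) section_on_subset by blast
  moreover have "h w = g w" by (rule h(2)[of g "ball w \<rho>"]) (use \<rho> in \<open>auto simp: P_def\<close>)
  ultimately show ?thesis using that[of "\<rho> + e" h] epos by simp
qed

text \<open>Branches starting at \<open>z0\<close> exist on small disks and agree on overlaps, and
  by \<open>section_extend\<close> the supremum of their radii cannot stop short of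
  \<open>r\<close>. Here the absence of asymptotic values becomes a covering property.\<close>

lemma section_ball:
  assumes nc: "ball w r \<inter> critical_values f = {}" and r: "r > 0" and z0: "f z0 = w"
  obtains g where "section_on g (ball w r)" "g w = z0"
proof -
  define S where "S = {s. 0 < s \<and> s \<le> r \<and> (\<exists>h. section_on h (ball w s) \<and> h w = z0)}"
  have "w \<notin> critical_values f" using nc r by (metis IntI centre_in_ball empty_iff)
  then obtain e k where k: "e > 0" "k holomorphic_on ball w e" "k w = z0" "\<And>x. x \<in> ball w e \<Longrightarrow> f (k x) = x"
    using local_inverse[OF not_crit, of z0] z0 by metis
  have "ball w (min e r) \<subseteq> ball w e" by auto
  moreover have "section_on k (ball w e)" using k by (auto simp: section_on_def)
  ultimately have "section_on k (ball w (min e r))"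
    by (meson section_on_subset)
  moreover have "0 < min e r" "min e r \<le> r" using k r by auto
  ultimately have Sne: "min e r \<in> S" unfolding S_def using k(3) by blast
  have Sbd: "bdd_above S" by (auto simp: S_def bdd_above_def)
  define \<rho> where "\<rho> = Sup S"
  have \<rho>r: "\<rho> \<le> r" unfolding \<rho>_def
  proof (rule cSup_least)
    show "S \<noteq> {}" using Sne by blast
  qed (auto simp: S_def)
  have \<rho>S: "s \<le> \<rho>" if "s \<in> S" for s unfolding \<rho>_def using that Sbd by (rule cSup_upper)
  have "\<rho> > 0" using \<rho>S[OF Sne] k r by auto
  define P where "P = {(h, ball w s) | h s. 0 < s \<and> s \<le> r \<and> section_on h (ball w s) \<and> h w = z0}"
  have sec: "open B \<and> section_on k B" if "(k, B) \<in> P" for k B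
    using that by (auto simp: P_def)
  have agree: "k x = k' x" if kB: "(k, B) \<in> P" "(k', B') \<in> P" "x \<in> B" "x \<in> B'" for k B k' B' x
  proof -
    obtain s where s: "0 < s" "s \<le> r" "section_on k (ball w s)" "k w = z0" "B = ball w s"
      using kB(1) by (auto simp: P_def)
    obtain s' where s': "0 < s'" "s' \<le> r" "section_on k' (ball w s')" "k' w = z0" "B' = ball w s'"
      using kB(2) by (auto simp: P_def)
    show ?thesis
    proof (rule section_unique[of k "ball w (min s s')" k' w x])
      show "section_on k (ball w (min s s'))" "section_on k' (ball w (min s s'))"
        by (rule section_on_subset[OF s(3) subset_ball[OF min.cobounded1]],
            rule section_on_subset[OF s'(3) subset_ball[OF min.cobounded2]])
      have "ball w (min s s') \<subseteq> ball w r" using s(2) by (intro subset_ball) simp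
      then show "ball w (min s s') \<inter> critical_values f = {}" using nc by blast
    qed (use s s' kB in auto)
  qed
  have "\<exists>h. section_on h (\<Union>p\<in>P. snd p) \<and> (\<forall>k B x. (k, B) \<in> P \<longrightarrow> x \<in> B \<longrightarrow> h x = k x)"
    by (rule section_glue) (erule sec, erule (3) agree)
  then obtain g where g: "section_on g (\<Union>p\<in>P. snd p)" "\<And>k B x. (k, B) \<in> P \<Longrightarrow> x \<in> B \<Longrightarrow> g x = k x"
    by blast
  have "ball w \<rho> \<subseteq> (\<Union>p\<in>P. snd p)"
  proof
    fix x assume "x \<in> ball w \<rho>"
    then obtain s where s: "s \<in> S" "x \<in> ball w s"
      using less_cSup_iff[of S "dist w x"] Sne Sbd by (auto simp: \<rho>_def)
    then obtain h where "(h, ball w s) \<in> P" by (auto simp: S_def P_def)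
    then show "x \<in> (\<Union>p\<in>P. snd p)" using s(2) by force
  qed
  then have sg: "section_on g (ball w \<rho>)" using g(1) section_on_subset by blast
  obtain h s where "0 < s" "s \<le> r" "section_on h (ball w s)" "h w = z0"
    using Sne unfolding S_def by blast
  then have hs: "(h, ball w s) \<in> P" "h w = z0" "0 < s" unfolding P_def by blast+
  then have gw: "g w = z0" using g(2)[OF hs(1), of w] by simp
  have "\<rho> = r"
  proof (rule ccontr)
    assume "\<rho> \<noteq> r"
    then have "\<rho> < r" using \<rho>r by simp
    then obtain \<rho>' h where h: "\<rho>' > \<rho>" "section_on h (ball w \<rho>')" "h w = g w"
      using section_extend[OF sg \<open>\<rho> > 0\<close> _ nc] by metis
    have "ball w (min \<rho>' r) \<subseteq> ball w \<rho>'" by auto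
    then have "section_on h (ball w (min \<rho>' r))" using h(2) section_on_subset by blast
    moreover have "0 < min \<rho>' r" "min \<rho>' r \<le> r" using h(1) \<open>\<rho> > 0\<close> r by auto
    moreover have "h w = z0" using h(3) gw by simp
    ultimately have "min \<rho>' r \<in> S" unfolding S_def by blast
    then show False using \<rho>S[of "min \<rho>' r"] h(1) \<open>\<rho> < r\<close> by auto
  qed
  then show ?thesis using that sg gw by simp
qed

section \<open>The covering property off the critical values\<close>

lemma closed_critical_values: "closed (critical_values f)"
  using finite_crit finite_imp_closed by blast

lemma evenly_covered:
  assumes "w \<notin> critical_values f"
  obtains r where "r > 0" "ball w r \<inter> critical_values f = {}"
    "\<And>z. f z \<in> ball w r \<Longrightarrow> \<exists>g. section_on g (ball w r) \<and> g (f z) = z"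
proof -
  have "open (- critical_values f)" using closed_critical_values by auto
  then obtain r where r: "r > 0" "ball w r \<subseteq> - critical_values f"
    using assms open_contains_ball by blast
  show ?thesis
  \<comment> \<open>If \<open>f z\<close> is within \<open>r/3\<close> of \<open>w\<close>, the disk
    of radius \<open>2 * r/3\<close> about \<open>f z\<close> still avoids the critical values and
    contains \<open>ball w (r/3)\<close>, so one radius serves all preimages.\<close>
  proof (rule that[of "r/3"])
    show "\<exists>g. section_on g (ball w (r/3)) \<and> g (f z) = z" if z: "f z \<in> ball w (r/3)" for z
    proof -
      have "ball (f z) (2 * r/3) \<subseteq> ball w r"
      proof
        fix x assume "x \<in> ball (f z) (2 * r/3)"
        then show "x \<in> ball w r" using z dist_triangle[of w x "f z"] by auto
      qed
      then have disj: "ball (f z) (2 * r/3) \<inter> critical_values f = {}" using r by blast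
      have "2 * r / 3 > 0" using r by simp
      from section_ball[OF disj this refl]
      obtain g where g: "section_on g (ball (f z) (2 * r/3))" "g (f z) = z" .
      have "ball w (r/3) \<subseteq> ball (f z) (2 * r/3)"
      proof
        fix x assume "x \<in> ball w (r/3)"
        then show "x \<in> ball (f z) (2 * r/3)" using z dist_triangle[of "f z" x w] by (auto simp: dist_commute)
      qed
      then show ?thesis using g section_on_subset by blast
    qed
    have "ball w (r/3) \<subseteq> ball w r" using r by auto
    then show "ball w (r/3) \<inter> critical_values f = {}" using r by blast
  qed (use r in auto)
qed

lemma connected_Compl_critical: "connected (- critical_values f)"
  using path_connected_complement_countable[of "critical_values f"] finite_crit
  by (simp add: countable_finite path_connected_imp_connected)

lemma surj_off_critical: "f ` {z. f z \<notin> critical_values f} = - critical_values f"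
proof -
  let ?I = "f ` {z. f z \<notin> critical_values f}"
  have "\<exists>z. f z \<notin> critical_values f"
  proof (rule ccontr)
    assume "\<not> ?thesis"
    then have "finite (range f)" using finite_crit by (auto intro: finite_subset)
    then have "f constant_on UNIV"
      using continuous_finite_range_constant[of UNIV f] by auto
    then show False using nonconst by simp
  qed
  then obtain w0 where w0: "w0 \<in> - critical_values f" "w0 \<in> ?I" by blast
  have "w \<in> ?I" if w: "w \<in> - critical_values f" for w
  proof (rule connected_induction_simple[of _ w0 w "\<lambda>w. w \<in> ?I", OF connected_Compl_critical w0(1) w w0(2)])
    fix x assume "x \<in> - critical_values f"
    then obtain r where r: "r > 0" "ball x r \<inter> critical_values f = {}"
      "\<And>z. f z \<in> ball x r \<Longrightarrow> \<exists>g. section_on g (ball x r) \<and> g (f z) = z"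
      using evenly_covered[of x] by auto
    have "openin (top_of_set (- critical_values f)) (ball x r)"
      using r(2) closed_critical_values by (intro open_openin_trans) auto
    moreover have "v \<in> ?I" if uv: "u \<in> ball x r" "v \<in> ball x r" "u \<in> ?I" for u v
    proof -
      obtain g where "section_on g (ball x r)" using r(3) uv by blast
      then have "f (g v) = v" using uv(2) by (simp add: section_on_def)
      moreover from this have "f (g v) \<notin> critical_values f" using r(2) uv(2) by auto
      ultimately show ?thesis by (intro image_eqI[of _ _ "g v"]) auto
    qed
    ultimately show "\<exists>T. openin (top_of_set (- critical_values f)) T \<and> x \<in> T \<and> (\<forall>u\<in>T. \<forall>v\<in>T. u \<in> ?I \<longrightarrow> v \<in> ?I)"
      using centre_in_ball[THEN iffD2, OF r(1)] by blast
  qed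
  then show ?thesis by auto
qed

text \<open>The sheets over an evenly covered disk are the images of the branches on it;
  \<open>section_unique\<close> makes distinct ones disjoint.\<close>

theorem covering_off_critical:
  "covering_space {z. f z \<notin> critical_values f} f (- critical_values f)"
proof (rule covering_spaceI[OF cont_on surj_off_critical])
  fix x assume "x \<in> - critical_values f"
  then obtain r where r: "r > 0" "ball x r \<inter> critical_values f = {}"
    "\<And>z. f z \<in> ball x r \<Longrightarrow> \<exists>g. section_on g (ball x r) \<and> g (f z) = z"
    using evenly_covered[of x] by auto
  let ?T = "ball x r" and ?C = "{z. f z \<notin> critical_values f}"
  let ?V = "{g ` ?T | g. section_on g ?T}"
  show "\<exists>T. x \<in> T \<and> openin (top_of_set (- critical_values f)) T \<and>
             (\<exists>v. \<Union> v = ?C \<inter> f -` T \<and> (\<forall>u\<in>v. openin (top_of_set ?C) u) \<and>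
             pairwise disjnt v \<and> (\<forall>u\<in>v. \<exists>q. homeomorphism u T f q))"
  proof (intro exI[of _ ?T] conjI exI[of _ ?V] ballI)
    show "x \<in> ?T" using r by simp
    show "openin (top_of_set (- critical_values f)) ?T"
      using r(2) closed_critical_values by (intro open_openin_trans) auto
    show "\<Union> ?V = ?C \<inter> f -` ?T"
    proof (intro equalityI subsetI)
      fix z assume "z \<in> \<Union> ?V"
      then obtain g y where "section_on g ?T" "y \<in> ?T" "z = g y" by blast
      then have "f z = y" "y \<in> ?T" by (auto simp: section_on_def)
      then show "z \<in> ?C \<inter> f -` ?T" using r(2) by blast
    next
      fix z assume "z \<in> ?C \<inter> f -` ?T"
      then obtain g where g: "section_on g ?T" "g (f z) = z" "f z \<in> ?T" using r(3) by blast
      then have "z \<in> g ` ?T" by (intro image_eqI[of _ _ "f z"]) auto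
      then show "z \<in> \<Union> ?V" using g(1) by blast
    qed
    show "pairwise disjnt ?V"
    proof (clarsimp simp: pairwise_def)
      fix g h assume g: "section_on g ?T" and h: "section_on h ?T" and ne: "g ` ?T \<noteq> h ` ?T"
      show "disjnt (g ` ?T) (h ` ?T)"
      proof (rule ccontr)
        assume "\<not> ?thesis"
        then obtain y y' where y: "y \<in> ?T" "y' \<in> ?T" "g y = h y'" by (auto simp: disjnt_def)
        have "f (g y) = y" using g y(1) by (simp add: section_on_def del: mem_ball)
        moreover have "f (h y') = y'" using h y(2) by (simp add: section_on_def del: mem_ball)
        ultimately have "y = y'" using y(3) by simp
        have "g z = h z" if "z \<in> ?T" for z
        proof (rule section_unique[OF g h _ r(2) y(1) _ that])
          show "g y = h y" using y(3) \<open>y = y'\<close> by simp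
        qed (rule connected_ball)
        then have "g ` ?T = h ` ?T" by (rule image_cong[OF refl])
        then show False using ne by contradiction
      qed
    qed
    fix u assume "u \<in> ?V"
    then obtain g where g: "section_on g ?T" "u = g ` ?T" by auto
    have fg: "f (g y) = y" if "y \<in> ?T" for y
      using g(1) that unfolding section_on_def by blast
    have inj: "inj_on g ?T"
      by (rule inj_on_inverseI[of _ f]) (use g(1) in \<open>auto simp: section_on_def\<close>)
    have "open u"
      using g inj open_mapping_thm3[of g ?T] by (auto simp: section_on_def)
    moreover have "u \<subseteq> ?C" using g r(2) by (auto simp: section_on_def)
    ultimately show "openin (top_of_set ?C) u" by (rule open_subset[rotated])
    show "\<exists>q. homeomorphism u ?T f q"
    proof (intro exI[of _ g] homeomorphismI)
      show "continuous_on ?T g" using g(1) by (auto simp: section_on_def holomorphic_on_imp_continuous_on)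
    qed (use g in \<open>auto simp: section_on_def\<close>)
  qed
qed

text \<open>The covering lifts \<open>q\<close> continuously because \<open>S\<close> is simply
  connected, and the lift is holomorphic since locally it is a branch composed with
  \<open>q\<close>. A general \<open>q\<close> permits lifting exponentials, which is needed for the
  tracts and for a punctured disk.\<close>

theorem lift_exists:
  fixes q :: "complex \<Rightarrow> complex"
  assumes S: "open S" "simply_connected S" and q: "q holomorphic_on S"
    and nc: "q ` S \<inter> critical_values f = {}" and s0: "s0 \<in> S" "f z0 = q s0"
  obtains \<phi> where "\<phi> holomorphic_on S" "\<phi> s0 = z0" "\<And>s. s \<in> S \<Longrightarrow> f (\<phi> s) = q s"
proof -
  have z0: "z0 \<in> {z. f z \<notin> critical_values f}" using s0 nc by auto
  have qS: "q \<in> S \<rightarrow> - critical_values f" using nc by auto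
  obtain \<phi> where \<phi>: "continuous_on S \<phi>" "\<phi> \<in> S \<rightarrow> {z. f z \<notin> critical_values f}" "\<phi> s0 = z0"
      "\<And>s. s \<in> S \<Longrightarrow> f (\<phi> s) = q s"
    using covering_space_lift_strong[OF covering_off_critical z0 s0(1) S(2)
        open_imp_locally_path_connected[OF S(1)] holomorphic_on_imp_continuous_on[OF q] qS] s0(2)
    by metis
  have "\<phi> holomorphic_on S"
    unfolding holomorphic_on_open[OF S(1)] field_differentiable_def[symmetric]
  proof
    fix s assume s: "s \<in> S"
    have "q s \<notin> critical_values f" using nc s by blast
    then obtain r where r: "r > 0" "ball (q s) r \<inter> critical_values f = {}"
        "\<And>z. f z \<in> ball (q s) r \<Longrightarrow> \<exists>g. section_on g (ball (q s) r) \<and> g (f z) = z"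
      using evenly_covered by auto
    then obtain g where g: "section_on g (ball (q s) r)" "g (q s) = \<phi> s"
      using r(3)[of "\<phi> s"] \<phi>(4)[OF s] by auto
    have "isCont q s"
      using q S(1) s continuous_on_eq_continuous_at holomorphic_on_imp_continuous_on by blast
    then obtain d1 where d1: "d1 > 0" "\<And>y. dist y s < d1 \<Longrightarrow> dist (q y) (q s) < r"
      using r(1) unfolding continuous_at_eps_delta by blast
    obtain d2 where d2: "d2 > 0" "ball s d2 \<subseteq> S" using S(1) s open_contains_ball by blast
    define B where "B = ball s (min d1 d2)"
    have B: "B \<subseteq> S" "q ` B \<subseteq> ball (q s) r" "s \<in> B"
      using d1 d2 by (auto simp: B_def dist_commute)
    have hol: "(\<lambda>y. g (q y)) holomorphic_on B"
      using holomorphic_on_compose_gen[OF holomorphic_on_subset[OF q B(1)] _ B(2), of g] g(1)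
      by (simp add: section_on_def o_def)
    have fg: "f (g (q y)) = q y" if "y \<in> B" for y
      using g(1) B(2) that by (auto simp: section_on_def)
    have "g (q y) = \<phi> y" if y: "y \<in> B" for y
    proof (rule lift_unique[of B "\<lambda>y. g (q y)" \<phi> s y])
      show "f (g (q x)) = f (\<phi> x)" if "x \<in> B" for x using fg[OF that] \<phi>(4) B(1) that by auto
      show "deriv f (g (q x)) \<noteq> 0" if "x \<in> B" for x
        using fg[OF that] nc B(1) that by (intro not_crit) auto
    qed (use g(2) B y hol \<phi>(1) in \<open>auto simp: B_def holomorphic_on_imp_continuous_on intro: continuous_on_subset\<close>)
    then have "\<phi> holomorphic_on B" by (rule holomorphic_transform[OF hol])
    then show "\<phi> field_differentiable at s"
      using B(3) by (auto simp: B_def intro: holomorphic_on_imp_differentiable_at)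
  qed
  then show ?thesis using that \<phi> by blast
qed

end

section \<open>Normal families and the Fatou set\<close>

text \<open>Montel's theorem, with infinity as a possible limit. After normalizing the omitted
  values to 0 and 1, \<open>GPicard3\<close> bounds the functions of modulus at most 1 at a base
  point; the others are replaced by their reciprocals, which omit the same values.\<close>

lemma normal_family_omitting_two:
  fixes F :: "(complex \<Rightarrow> complex) set"
  assumes W: "open W" "connected W" and hol: "\<And>h. h \<in> F \<Longrightarrow> h holomorphic_on W"
    and ab: "\<alpha> \<noteq> \<beta>" and om: "\<And>h z. h \<in> F \<Longrightarrow> z \<in> W \<Longrightarrow> h z \<noteq> \<alpha> \<and> h z \<noteq> \<beta>"
  shows "normal_family_on W F"
proof (cases "W = {}")
  case True
  then show ?thesis
    unfolding normal_family_on_def by (auto intro!: exI[of _ id] strict_mono_id simp: uniform_limit_iff)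
next
  case False
  then obtain w where w: "w \<in> W" by blast
  define X where "X = {h. h holomorphic_on W \<and> (\<forall>z\<in>W. h z \<noteq> 0 \<and> h z \<noteq> 1)}"
  have bnd: "\<exists>g r. g holomorphic_on W \<and> strict_mono (r :: nat \<Rightarrow> nat) \<and>
      (\<forall>K. compact K \<and> K \<subseteq> W \<longrightarrow> uniform_limit K (\<lambda>n. H (r n)) g sequentially)"
    if H: "\<And>n::nat. H n \<in> X" "\<And>n. norm (H n w) \<le> 1" for H
  proof -
    have "\<exists>B. \<forall>h\<in>range H. \<forall>z\<in>K. norm (h z) \<le> B" if K: "compact K" "K \<subseteq> W" for K
    proof -
      obtain B where "\<And>h z. h \<in> range H \<Longrightarrow> z \<in> K \<Longrightarrow> norm (h z) \<le> B"
        by (rule GPicard3[OF W w, of "range H" X K]) (use K H in \<open>auto simp: X_def\<close>)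
      then show ?thesis by blast
    qed
    note bd = this
    obtain g r where "g holomorphic_on W" "strict_mono (r :: nat \<Rightarrow> nat)"
      "\<And>K. compact K \<Longrightarrow> K \<subseteq> W \<Longrightarrow> uniform_limit K (H \<circ> r) g sequentially"
      by (rule Montel[OF W(1), of "range H" H, OF _ bd]) (use H in \<open>auto simp: X_def\<close>)
    then show ?thesis by (auto simp: o_def)
  qed
  show ?thesis
    unfolding normal_family_on_def
  proof (intro allI impI)
    fix s :: "nat \<Rightarrow> complex \<Rightarrow> complex" assume s: "range s \<subseteq> F"
    define H where "H = (\<lambda>n z. (s n z - \<alpha>) / (\<beta> - \<alpha>))"
    have sH: "s n z = \<alpha> + (\<beta> - \<alpha>) * H n z" for n z using ab by (simp add: H_def)
    have HX: "H n \<in> X" for n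
      using s hol om ab by (auto simp: X_def H_def intro!: holomorphic_intros)
    have HX': "(\<lambda>z. inverse (H n z)) \<in> X" for n
      using HX[of n] by (auto simp: X_def intro!: holomorphic_intros)
    have ul: "uniform_limit K (\<lambda>n. s (r n)) (\<lambda>z. \<alpha> + (\<beta> - \<alpha>) * g z) sequentially"
      if "uniform_limit K (\<lambda>n. H (r n)) g sequentially" for K r g
      unfolding sH by (intro uniform_limit_intros that)
    consider "infinite {n. norm (H n w) \<le> 1}" | "infinite {n. norm (H n w) > 1}"
    proof -
      have "{n. norm (H n w) \<le> 1} \<union> {n. norm (H n w) > 1} = UNIV" by auto
      then show ?thesis using that by (metis infinite_UNIV_nat finite_Un)
    qed
    then show "\<exists>r::nat\<Rightarrow>nat. strict_mono r \<and>
           ((\<exists>g. g holomorphic_on W \<and>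
               (\<forall>K. compact K \<and> K \<subseteq> W \<longrightarrow> uniform_limit K (\<lambda>n. s (r n)) g sequentially)) \<or>
            (\<forall>K B. compact K \<and> K \<subseteq> W \<longrightarrow>
               (\<forall>\<^sub>F n in sequentially. \<forall>z\<in>K. B < norm (s (r n) z))))"
    proof cases
      case 1
      then obtain r0 :: "nat \<Rightarrow> nat" where r0: "strict_mono r0" "\<And>n. norm (H (r0 n) w) \<le> 1"
        using infinite_enumerate by (metis (mono_tags, lifting) mem_Collect_eq)
      obtain g r where g: "g holomorphic_on W" "strict_mono (r :: nat \<Rightarrow> nat)"
          "\<And>K. compact K \<and> K \<subseteq> W \<Longrightarrow> uniform_limit K (\<lambda>n. H (r0 (r n))) g sequentially"
        using bnd[of "\<lambda>n. H (r0 n)"] HX r0(2) by blast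
      show ?thesis
      proof (intro exI[of _ "r0 \<circ> r"] conjI disjI1 exI[of _ "\<lambda>z. \<alpha> + (\<beta> - \<alpha>) * g z"] allI impI)
        show "strict_mono (r0 \<circ> r)" using r0 g by (simp add: strict_mono_o)
        show "(\<lambda>z. \<alpha> + (\<beta> - \<alpha>) * g z) holomorphic_on W" by (intro holomorphic_intros g)
      qed (use ul[where r = "r0 \<circ> r"] g(3) in simp)
    next
      case 2
      then obtain r0 :: "nat \<Rightarrow> nat" where r0: "strict_mono r0" "\<And>n. norm (H (r0 n) w) > 1"
        using infinite_enumerate by (metis (mono_tags, lifting) mem_Collect_eq)
      have "norm (inverse (H (r0 n) w)) \<le> 1" for n
        using r0(2)[of n] by (simp add: norm_inverse inverse_le_1_iff)
      then obtain g r where g: "g holomorphic_on W" "strict_mono (r :: nat \<Rightarrow> nat)"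
          "\<And>K. compact K \<and> K \<subseteq> W \<Longrightarrow> uniform_limit K (\<lambda>n z. inverse (H (r0 (r n)) z)) g sequentially"
        using bnd[of "\<lambda>n z. inverse (H (r0 n) z)"] HX' by blast
      have Hnz: "H n z \<noteq> 0" if "z \<in> W" for n z using HX that by (auto simp: X_def)
      \<comment> \<open>Hurwitz: a limit of zero-free functions is zero-free or identically zero. If
        it vanishes identically, the original functions tend to infinity locally uniformly.\<close>
      have dich: "(\<forall>z\<in>W. g z = 0) \<or> (\<forall>z\<in>W. g z \<noteq> 0)"
      proof (cases "g constant_on W")
        case True then show ?thesis by (auto simp: constant_on_def)
      next
        case False
        have "g z \<noteq> 0" if "z \<in> W" for z
        proof (rule Hurwitz_no_zeros[OF W _ g(1) _ False _ that, of "\<lambda>n z. inverse (H (r0 (r n)) z)"])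
          show "(\<lambda>z. inverse (H (r0 (r n)) z)) holomorphic_on W" for n using HX' by (auto simp: X_def)
        qed (use g(3) Hnz in auto)
        then show ?thesis by blast
      qed
      then show ?thesis
      proof
        assume g0: "\<forall>z\<in>W. g z = 0"
        show ?thesis
        proof (intro exI[of _ "r0 \<circ> r"] conjI disjI2 allI impI)
          show "strict_mono (r0 \<circ> r)" using r0 g by (simp add: strict_mono_o)
          fix K B assume K: "compact K \<and> K \<subseteq> W"
          define C where "C = (\<bar>B\<bar> + norm \<alpha> + 1) / norm (\<beta> - \<alpha>)"
          have C: "C > 0" using ab by (simp add: C_def add_nonneg_pos)
          have "\<forall>\<^sub>F n in sequentially. \<forall>z\<in>K. dist (inverse (H (r0 (r n)) z)) (g z) < inverse C"
            by (rule uniform_limitD[OF g(3)[OF K]]) (use C in simp)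
          then show "\<forall>\<^sub>F n in sequentially. \<forall>z\<in>K. B < norm (s ((r0 \<circ> r) n) z)"
          proof eventually_elim
            case (elim n)
            show ?case
            proof
              fix z assume z: "z \<in> K"
              then have zW: "z \<in> W" using K by blast
              have "norm (inverse (H (r0 (r n)) z)) < inverse C" using elim z g0 zW by auto
              then have "C < norm (H (r0 (r n)) z)"
                using C Hnz[OF zW, of "r0 (r n)"] by (simp add: norm_inverse)
              then have "C * norm (\<beta> - \<alpha>) < norm ((\<beta> - \<alpha>) * H (r0 (r n)) z)"
                using ab by (simp add: norm_mult)
              moreover have "C * norm (\<beta> - \<alpha>) = \<bar>B\<bar> + norm \<alpha> + 1" using ab by (simp add: C_def)
              moreover have "norm ((\<beta> - \<alpha>) * H (r0 (r n)) z) \<le> norm (s (r0 (r n)) z) + norm \<alpha>"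
                using norm_triangle_ineq4[of "s (r0 (r n)) z" \<alpha>] sH[of "r0 (r n)" z] by simp
              ultimately show "B < norm (s ((r0 \<circ> r) n) z)" by simp
            qed
          qed
        qed
      next
        assume gn: "\<forall>z\<in>W. g z \<noteq> 0"
        show ?thesis
        proof (intro exI[of _ "r0 \<circ> r"] conjI disjI1 exI[of _ "\<lambda>z. \<alpha> + (\<beta> - \<alpha>) * inverse (g z)"] allI impI)
          show "strict_mono (r0 \<circ> r)" using r0 g by (simp add: strict_mono_o)
          show "(\<lambda>z. \<alpha> + (\<beta> - \<alpha>) * inverse (g z)) holomorphic_on W"
            using gn by (intro holomorphic_intros g) auto
          fix K assume K: "compact K \<and> K \<subseteq> W"
          have "uniform_limit K (\<lambda>n. H (r0 (r n))) (\<lambda>z. inverse (g z)) sequentially"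
          proof (cases "K = {}")
            case False
            have "continuous_on K (\<lambda>z. norm (g z))"
              using K by (intro continuous_intros continuous_on_subset[OF holomorphic_on_imp_continuous_on[OF g(1)]]) auto
            then obtain y where y: "y \<in> K" "\<And>z. z \<in> K \<Longrightarrow> norm (g y) \<le> norm (g z)"
              using continuous_attains_inf[of K "\<lambda>z. norm (g z)"] K False by auto
            have "uniform_limit K (\<lambda>n z. inverse (inverse (H (r0 (r n)) z))) (inverse \<circ> g) sequentially"
              by (rule uniform_lim_inverse[OF g(3)[OF K] y(2)]) (use y K gn in auto)
            then show ?thesis by (simp add: o_def)
          qed (simp add: uniform_limit_iff)
          then show "uniform_limit K (\<lambda>n. s ((r0 \<circ> r) n)) (\<lambda>z. \<alpha> + (\<beta> - \<alpha>) * inverse (g z)) sequentially"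
            using ul[where K = K and r = "r0 \<circ> r"] by simp
        qed
      qed
    qed
  qed
qed

lemma normal_family_converges:
  assumes "normal_family_on W (range s)" and w: "w \<in> W" "\<And>n::nat. norm (s n w) \<le> B"
  obtains g r where "g holomorphic_on W" "strict_mono (r :: nat \<Rightarrow> nat)"
    "\<And>K. compact K \<Longrightarrow> K \<subseteq> W \<Longrightarrow> uniform_limit K (\<lambda>n. s (r n)) g sequentially"
proof -
  obtain r :: "nat \<Rightarrow> nat" where r: "strict_mono r"
    "(\<exists>g. g holomorphic_on W \<and> (\<forall>K. compact K \<and> K \<subseteq> W \<longrightarrow> uniform_limit K (\<lambda>n. s (r n)) g sequentially)) \<or>
     (\<forall>K B. compact K \<and> K \<subseteq> W \<longrightarrow> (\<forall>\<^sub>F n in sequentially. \<forall>z\<in>K. B < norm (s (r n) z)))"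
    using assms(1) unfolding normal_family_on_def by blast
  have "\<not> (\<forall>\<^sub>F n in sequentially. \<forall>z\<in>{w}. B < norm (s (r n) z))"
    using w(2) by (auto simp: eventually_sequentially not_less)
  moreover have "compact {w}" "{w} \<subseteq> W" using w by auto
  ultimately have "\<exists>g. g holomorphic_on W \<and>
      (\<forall>K. compact K \<and> K \<subseteq> W \<longrightarrow> uniform_limit K (\<lambda>n. s (r n)) g sequentially)"
    using r(2) by meson
  then show ?thesis using r(1) that by blast
qed

lemma locally_uniform_limit_pointwise:
  assumes "\<And>K. compact K \<Longrightarrow> K \<subseteq> W \<Longrightarrow> uniform_limit K s g sequentially" "z \<in> W"
  shows "(\<lambda>n. s n z) \<longlonglongrightarrow> g z"
  using tendsto_uniform_limitI[OF assms(1)[of "{z}"]] assms(2) by auto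

lemma normal_family_on_subset:
  "normal_family_on W F \<Longrightarrow> G \<subseteq> F \<Longrightarrow> normal_family_on W G"
  unfolding normal_family_on_def by (meson order_trans)

text \<open>A Hurwitz argument: on a small circle about \<open>w\<close> the limit \<open>g\<close>
  keeps distance \<open>m\<close> from \<open>g w\<close>. Errors below \<open>m / 4\<close> leave
  distance \<open>m / 2\<close> between \<open>s n\<close> on the circle and \<open>s n w\<close>,
  so by openness the image contains the disk of that radius about \<open>s n w\<close>, hence a disk
  about \<open>g w\<close> that does not depend on \<open>n\<close>.\<close>

lemma common_disk_in_images:
  assumes hol: "\<And>n. s n holomorphic_on W" and g: "g holomorphic_on W" and W: "open W" "connected W"
    and lim: "\<And>K. compact K \<Longrightarrow> K \<subseteq> W \<Longrightarrow> uniform_limit K s g sequentially"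
    and nc: "\<not> g constant_on W" and w: "w \<in> W"
  obtains \<eta> where "\<eta> > 0" "\<forall>\<^sub>F n in sequentially. ball (g w) \<eta> \<subseteq> s n ` W"
proof -
  obtain \<beta> where \<beta>: "\<beta> \<in> W" "g \<beta> \<noteq> g w"
    using nc w unfolding constant_on_def by metis
  obtain r where r: "0 < r" "ball w r \<subseteq> W" "\<And>z. z \<in> ball w r - {w} \<Longrightarrow> g z - g w \<noteq> 0"
    by (rule isolated_zeros[of "\<lambda>z. g z - g w" W w \<beta>]) (use \<beta> w W in \<open>auto intro!: holomorphic_intros g\<close>)
  define \<rho> where "\<rho> = r / 2"
  have \<rho>: "\<rho> > 0" "cball w \<rho> \<subseteq> ball w r" using r by (auto simp: \<rho>_def)
  have cW: "cball w \<rho> \<subseteq> W" using \<rho> r by blast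
  have "continuous_on (sphere w \<rho>) (\<lambda>z. norm (g z - g w))"
    using cW by (intro continuous_intros continuous_on_subset[OF holomorphic_on_imp_continuous_on[OF g]]) auto
  then obtain y where y: "y \<in> sphere w \<rho>" "\<And>z. z \<in> sphere w \<rho> \<Longrightarrow> norm (g y - g w) \<le> norm (g z - g w)"
    using continuous_attains_inf[of "sphere w \<rho>" "\<lambda>z. norm (g z - g w)"] \<rho>(1) by auto
  define m where "m = norm (g y - g w)"
  have "y \<in> ball w r - {w}" using y(1) \<rho> by auto
  then have m: "m > 0" using r(3) by (auto simp: m_def)
  have ev: "\<forall>\<^sub>F n in sequentially. \<forall>z\<in>cball w \<rho>. dist (s n z) (g z) < m / 4"
    using uniform_limitD[OF lim[OF compact_cball cW], of "m/4"] m by simp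
  show ?thesis
  proof (rule that[of "m / 4"])
    show "\<forall>\<^sub>F n in sequentially. ball (g w) (m / 4) \<subseteq> s n ` W"
      using ev
    proof eventually_elim
      case (elim n)
      have sW: "s n holomorphic_on cball w \<rho>" using hol cW holomorphic_on_subset by blast
      have wd: "dist (s n w) (g w) < m / 4" using elim \<rho> by simp
      have big: "m / 2 \<le> norm (s n z - s n w)" if z: "z \<in> sphere w \<rho>" for z
      proof -
        have "dist (s n z) (g z) < m / 4" using elim z by auto
        moreover have "m \<le> norm (g z - g w)" using y z by (simp add: m_def)
        moreover have "dist (g z) (g w) \<le> dist (g z) (s n z) + dist (s n z) (s n w) + dist (s n w) (g w)"
          by (smt (verit) dist_triangle)
        ultimately show ?thesis using wd by (simp add: dist_norm norm_minus_commute)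
      qed
      have "\<not> s n constant_on ball w \<rho>"
      proof
        assume "s n constant_on ball w \<rho>"
        then obtain c where c: "\<And>z. z \<in> ball w \<rho> \<Longrightarrow> s n z = c" by (auto simp: constant_on_def)
        have "s n y = c"
        proof (rule continuous_constant_on_closure[of "ball w \<rho>" "s n" c])
          show "continuous_on (closure (ball w \<rho>)) (s n)"
            using sW \<rho> by (simp add: holomorphic_on_imp_continuous_on)
        qed (use c y \<rho> in auto)
        then show False using big[OF y(1)] c[of w] \<rho> m by simp
      qed
      then have "open (s n ` ball w \<rho>)"
        using open_mapping_thm[of "s n" "ball w \<rho>" "ball w \<rho>"] sW
        by (meson ball_subset_cball connected_ball holomorphic_on_subset open_ball order_refl)
      then have "ball (s n w) (m / 2) \<subseteq> s n ` ball w \<rho>"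
        using ball_subset_open_map_image[of "ball w \<rho>" "s n" "m/2" w] sW \<rho> m big
        by (simp add: holomorphic_on_imp_continuous_on frontier_ball)
      moreover have "ball (g w) (m / 4) \<subseteq> ball (s n w) (m / 2)"
      proof
        fix x assume "x \<in> ball (g w) (m / 4)"
        then show "x \<in> ball (s n w) (m / 2)"
          using wd dist_triangle[of "s n w" x "g w"] by auto
      qed
      ultimately show ?case using cW by (meson ball_subset_cball image_mono order_trans)
    qed
  qed (use m in simp)
qed

section \<open>Iterates and the Fatou set\<close>

context tame_entire begin

lemma hol_iter: "(f ^^ k) holomorphic_on S"
proof (induction k)
  case (Suc k)
  have "(f \<circ> (f ^^ k)) holomorphic_on S"
    by (rule holomorphic_on_compose[OF Suc]) auto
  then show ?case by (simp add: o_def)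
qed (simp add: holomorphic_on_id id_def[symmetric])

lemma cont_iter: "continuous_on S (f ^^ k)"
  using hol_iter holomorphic_on_imp_continuous_on by blast

lemma iter_add: "(f ^^ k) ((f ^^ l) z) = (f ^^ (k + l)) z"
  by (simp add: funpow_add)

text \<open>The critical values of \<open>f ^^ k\<close> are among the points
  \<open>(f ^^ l) c\<close> with \<open>l < k\<close>. The lift is built one step at a time: if the
  first lift met \<open>(f ^^ l) c\<close>, then \<open>q\<close> would meet
  \<open>(f ^^ Suc l) c\<close>.\<close>

lemma iter_lift_exists:
  fixes q :: "complex \<Rightarrow> complex"
  assumes S: "open S" "simply_connected S" and q: "q holomorphic_on S"
    and nc: "\<And>l c. l < k \<Longrightarrow> c \<in> critical_values f \<Longrightarrow> (f ^^ l) c \<notin> q ` S"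
    and s0: "s0 \<in> S" "(f ^^ k) z0 = q s0"
  obtains \<phi> where "\<phi> holomorphic_on S" "\<phi> s0 = z0" "\<And>s. s \<in> S \<Longrightarrow> (f ^^ k) (\<phi> s) = q s"
  using q nc s0(2)
proof (induction k arbitrary: q thesis)
  case 0
  then show ?case by (metis funpow_0)
next
  case (Suc k)
  have "q ` S \<inter> critical_values f = {}"
    using Suc.prems(3)[of 0] by auto
  moreover have "f ((f ^^ k) z0) = q s0" using Suc.prems(4) by simp
  ultimately obtain \<phi>1 where p1: "\<phi>1 holomorphic_on S" "\<phi>1 s0 = (f ^^ k) z0" "\<And>s. s \<in> S \<Longrightarrow> f (\<phi>1 s) = q s"
    using lift_exists[OF S Suc.prems(2) _ s0(1)] by metis
  have "(f ^^ l) c \<notin> \<phi>1 ` S" if l: "l < k" "c \<in> critical_values f" for l c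
  proof
    assume "(f ^^ l) c \<in> \<phi>1 ` S"
    then obtain s where s: "s \<in> S" "(f ^^ l) c = \<phi>1 s" by blast
    then have "(f ^^ (Suc l)) c = q s" using p1(3) by simp
    then show False using Suc.prems(3)[of "Suc l" c] l s(1) by auto
  qed
  then obtain \<phi> where p: "\<phi> holomorphic_on S" "\<phi> s0 = z0" "\<And>s. s \<in> S \<Longrightarrow> (f ^^ k) (\<phi> s) = \<phi>1 s"
    using Suc.IH[OF _ p1(1) _ p1(2)[symmetric]] by blast
  have "(f ^^ Suc k) (\<phi> s) = q s" if "s \<in> S" for s
    using p(3) p1(3) that by simp
  then show ?case using Suc.prems(1) p by blast
qed

lemma open_fatou: "open (fatou_set f)"
proof (rule openI)
  fix z assume "z \<in> fatou_set f"
  then obtain W where W: "open W" "connected W" "z \<in> W" "normal_family_on W (range (\<lambda>n. f ^^ n))"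
    unfolding fatou_set_def by blast
  then have "W \<subseteq> fatou_set f" unfolding fatou_set_def by blast
  then show "\<exists>e>0. ball z e \<subseteq> fatou_set f" using W open_contains_ball by (meson order_trans)
qed

lemma fatou_forward:
  assumes "z \<in> fatou_set f"
  shows "f z \<in> fatou_set f"
proof -
  obtain W where W: "open W" "connected W" "z \<in> W" "normal_family_on W (range (\<lambda>n. f ^^ n))"
    using assms unfolding fatou_set_def by blast
  obtain e where e: "e > 0" "cball z e \<subseteq> W" using W open_contains_cball by blast
  define V where "V = f ` ball z e"
  have nc: "\<not> f constant_on ball z e"
  proof
    assume "f constant_on ball z e"
    then obtain c where c: "\<And>x. x \<in> ball z e \<Longrightarrow> f x = c" by (auto simp: constant_on_def)
    have "infinite (ball z e)" using uncountable_ball[OF e(1)] countable_finite by blast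
    moreover have "ball z e \<subseteq> {x \<in> cball z e. f x = c}" using c by auto
    ultimately show False using finite_preimage[OF compact_cball, of z e c] finite_subset by blast
  qed
  have V: "open V" "connected V" "f z \<in> V"
    using open_mapping_thm[of f "ball z e" "ball z e"] nc e
    by (auto simp: V_def intro!: connected_continuous_image)
  have "normal_family_on V (range (\<lambda>n. f ^^ n))"
    unfolding normal_family_on_def
  proof (intro allI impI)
    fix s :: "nat \<Rightarrow> complex \<Rightarrow> complex" assume "range s \<subseteq> range (\<lambda>n. f ^^ n)"
    then have "\<forall>n. \<exists>k. s n = f ^^ k" by auto
    then obtain k where k: "\<And>n. s n = f ^^ k n" by metis
    have sf: "s n (f x) = (f ^^ Suc (k n)) x" for n x by (simp add: k funpow_swap1)
    have "range (\<lambda>n. f ^^ Suc (k n)) \<subseteq> range (\<lambda>n. f ^^ n)" by blast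
    then obtain r :: "nat \<Rightarrow> nat" where r: "strict_mono r"
      "(\<exists>g. g holomorphic_on W \<and> (\<forall>K. compact K \<and> K \<subseteq> W \<longrightarrow> uniform_limit K (\<lambda>n. f ^^ Suc (k (r n))) g sequentially)) \<or>
       (\<forall>K B. compact K \<and> K \<subseteq> W \<longrightarrow> (\<forall>\<^sub>F n in sequentially. \<forall>z\<in>K. B < norm ((f ^^ Suc (k (r n))) z)))"
      using W(4)[unfolded normal_family_on_def, rule_format, of "\<lambda>n. f ^^ Suc (k n)"] by blast
    have VK: "K \<subseteq> f ` cball z e" if "K \<subseteq> V" for K using that by (auto simp: V_def)
    show "\<exists>r::nat\<Rightarrow>nat. strict_mono r \<and>
           ((\<exists>g. g holomorphic_on V \<and>
               (\<forall>K. compact K \<and> K \<subseteq> V \<longrightarrow> uniform_limit K (\<lambda>n. s (r n)) g sequentially)) \<or>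
            (\<forall>K B. compact K \<and> K \<subseteq> V \<longrightarrow>
               (\<forall>\<^sub>F n in sequentially. \<forall>z\<in>K. B < norm (s (r n) z))))"
      using r(2)
    proof
      assume "\<exists>g. g holomorphic_on W \<and> (\<forall>K. compact K \<and> K \<subseteq> W \<longrightarrow> uniform_limit K (\<lambda>n. f ^^ Suc (k (r n))) g sequentially)"
      then obtain g where g: "uniform_limit (cball z e) (\<lambda>n. f ^^ Suc (k (r n))) g sequentially"
        using e by (meson compact_cball)
      \<comment> \<open>Being uniformly Cauchy passes to the image, because \<open>s n (f x)\<close>
        is \<open>(f ^^ Suc (k n)) x\<close>. This yields a limit on \<open>V\<close> without having
        to factor \<open>g\<close> through \<open>f\<close>.\<close>
      have "uniformly_Cauchy_on V (\<lambda>n. s (r n))"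
      proof -
        have "uniformly_Cauchy_on (cball z e) (\<lambda>n. f ^^ Suc (k (r n)))"
          using g uniformly_convergent_on_def uniformly_convergent_Cauchy by blast
        then show ?thesis
          unfolding uniformly_Cauchy_on_def V_def by (simp add: sf) (meson ball_subset_cball mem_ball_imp_mem_cball subsetD mem_ball)
      qed
      then obtain h where h: "uniform_limit V (\<lambda>n. s (r n)) h sequentially"
        using Cauchy_uniformly_convergent uniformly_convergent_on_def by blast
      have "h holomorphic_on V"
      proof (rule holomorphic_uniform_sequence[OF V(1)])
        show "s (r n) holomorphic_on V" for n by (simp add: k hol_iter)
        fix x assume "x \<in> V"
        then obtain d where "d > 0" "cball x d \<subseteq> V" using V(1) open_contains_cball by blast
        then show "\<exists>d>0. cball x d \<subseteq> V \<and> uniform_limit (cball x d) (\<lambda>n. s (r n)) h sequentially"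
          using h uniform_limit_on_subset by blast
      qed
      then show ?thesis using r(1) h uniform_limit_on_subset by blast
    next
      assume *: "\<forall>K B. compact K \<and> K \<subseteq> W \<longrightarrow> (\<forall>\<^sub>F n in sequentially. \<forall>z\<in>K. B < norm ((f ^^ Suc (k (r n))) z))"
      show ?thesis
      proof (intro exI[of _ r] conjI r(1) disjI2 allI impI)
        fix K B assume K: "compact K \<and> K \<subseteq> V"
        have "\<forall>\<^sub>F n in sequentially. \<forall>z\<in>cball z e. B < norm ((f ^^ Suc (k (r n))) z)"
          using * e compact_cball by blast
        then show "\<forall>\<^sub>F n in sequentially. \<forall>z\<in>K. B < norm (s (r n) z)"
        proof eventually_elim
          case (elim n)
          show ?case
          proof
            fix x assume "x \<in> K"
            then obtain y where "y \<in> cball z e" "x = f y" using K VK by blast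
            then show "B < norm (s (r n) x)" using elim sf by auto
          qed
        qed
      qed
    qed
  qed
  then show ?thesis using V unfolding fatou_set_def by blast
qed

lemma fatou_iter: "z \<in> fatou_set f \<Longrightarrow> (f ^^ k) z \<in> fatou_set f"
  by (induction k) (auto intro: fatou_forward)

lemma fatou_if_omitting_two:
  assumes "r > 0" "\<alpha> \<noteq> \<beta>" "\<And>k z. z \<in> ball \<xi> r \<Longrightarrow> (f ^^ k) z \<noteq> \<alpha> \<and> (f ^^ k) z \<noteq> \<beta>"
  shows "\<xi> \<in> fatou_set f"
proof -
  have "normal_family_on (ball \<xi> r) (range (\<lambda>n. f ^^ n))"
    by (rule normal_family_omitting_two[OF open_ball connected_ball _ assms(2)])
      (use assms(3) in \<open>auto intro: hol_iter\<close>)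
  then show ?thesis
    using assms(1) unfolding fatou_set_def by (auto intro!: exI[of _ "ball \<xi> r"])
qed

end

section \<open>The cycle of Siegel disks\<close>

locale siegel_cycle = tame_entire f for f +
  fixes U :: "complex set" and n :: nat and \<phi> :: "complex \<Rightarrow> complex" and \<theta> :: real
  assumes U: "U \<in> components (fatou_set f)" and n: "n \<ge> 1" and inv: "(f ^^ n) ` U = U"
    and simply: "simply_connected U"
    and \<phi>: "\<phi> holomorphic_on U" "bij_betw \<phi> U (ball 0 1)" and \<theta>: "\<theta> \<notin> \<rat>"
    and conj: "\<And>z. z \<in> U \<Longrightarrow> \<phi> ((f ^^ n) z) = cis (2 * pi * \<theta>) * \<phi> z"
    and crit_nonempty: "critical_values f \<noteq> {}"
begin

definition rot :: complex where "rot = cis (2 * pi * \<theta>)"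

text \<open>Parametrizations of the iterated images of \<open>U\<close> by the unit disk, for every
  index and not only below \<open>n\<close>: \<open>f\<close> acts as an index shift, and one turn
  around the cycle costs a rotation.\<close>

definition \<psi> :: "nat \<Rightarrow> complex \<Rightarrow> complex" where
  "\<psi> j \<zeta> = (f ^^ j) (the_inv_into U \<phi> \<zeta>)"

lemma norm_rot [simp]: "norm rot = 1" "norm (rot ^ k) = 1"
  by (simp_all add: rot_def norm_power)

lemma open_U: "open U"
  using open_components[OF open_fatou U] .

lemma U_fatou: "U \<subseteq> fatou_set f"
  using U in_components_subset by blast

lemma \<psi>0_U: "norm \<zeta> < 1 \<Longrightarrow> \<psi> 0 \<zeta> \<in> U"
  using \<phi>(2) by (auto simp: \<psi>_def bij_betw_def intro!: the_inv_into_into)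

lemma \<phi>_\<psi>0: "norm \<zeta> < 1 \<Longrightarrow> \<phi> (\<psi> 0 \<zeta>) = \<zeta>"
  using \<phi>(2) by (auto simp: \<psi>_def bij_betw_def intro!: f_the_inv_into_f)

lemma \<psi>0_\<phi>: "z \<in> U \<Longrightarrow> \<psi> 0 (\<phi> z) = z"
  using \<phi>(2) by (auto simp: \<psi>_def bij_betw_def intro!: the_inv_into_f_f)

lemma \<phi>_ball: "z \<in> U \<Longrightarrow> norm (\<phi> z) < 1"
  using bij_betwE[OF \<phi>(2)] by auto

lemma hol_\<psi>0: "\<psi> 0 holomorphic_on ball 0 1"
proof -
  have inj: "inj_on \<phi> U" using \<phi>(2) by (simp add: bij_betw_def)
  obtain g where g: "g holomorphic_on \<phi> ` U" "\<And>z. z \<in> U \<Longrightarrow> g (\<phi> z) = z"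
    using holomorphic_has_inverse[OF \<phi>(1) open_U inj] by metis
  have "\<phi> ` U = ball 0 1" using \<phi>(2) by (simp add: bij_betw_def)
  moreover have "g \<zeta> = \<psi> 0 \<zeta>" if "\<zeta> \<in> ball 0 1" for \<zeta>
    using g(2)[OF \<psi>0_U[of \<zeta>]] \<phi>_\<psi>0[of \<zeta>] that by simp
  ultimately show ?thesis using g(1) holomorphic_transform by metis
qed

lemma \<psi>_add: "\<psi> (k + l) \<zeta> = (f ^^ k) (\<psi> l \<zeta>)"
  by (simp add: \<psi>_def funpow_add)

lemma \<psi>_Suc: "\<psi> (Suc j) \<zeta> = f (\<psi> j \<zeta>)"
  by (simp add: \<psi>_def)

lemma hol_\<psi>: "\<psi> j holomorphic_on ball 0 1"
proof -
  have "((f ^^ j) \<circ> \<psi> 0) holomorphic_on ball 0 1"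
    by (rule holomorphic_on_compose[OF hol_\<psi>0 hol_iter])
  moreover have "(f ^^ j) \<circ> \<psi> 0 = \<psi> j" using \<psi>_add[of j 0] by (auto simp: fun_eq_iff)
  ultimately show ?thesis by simp
qed

lemma cont_\<psi>: "S \<subseteq> ball 0 1 \<Longrightarrow> continuous_on S (\<psi> j)"
  using hol_\<psi> holomorphic_on_imp_continuous_on holomorphic_on_subset by blast

lemma \<psi>_n: assumes "norm \<zeta> < 1" shows "\<psi> n \<zeta> = \<psi> 0 (rot * \<zeta>)"
proof -
  have "\<psi> n \<zeta> \<in> U" using \<psi>_add[of n 0 \<zeta>] \<psi>0_U[OF assms] inv by auto
  moreover have "\<phi> (\<psi> n \<zeta>) = rot * \<zeta>"
    using \<psi>_add[of n 0 \<zeta>] conj[OF \<psi>0_U[OF assms]] \<phi>_\<psi>0[OF assms] by (simp add: rot_def)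
  ultimately show ?thesis using \<psi>0_\<phi> by metis
qed

lemma \<psi>_period: "norm \<zeta> < 1 \<Longrightarrow> \<psi> (n * t + j) \<zeta> = \<psi> j (rot ^ t * \<zeta>)"
proof (induction t arbitrary: \<zeta>)
  case (Suc t)
  have "\<psi> (n * Suc t + j) \<zeta> = (f ^^ (n * t + j)) (\<psi> n \<zeta>)"
    using \<psi>_add[of "n * t + j" n \<zeta>] by (simp add: add_ac)
  also have "\<dots> = \<psi> (n * t + j) (rot * \<zeta>)"
    using \<psi>_n[OF Suc.prems] \<psi>_add[of "n * t + j" 0 "rot * \<zeta>"] by simp
  also have "\<dots> = \<psi> j (rot ^ t * (rot * \<zeta>))"
    using Suc by (intro Suc.IH) (simp add: norm_mult)
  finally show ?case by (simp add: mult_ac)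
qed auto

lemma \<psi>_mod: "norm \<zeta> < 1 \<Longrightarrow> \<psi> k \<zeta> = \<psi> (k mod n) (rot ^ (k div n) * \<zeta>)"
  using \<psi>_period[of \<zeta> "k div n" "k mod n"] by simp

lemma \<psi>_fatou: "norm \<zeta> < 1 \<Longrightarrow> \<psi> j \<zeta> \<in> fatou_set f"
  using \<psi>_add[of j 0 \<zeta>] \<psi>0_U U_fatou fatou_iter by auto

text \<open>Following \<open>\<psi> j\<close> by \<open>(n - 1) * j\<close> more iterations gives
  \<open>\<psi> (n * j)\<close>, which is \<open>\<psi> 0\<close> after a rotation and hence
  injective.\<close>

lemma inj_\<psi>: "inj_on (\<psi> j) (ball 0 1)"
proof (rule inj_onI)
  fix x y assume xy: "x \<in> ball (0::complex) 1" "y \<in> ball (0::complex) 1" "\<psi> j x = \<psi> j y"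
  have "n * j = (n - 1) * j + j" using n by (metis Nat.add_0_right add_mult_distrib le_add_diff_inverse2 mult_1)
  then have "\<psi> (n * j) x = \<psi> (n * j) y" using \<psi>_add[of "(n - 1) * j" j] xy(3) by simp
  then have "\<psi> 0 (rot ^ j * x) = \<psi> 0 (rot ^ j * y)"
    using \<psi>_period[of x j 0] \<psi>_period[of y j 0] xy by simp
  moreover have "\<phi> (\<psi> 0 (rot ^ j * x)) = rot ^ j * x" "\<phi> (\<psi> 0 (rot ^ j * y)) = rot ^ j * y"
    using xy by (auto intro!: \<phi>_\<psi>0 simp: norm_mult simp del: mult_eq_0_iff)
  ultimately have "rot ^ j * x = rot ^ j * y" by metis
  moreover have "rot ^ j \<noteq> 0" using norm_rot(2)[of j] by (metis norm_zero zero_neq_one)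
  ultimately show "x = y" using mult_left_cancel by blast
qed

text \<open>The closed concentric subdisks of the cycle. For \<open>r < 1\<close> this set is
  compact, forward invariant and contained in the Fatou set, so it traps orbits.\<close>

definition disc :: "real \<Rightarrow> complex set" where
  "disc r = (\<Union>j<n. \<psi> j ` cball 0 r)"

lemma compact_disc: "r < 1 \<Longrightarrow> compact (disc r)"
  unfolding disc_def by (intro compact_UN compact_continuous_image cont_\<psi>) auto

lemma disc_fatou: "r < 1 \<Longrightarrow> disc r \<subseteq> fatou_set f"
  unfolding disc_def using \<psi>_fatou by force

lemma disc_\<psi>: assumes "norm \<zeta> \<le> r" "r < 1" shows "\<psi> j \<zeta> \<in> disc r"
proof -
  have "\<psi> j \<zeta> = \<psi> (j mod n) (rot ^ (j div n) * \<zeta>)" using \<psi>_mod assms by simp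
  moreover have "j mod n < n" using n by simp
  moreover have "rot ^ (j div n) * \<zeta> \<in> cball 0 r" using assms by (simp add: norm_mult)
  ultimately show ?thesis unfolding disc_def by blast
qed

lemma disc_iter: assumes "z \<in> disc r" "r < 1" shows "(f ^^ k) z \<in> disc r"
proof -
  obtain j \<zeta> where "norm \<zeta> \<le> r" "z = \<psi> j \<zeta>" using assms by (auto simp: disc_def)
  then show ?thesis using disc_\<psi>[of \<zeta> r "k + j"] assms(2) \<psi>_add by simp
qed

lemma \<psi>0_disc: "z \<in> U \<Longrightarrow> z \<in> disc (norm (\<phi> z))"
  using disc_\<psi>[of "\<phi> z" "norm (\<phi> z)" 0] \<phi>_ball \<psi>0_\<phi> by simp

text \<open>The radius 1/2 only has to leave room for two distinct points: \<open>\<psi> 0 0\<close>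
  and \<open>\<psi> 0 (1/4)\<close> are the values omitted by the families of inverse branches
  below.\<close>

abbreviation core :: "complex set" where "core \<equiv> disc (1/2)"

lemma core_points: "\<psi> 0 0 \<in> core" "\<psi> 0 (1/4) \<in> core" "\<psi> 0 0 \<noteq> \<psi> 0 (1/4)"
proof -
  show "\<psi> 0 0 \<noteq> \<psi> 0 (1/4)" using inj_onD[OF inj_\<psi>[of 0], of 0 "1/4"] by auto
qed (auto intro!: disc_\<psi>)

text \<open>By Montel's theorem the iterates of a disk about a Julia point cannot omit both chosen
  points of \<open>core\<close>. As \<open>core\<close> is forward invariant, all later iterates of
  the point found stay there, so a contradiction may use any large iterate.\<close>

lemma blow_up:
  assumes "\<xi> \<notin> fatou_set f" "r > 0"
  obtains u t where "u \<in> ball \<xi> r" "\<And>k. k \<ge> t \<Longrightarrow> (f ^^ k) u \<in> core"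
proof -
  have "\<exists>u\<in>ball \<xi> r. \<exists>t. (f ^^ t) u \<in> core"
  proof (rule ccontr)
    assume "\<not> ?thesis"
    then have "\<xi> \<in> fatou_set f"
      using core_points by (intro fatou_if_omitting_two[OF assms(2) core_points(3)]) metis
    then show False using assms by simp
  qed
  then obtain u t where ut: "u \<in> ball \<xi> r" "(f ^^ t) u \<in> core" by blast
  have "(f ^^ k) u \<in> core" if "k \<ge> t" for k
    using disc_iter[OF ut(2), of "k - t"] that by (simp add: iter_add)
  then show ?thesis using that ut by blast
qed

lemma frontier_notin_fatou: assumes "w \<in> frontier U" shows "w \<notin> fatou_set f"
proof
  assume "w \<in> fatou_set f"
  then obtain e where e: "e > 0" "ball w e \<subseteq> fatou_set f"
    using open_fatou open_contains_ball by blast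
  have "w \<in> closure U" using assms by (simp add: frontier_def)
  then obtain y where "y \<in> U" "dist y w < e" using e(1) closure_approachable by metis
  then have "U \<inter> ball w e \<noteq> {}" by (auto simp: dist_commute)
  then have "ball w e \<subseteq> U"
    using components_maximal[OF U connected_ball e(2)] by blast
  then have "w \<in> U" using e(1) by auto
  then show False using assms open_U by (simp add: frontier_def interior_open)
qed

lemma fatou_component_U:
  assumes "connected T" "T \<subseteq> fatou_set f" "T \<inter> U \<noteq> {}"
  shows "T \<subseteq> U"
  using components_maximal[OF U assms(1,2)] assms(3) by blast

lemma closed_julia: "closed (- fatou_set f)"
  using open_fatou by auto

text \<open>A countable frontier has connected complement, which would then equal \<open>U\<close>,
  so \<open>- U\<close> would be countable. But \<open>- U\<close> is nonempty by Liouville, and its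
  components are unbounded by simple connectivity, hence uncountable. This allows a frontier point
  to be chosen off countably many periodic points.\<close>

lemma uncountable_frontier: "uncountable (frontier U)"
proof -
  have UU: "U \<noteq> UNIV"
  proof
    assume "U = UNIV"
    then have "\<phi> holomorphic_on UNIV" "bounded (range \<phi>)"
      using \<phi> by (auto simp: bij_betw_def)
    then have "\<phi> constant_on UNIV" by (rule Liouville_theorem)
    then obtain c where "\<And>z. \<phi> z = c" by (auto simp: constant_on_def)
    then have "\<phi> ` U \<subseteq> {c}" by auto
    then have "ball (0::complex) 1 \<subseteq> {c}" using \<phi>(2) by (simp add: bij_betw_def)
    moreover have "0 \<in> ball (0::complex) 1" "1/2 \<in> ball (0::complex) 1" by auto
    ultimately show False by (metis singletonD subsetD zero_neq_one div_0 divide_eq_0_iff zero_neq_numeral)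
  qed
  have Une: "U \<noteq> {}" using \<psi>0_U[of 0] by auto
  show "uncountable (frontier U)"
  proof
    assume c: "countable (frontier U)"
    then have con: "connected (- frontier U)"
      using path_connected_complement_countable[OF _ c] by (simp add: path_connected_imp_connected)
    have Usub: "U \<subseteq> - frontier U" using open_U by (auto simp: frontier_def interior_open)
    have "U = - frontier U"
    proof (rule ccontr)
      assume "U \<noteq> - frontier U"
      then have "U \<union> (- closure U) = - frontier U" "- closure U \<noteq> {}"
        using open_U Usub by (auto simp: frontier_def interior_open)
      moreover have "U \<inter> - closure U = {}" using closure_subset by blast
      moreover have "open (- closure U)" by auto
      ultimately show False
        using con open_U Une unfolding connected_def
        by (metis Int_Un_distrib2 Int_absorb1 Un_upper1 Un_upper2 inf.orderE inf_bot_left order_refl inf_commute)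
    qed
    then have "- U = frontier U" by blast
    then have cU: "countable (- U)" using c by simp
    obtain C where C: "C \<in> components (- U)" using UU components_eq_empty by fastforce
    then have "\<not> bounded C" using simply simply_connected_eq_unbounded_complement_components[OF open_U] by blast
    then obtain x y where "x \<in> C" "y \<in> C" "x \<noteq> y"
      by (metis bounded_empty bounded_insert finite_imp_bounded finite.emptyI finite.insertI insertI1 is_singletonI' is_singleton_def C in_components_nonempty)
    then have "uncountable C" using connected_uncountable C in_components_connected by blast
    then show False using cU C countable_subset in_components_subset by blast
  qed
qed

end

section \<open>The frontier of the disk and the postcritical set\<close>

context siegel_cycle begin

definition postcritical :: "complex set" where
  "postcritical = {(f ^^ l) c | l c. c \<in> critical_values f}"

lemma far_from_core:
  assumes "w \<in> frontier U"
  obtains r where "r > 0" "ball w r \<inter> core = {}"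
proof -
  have "w \<notin> core" using frontier_notin_fatou[OF assms] disc_fatou[of "1/2"] by auto
  moreover have "closed core" using compact_disc[of "1/2"] by (simp add: compact_imp_closed)
  ultimately obtain r where "r > 0" "ball w r \<subseteq> - core"
    using open_contains_ball by (metis ComplI open_Compl)
  then show ?thesis using that by blast
qed

text \<open>This is forward invariance of \<open>core\<close>. Inverse branches over a set off
  \<open>core\<close> thus omit two fixed values and form a normal family.\<close>

lemma section_omits_core:
  assumes "(f ^^ k) z = x" "x \<notin> core"
  shows "z \<noteq> \<psi> 0 0 \<and> z \<noteq> \<psi> 0 (1/4)"
  using assms core_points disc_iter[of _ "1/2" k] by auto

text \<open>Otherwise inverse branches of all iterates exist on a disk \<open>D\<close> about
  \<open>w\<close> off \<open>core\<close>. A limit \<open>G\<close> of suitable ones sends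
  \<open>u\<close> into \<open>U\<close> and \<open>w\<close> into the Julia set, so it is not
  constant. The branches then cover a fixed disk about a Julia point; some point of it iterates into
  \<open>core\<close>, although the same iterates bring the branch values back to
  \<open>D\<close>.\<close>

lemma frontier_subset_closure_postcritical:
  assumes w: "w \<in> frontier U"
  shows "w \<in> closure postcritical"
proof (rule ccontr)
  assume "w \<notin> closure postcritical"
  then obtain r1 where r1: "r1 > 0" "ball w r1 \<subseteq> - closure postcritical"
    using open_contains_ball[of "- closure postcritical"] by auto
  then have r1': "ball w r1 \<inter> postcritical = {}" using closure_subset by blast
  obtain r2 where r2: "r2 > 0" "ball w r2 \<inter> core = {}" using far_from_core[OF w] .
  define D where "D = ball w (min r1 r2)"
  have D: "open D" "connected D" "simply_connected D" "w \<in> D" "D \<inter> postcritical = {}" "D \<inter> core = {}"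
    using r1(1) r1' r2 by (auto simp: D_def convex_imp_simply_connected)
  have "w \<in> closure U" using w by (simp add: frontier_def)
  then obtain u where u: "u \<in> U" "dist u w < min r1 r2"
    using r1(1) r2(1) closure_approachable[of w U] by (metis min_less_iff_conj)
  then have uD: "u \<in> D" by (simp add: D_def dist_commute)
  define \<zeta> where "\<zeta> = \<phi> u"
  have \<zeta>: "norm \<zeta> < 1" "\<psi> 0 \<zeta> = u" using \<phi>_ball \<psi>0_\<phi> u by (auto simp: \<zeta>_def)
  \<comment> \<open>Each branch is chosen by turning \<open>\<zeta>\<close> backwards. This keeps
    the values at \<open>u\<close> in a compact subset of \<open>U\<close>, so that the limit at
    \<open>u\<close> lies in \<open>U\<close> too.\<close>
  define ir where "ir = inverse rot"
  have ir: "norm (ir ^ k) = 1" "rot ^ k * ir ^ k = 1" for k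
    using norm_rot by (simp_all add: ir_def norm_power norm_inverse flip: power_mult_distrib)
      (metis norm_rot(1) norm_zero right_inverse power_one zero_neq_one)
  have "\<exists>g. g holomorphic_on D \<and> g u = \<psi> 0 (ir ^ k * \<zeta>) \<and> (\<forall>x\<in>D. (f ^^ (n * k)) (g x) = x)" for k
  proof -
    have "(f ^^ (n * k)) (\<psi> 0 (ir ^ k * \<zeta>)) = \<psi> (n * k + 0) (ir ^ k * \<zeta>)"
      using \<psi>_add[of "n * k" 0] by simp
    also have "\<dots> = \<psi> 0 (rot ^ k * (ir ^ k * \<zeta>))"
      using \<zeta> ir by (intro \<psi>_period) (simp add: norm_mult)
    also have "rot ^ k * (ir ^ k * \<zeta>) = \<zeta>" using ir(2)[of k] by (simp add: mult.assoc[symmetric])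
    finally have "(f ^^ (n * k)) (\<psi> 0 (ir ^ k * \<zeta>)) = u" using \<zeta> by simp
    then have e: "(f ^^ (n * k)) (\<psi> 0 (ir ^ k * \<zeta>)) = (\<lambda>x. x) u" by simp
    have nc: "(f ^^ l) c \<notin> (\<lambda>x. x) ` D" if "l < n * k" "c \<in> critical_values f" for l c
      using D(5) that by (auto simp: postcritical_def)
    obtain g where "g holomorphic_on D" "g u = \<psi> 0 (ir ^ k * \<zeta>)" "\<And>x. x \<in> D \<Longrightarrow> (f ^^ (n * k)) (g x) = x"
      using iter_lift_exists[OF D(1,3) _ nc uD e] by (metis holomorphic_on_ident)
    then show ?thesis by blast
  qed
  then have "\<exists>g. \<forall>k. g k holomorphic_on D \<and> g k u = \<psi> 0 (ir ^ k * \<zeta>) \<and> (\<forall>x\<in>D. (f ^^ (n * k)) (g k x) = x)"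
    by (intro choice allI)
  then obtain g where g: "\<And>k. g k holomorphic_on D" "\<And>k. g k u = \<psi> 0 (ir ^ k * \<zeta>)"
      "\<And>k x. x \<in> D \<Longrightarrow> (f ^^ (n * k)) (g k x) = x"
    by blast
  let ?C = "\<psi> 0 ` cball 0 (norm \<zeta>)"
  have C: "compact ?C" "?C \<subseteq> U"
    using \<zeta> \<psi>0_U by (auto intro!: compact_continuous_image cont_\<psi>)
  have guC: "g k u \<in> ?C" for k
    using g(2) ir(1)[of k] by (auto simp: norm_mult)
  obtain B where B: "\<And>z. z \<in> ?C \<Longrightarrow> norm z \<le> B"
    using C(1) compact_imp_bounded bounded_iff by metis
  have nf: "normal_family_on D (range g)"
    by (rule normal_family_omitting_two[OF D(1,2) _ core_points(3)])
      (use g section_omits_core D(6) in \<open>blast+\<close>)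
  have bd: "norm (g k u) \<le> B" for k using B guC by blast
  obtain G r where G: "G holomorphic_on D" "strict_mono (r :: nat \<Rightarrow> nat)"
      "\<And>K. compact K \<Longrightarrow> K \<subseteq> D \<Longrightarrow> uniform_limit K (\<lambda>k. g (r k)) G sequentially"
    by (rule normal_family_converges[OF nf uD bd], rule that) blast+
  have lim: "(\<lambda>k. g (r k) x) \<longlonglongrightarrow> G x" if "x \<in> D" for x
    by (rule locally_uniform_limit_pointwise[OF G(3) that])
  have GuU: "G u \<in> U"
    using closed_sequentially[OF compact_imp_closed[OF C(1)] _ lim[OF uD]] guC C(2) by blast
  have nc: "\<not> G constant_on D"
  proof
    assume "G constant_on D"
    then have "G w = G u" using uD D(4) by (auto simp: constant_on_def)
    then have "\<forall>\<^sub>F k in sequentially. g (r k) w \<in> U"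
      using topological_tendstoD[OF lim[OF D(4)] open_U] GuU by simp
    then obtain k where k: "g (r k) w \<in> U" by (auto simp: eventually_sequentially)
    have "(f ^^ (n * r k)) (g (r k) w) \<in> fatou_set f" using fatou_iter k U_fatou by blast
    then show False using g(3)[OF D(4)] frontier_notin_fatou[OF w] by simp
  qed
  obtain \<eta> where \<eta>: "\<eta> > 0" "\<forall>\<^sub>F k in sequentially. ball (G w) \<eta> \<subseteq> g (r k) ` D"
    using common_disk_in_images[OF _ G(1) D(1,2) G(3) nc D(4)] g(1) by metis
  have "G w \<notin> fatou_set f"
  proof -
    have "g (r k) w \<in> - fatou_set f" for k
      using fatou_iter[of "g (r k) w" "n * r k"] g(3)[OF D(4)] frontier_notin_fatou[OF w] by auto
    then show ?thesis using closed_sequentially[OF closed_julia _ lim[OF D(4)]] by blast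
  qed
  then obtain v t where v: "v \<in> ball (G w) \<eta>" "\<And>k. k \<ge> t \<Longrightarrow> (f ^^ k) v \<in> core"
    using blow_up \<eta>(1) by metis
  obtain k where k: "k \<ge> t" "ball (G w) \<eta> \<subseteq> g (r k) ` D"
    using \<eta>(2) unfolding eventually_sequentially by (metis max.cobounded1 max.cobounded2)
  then obtain x where x: "x \<in> D" "v = g (r k) x" using v(1) by blast
  have "r k \<ge> k" using seq_suble[OF G(2)] .
  moreover have "n * r k \<ge> r k" using n by simp
  ultimately have "n * r k \<ge> t" using k(1) by linarith
  then have "x \<in> core" using v(2)[of "n * r k"] x g(3) by auto
  then show False using D(6) x(1) by blast
qed

lemma fatou_normal:
  assumes "x \<in> fatou_set f"
  obtains W where "open W" "connected W" "x \<in> W" "W \<subseteq> fatou_set f"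
    "normal_family_on W (range (\<lambda>n. f ^^ n))"
proof -
  obtain W where W: "open W" "connected W" "x \<in> W" "normal_family_on W (range (\<lambda>n. f ^^ n))"
    using assms unfolding fatou_set_def by blast
  then have "W \<subseteq> fatou_set f" unfolding fatou_set_def by blast
  then show ?thesis using that W by blast
qed

text \<open>A nonconstant limit function near \<open>y1\<close> would make the orbit of \<open>y1\<close> enter the Siegel disk, where it
  stays in a compact set; so all limit functions are constant.\<close>

lemma boundary_limit_propagates:
  assumes W: "open W" "connected W" "W \<subseteq> fatou_set f" "normal_family_on W (range (\<lambda>n. f ^^ n))"
    and k: "strict_mono (k :: nat \<Rightarrow> nat)" and \<kappa>: "\<kappa> \<in> frontier U"
    and y: "y1 \<in> W" "y2 \<in> W" "(\<lambda>m. (f ^^ k m) y1) \<longlonglongrightarrow> \<kappa>"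
  shows "(\<lambda>m. (f ^^ k m) y2) \<longlonglongrightarrow> \<kappa>"
proof (rule ccontr)
  assume "\<not> ?thesis"
  then obtain \<epsilon> where \<epsilon>: "\<epsilon> > 0" "\<And>N. \<exists>m\<ge>N. \<epsilon> \<le> dist ((f ^^ k m) y2) \<kappa>"
    unfolding lim_sequentially by (meson not_le)
  then have "infinite {m. \<epsilon> \<le> dist ((f ^^ k m) y2) \<kappa>}"
    by (auto simp: infinite_nat_iff_unbounded_le)
  then obtain r :: "nat \<Rightarrow> nat" where r: "strict_mono r" "\<And>m. \<epsilon> \<le> dist ((f ^^ k (r m)) y2) \<kappa>"
    using infinite_enumerate by (metis (mono_tags, lifting) mem_Collect_eq)
  have nf: "normal_family_on W (range (\<lambda>m. f ^^ k (r m)))"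
    by (rule normal_family_on_subset[OF W(4)]) blast
  obtain B where B: "\<And>m. norm ((f ^^ k m) y1) \<le> B"
    using convergent_imp_Bseq convergentI[OF y(3)] BseqE by metis
  obtain g r' where g: "g holomorphic_on W" "strict_mono (r' :: nat \<Rightarrow> nat)"
      "\<And>K. compact K \<Longrightarrow> K \<subseteq> W \<Longrightarrow> uniform_limit K (\<lambda>m. f ^^ k (r (r' m))) g sequentially"
    by (rule normal_family_converges[OF nf y(1) B], rule that) blast+
  have lim: "(\<lambda>m. (f ^^ k (r (r' m))) z) \<longlonglongrightarrow> g z" if "z \<in> W" for z
    by (rule locally_uniform_limit_pointwise[OF g(3) that])
  have "(\<lambda>m. (f ^^ k (r (r' m))) y1) \<longlonglongrightarrow> \<kappa>"
    using LIMSEQ_subseq_LIMSEQ[OF y(3) strict_mono_o[OF r(1) g(2)]] by (simp add: o_def)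
  then have gy: "g y1 = \<kappa>" using LIMSEQ_unique lim[OF y(1)] by blast
  have "g constant_on W"
  proof (rule ccontr)
    assume nc: "\<not> g constant_on W"
    obtain \<eta> where \<eta>: "\<eta> > 0" "\<forall>\<^sub>F m in sequentially. ball (g y1) \<eta> \<subseteq> (f ^^ (k (r (r' m)))) ` W"
      using common_disk_in_images[OF _ g(1) W(1,2) g(3) nc y(1)] hol_iter by metis
    then obtain m where m: "ball \<kappa> \<eta> \<subseteq> (f ^^ (k (r (r' m)))) ` W"
      using gy by (auto simp: eventually_sequentially)
    define K where "K = k (r (r' m))"
    have "\<kappa> \<in> closure U" using \<kappa> by (simp add: frontier_def)
    then obtain u where "u \<in> U" "dist u \<kappa> < \<eta>" using \<eta>(1) closure_approachable by metis
    then have "u \<in> ball \<kappa> \<eta>" by (simp add: dist_commute)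
    then have "(f ^^ K) ` W \<inter> U \<noteq> {}" using m \<open>u \<in> U\<close> unfolding K_def by blast
    moreover have "connected ((f ^^ K) ` W)"
      by (rule connected_continuous_image[OF cont_iter W(2)])
    moreover have "(f ^^ K) ` W \<subseteq> fatou_set f" using W(3) fatou_iter by blast
    ultimately have "(f ^^ K) ` W \<subseteq> U" by (rule fatou_component_U[rotated -1])
    then have yU: "(f ^^ K) y1 \<in> U" using y(1) by blast
    define \<rho> where "\<rho> = norm (\<phi> ((f ^^ K) y1))"
    have \<rho>: "\<rho> < 1" using \<phi>_ball[OF yU] by (simp add: \<rho>_def)
    have d: "(f ^^ l) y1 \<in> disc \<rho>" if "l \<ge> K" for l
      using disc_iter[OF \<psi>0_disc[OF yU], of "l - K"] \<rho> that by (simp add: iter_add \<rho>_def)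
    have "\<forall>\<^sub>F m in sequentially. (f ^^ k m) y1 \<in> disc \<rho>"
      unfolding eventually_sequentially using d seq_suble[OF k] by (metis order_trans)
    then have "\<kappa> \<in> disc \<rho>"
      using Lim_in_closed_set[OF compact_imp_closed[OF compact_disc[OF \<rho>]] _ _ y(3)] by simp
    then show False using disc_fatou[OF \<rho>] frontier_notin_fatou[OF \<kappa>] by blast
  qed
  then have "g y2 = \<kappa>" using gy y by (auto simp: constant_on_def)
  then have "\<forall>\<^sub>F m in sequentially. dist ((f ^^ k (r (r' m))) y2) \<kappa> < \<epsilon>"
    using tendstoD[OF lim[OF y(2)] \<epsilon>(1)] by simp
  then show False using r(2) by (auto simp: eventually_sequentially not_less[symmetric])
qed

text \<open>Convergence to \<open>\<kappa>\<close> spreads over the Fatou component of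
  \<open>x\<close> and so reaches \<open>(f ^^ p) x\<close>; but the same iterates of
  \<open>(f ^^ p) x\<close> also tend to \<open>(f ^^ p) \<kappa>\<close>.\<close>

lemma boundary_limit_periodic:
  assumes x: "x \<in> fatou_set f" and p: "(f ^^ p) x \<in> connected_component_set (fatou_set f) x"
    and k: "strict_mono (k :: nat \<Rightarrow> nat)" "(\<lambda>m. (f ^^ k m) x) \<longlonglongrightarrow> \<kappa>" and \<kappa>: "\<kappa> \<in> frontier U"
  shows "(f ^^ p) \<kappa> = \<kappa>"
proof -
  let ?Y = "connected_component_set (fatou_set f) x"
  have xY: "x \<in> ?Y" using x by (simp add: connected_component_refl)
  have "(\<lambda>m. (f ^^ k m) ((f ^^ p) x)) \<longlonglongrightarrow> \<kappa>"
  proof (rule connected_induction_simple[of ?Y x "(f ^^ p) x" "\<lambda>y. (\<lambda>m. (f ^^ k m) y) \<longlonglongrightarrow> \<kappa>",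
        OF connected_connected_component xY p k(2)])
    fix z assume z: "z \<in> ?Y"
    then have "z \<in> fatou_set f" using connected_component_subset by blast
    then obtain W where W: "open W" "connected W" "z \<in> W" "W \<subseteq> fatou_set f" "normal_family_on W (range (\<lambda>n. f ^^ n))"
      by (rule fatou_normal)
    show "\<exists>T. openin (top_of_set ?Y) T \<and> z \<in> T \<and>
        (\<forall>u\<in>T. \<forall>v\<in>T. (\<lambda>m. (f ^^ k m) u) \<longlonglongrightarrow> \<kappa> \<longrightarrow> (\<lambda>m. (f ^^ k m) v) \<longlonglongrightarrow> \<kappa>)"
    proof (intro exI[of _ "?Y \<inter> W"] conjI ballI impI)
      show "openin (top_of_set ?Y) (?Y \<inter> W)" using W(1) by auto
      show "(\<lambda>m. (f ^^ k m) v) \<longlonglongrightarrow> \<kappa>"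
        if "u \<in> ?Y \<inter> W" "v \<in> ?Y \<inter> W" "(\<lambda>m. (f ^^ k m) u) \<longlonglongrightarrow> \<kappa>" for u v
        using boundary_limit_propagates[OF W(1,2,4,5) k(1) \<kappa>, of u v] that by blast
    qed (use z W in auto)
  qed
  moreover have "(\<lambda>m. (f ^^ p) ((f ^^ k m) x)) \<longlonglongrightarrow> (f ^^ p) \<kappa>"
  proof (rule isCont_tendsto_compose[of \<kappa> "f ^^ p"])
    show "isCont (f ^^ p) \<kappa>" using cont_iter[of UNIV p] continuous_on_eq_continuous_at[OF open_UNIV] by blast
  qed (rule k(2))
  moreover have "(f ^^ k m) ((f ^^ p) x) = (f ^^ p) ((f ^^ k m) x)" for m
    by (simp add: iter_add add.commute)
  ultimately show ?thesis using LIMSEQ_unique by simp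
qed

end

section \<open>A critical value in the Julia set\<close>

lemma close_orbit_subsequence:
  fixes x :: "nat \<Rightarrow> complex"
  assumes "\<And>\<epsilon>. \<epsilon> > 0 \<Longrightarrow> \<exists>l. dist (x l) \<kappa> < \<epsilon>" "\<And>l. x l \<noteq> \<kappa>"
  obtains k where "strict_mono (k :: nat \<Rightarrow> nat)" "(\<lambda>m. x (k m)) \<longlonglongrightarrow> \<kappa>"
proof -
  have "\<kappa> islimpt range x"
    unfolding islimpt_approachable using assms by (metis rangeI)
  then show ?thesis
    using islimpt_range_imp_convergent_subsequence that by (auto simp: o_def)
qed

context siegel_cycle begin

abbreviation "fatou_comp x \<equiv> connected_component_set (fatou_set f) x"

text \<open>For a point of the Fatou set this says that its component is eventually periodic. If it
  fails, the components visited by the orbit are pairwise distinct, as for a wandering domain; that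
  case is treated rather than excluded.\<close>

definition returning :: "complex \<Rightarrow> bool" where
  "returning c \<longleftrightarrow> (\<exists>i p. p \<ge> 1 \<and> (f ^^ (i + p)) c \<in> fatou_comp ((f ^^ i) c))"

lemma comp_iter:
  assumes "y \<in> fatou_comp x"
  shows "(f ^^ k) y \<in> fatou_comp ((f ^^ k) x)"
proof -
  have "connected ((f ^^ k) ` fatou_comp x)"
    by (rule connected_continuous_image[OF cont_iter connected_connected_component])
  moreover have "(f ^^ k) ` fatou_comp x \<subseteq> fatou_set f"
    using connected_component_subset fatou_iter by blast
  moreover have "x \<in> fatou_comp x"
    using assms by (metis connected_component_eq_empty connected_component_refl_eq empty_iff mem_Collect_eq)
  ultimately show ?thesis
    using connected_component_maximal[of "(f ^^ k) x" "(f ^^ k) ` fatou_comp x" "fatou_set f"] assms by blast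
qed

text \<open>If \<open>(f ^^ p) z - z\<close> were constant, \<open>f ^^ p\<close> would be a
  translation with derivative 1, whereas the chain rule gives derivative 0 at a critical point of
  \<open>f\<close>.\<close>

lemma fixed_points_countable:
  assumes "p \<ge> 1"
  shows "countable {z. (f ^^ p) z = z}"
proof -
  obtain c where c: "deriv f c = 0" using crit_nonempty unfolding critical_values_def by auto
  have "\<not> (\<lambda>z. (f ^^ p) z - z) constant_on UNIV"
  proof
    assume "(\<lambda>z. (f ^^ p) z - z) constant_on UNIV"
    then obtain a where "\<And>z. (f ^^ p) z - z = a" by (auto simp: constant_on_def)
    then have eq: "f ^^ p = (\<lambda>z. z + a)" by (auto simp: fun_eq_iff algebra_simps)
    obtain p' where p': "p = Suc p'" using assms by (cases p) auto
    have "f ^^ p = (f ^^ p') \<circ> f" by (simp add: p' funpow_swap1 fun_eq_iff del: funpow.simps) (simp add: funpow_Suc_right del: funpow.simps)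
    then have "deriv (f ^^ p) c = deriv (f ^^ p') (f c) * deriv f c"
      using deriv_chain[of f c "f ^^ p'"] hol_iter[of p' UNIV] hol
      by (simp add: holomorphic_on_imp_differentiable_at[of _ UNIV])
    then have "deriv (f ^^ p) c = 0" using c by simp
    moreover have "deriv (\<lambda>z::complex. z + a) c = 1" by (intro DERIV_imp_deriv derivative_eq_intros) auto
    ultimately show False by (simp add: eq)
  qed
  then have "countable {z \<in> UNIV. (f ^^ p) z - z = 0}"
    by (intro holomorphic_countable_zeros) (auto intro!: holomorphic_intros hol_iter)
  then show ?thesis by simp
qed

lemma returning_orbit_avoids:
  assumes c: "c \<in> fatou_set f" and i: "(f ^^ (i + p)) c \<in> fatou_comp ((f ^^ i) c)"
    and \<kappa>: "\<kappa> \<in> frontier U" "(f ^^ p) \<kappa> \<noteq> \<kappa>"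
  obtains \<tau> where "\<tau> > 0" "\<And>l. \<tau> \<le> dist ((f ^^ l) c) \<kappa>"
proof (rule ccontr)
  note avoids = that
  assume "\<not> thesis"
  then have "\<exists>l. dist ((f ^^ l) c) \<kappa> < \<epsilon>" if eps: "0 < \<epsilon>" for \<epsilon>
    using \<open>\<not> thesis\<close> avoids[OF eps] by (meson not_less)
  moreover have "(f ^^ l) c \<noteq> \<kappa>" for l
    using fatou_iter[OF c] frontier_notin_fatou[OF \<kappa>(1)] by metis
  ultimately obtain k where k: "strict_mono (k :: nat \<Rightarrow> nat)" "(\<lambda>m. (f ^^ k m) c) \<longlonglongrightarrow> \<kappa>"
    by (rule close_orbit_subsequence[of "\<lambda>l. (f ^^ l) c" \<kappa>]) blast
  \<comment> \<open>The subsequence is restarted at \<open>(f ^^ i) c\<close>; as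
    \<open>k (m + i) \<ge> m + i\<close>, the truncated subtraction is exact.\<close>
  let ?k = "\<lambda>m. k (m + i) - i"
  have ki: "k (m + i) \<ge> m + i" for m using seq_suble[OF k(1)] .
  have "strict_mono ?k"
  proof (rule strict_monoI)
    fix a b :: nat assume "a < b"
    then have "k (a + i) < k (b + i)" using k(1) by (simp add: strict_mono_less)
    then show "?k a < ?k b" using ki[of a] by simp
  qed
  moreover have "(\<lambda>m. (f ^^ ?k m) ((f ^^ i) c)) \<longlonglongrightarrow> \<kappa>"
  proof -
    have "(f ^^ ?k m) ((f ^^ i) c) = (f ^^ k (m + i)) c" for m
    proof -
      have "k (m + i) - i + i = k (m + i)" using ki[of m] by simp
      then show ?thesis by (simp only: iter_add)
    qed
    then show ?thesis using LIMSEQ_ignore_initial_segment[OF k(2), of i] by simp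
  qed
  moreover have "(f ^^ p) ((f ^^ i) c) \<in> fatou_comp ((f ^^ i) c)"
    using i by (simp add: iter_add add.commute)
  ultimately have "(f ^^ p) \<kappa> = \<kappa>"
    using boundary_limit_periodic[OF fatou_iter[OF c]] \<kappa>(1) by blast
  then show False using \<kappa>(2) by simp
qed

text \<open>The components along the orbit of \<open>c\<close> are pairwise distinct, so a single
  meeting at indices \<open>i0\<close>, \<open>l0\<close> determines all others by
  \<open>i + l0 = l + i0\<close>. Thus early points of the orbit of \<open>c'\<close> cannot lie in
  the component of \<open>(f ^^ i) c\<close>.\<close>

lemma nonreturning_shift:
  assumes c: "\<not> returning c" "c \<in> fatou_set f" and c': "c' \<in> fatou_set f"
  obtains s where "\<And>i l. (f ^^ l) c' \<in> fatou_comp ((f ^^ i) c) \<Longrightarrow> i \<le> l + s"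
proof (cases "\<exists>i l. (f ^^ l) c' \<in> fatou_comp ((f ^^ i) c)")
  case False
  then show ?thesis using that by blast
next
  case True
  then obtain i0 l0 where 0: "(f ^^ l0) c' \<in> fatou_comp ((f ^^ i0) c)" by blast
  have uniq: "i = j" if "y \<in> fatou_comp ((f ^^ i) c)" "y \<in> fatou_comp ((f ^^ j) c)" for i j y
  proof -
    have lt: False if "i < j" "y \<in> fatou_comp ((f ^^ i) c)" "y \<in> fatou_comp ((f ^^ j) c)" for i j
    proof -
      have "fatou_comp ((f ^^ i) c) = fatou_comp ((f ^^ j) c)"
        using that by (metis connected_component_eq)
      then have "(f ^^ j) c \<in> fatou_comp ((f ^^ i) c)"
        using fatou_iter[OF c(2)] by (simp add: connected_component_refl)
      then have "returning c" unfolding returning_def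
        using that(1) by (intro exI[of _ i] exI[of _ "j - i"]) simp
      then show False using c by simp
    qed
    show ?thesis using lt that by (metis linorder_neqE_nat)
  qed
  have "i \<le> l + i0" if il: "(f ^^ l) c' \<in> fatou_comp ((f ^^ i) c)" for i l
  proof -
    have "(f ^^ (l + l0)) c' \<in> fatou_comp ((f ^^ (i + l0)) c)"
      using comp_iter[OF il, of l0] by (simp add: iter_add add.commute)
    moreover have "(f ^^ (l + l0)) c' \<in> fatou_comp ((f ^^ (l + i0)) c)"
      using comp_iter[OF 0, of l] by (simp add: iter_add)
    ultimately show ?thesis using uniq by fastforce
  qed
  then show ?thesis using that by blast
qed

text \<open>Otherwise the frontier of \<open>U\<close> lies in the closure of the postcritical set. Choose \<open>\<kappa>\<close> there such that
  only orbits with pairwise distinct Fatou components come close to it. Minimising the quotient \<open>\<omega>\<close> of the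
  distance to the Julia set and the distance to the circle of radius \<open>\<tau>\<close> around \<open>\<kappa>\<close> over the points of these
  orbits produces points \<open>y m\<close> near which, at the scale of their distance to the Julia set, all inverse
  branches exist; their limit function blows up a Julia point to a disk avoiding \<open>core\<close>.\<close>

theorem critical_value_in_julia: "\<exists>c\<in>critical_values f. c \<notin> fatou_set f"
proof (rule ccontr)
  assume "\<not> ?thesis"
  then have CF: "\<And>c. c \<in> critical_values f \<Longrightarrow> c \<in> fatou_set f" by blast
  let ?CV = "critical_values f"
  have "\<exists>i p. returning c \<longrightarrow> (p \<ge> 1 \<and> (f ^^ (i + p)) c \<in> fatou_comp ((f ^^ i) c))" for c
    by (auto simp: returning_def)
  then obtain I P where IP: "\<And>c. returning c \<Longrightarrow> P c \<ge> 1 \<and> (f ^^ (I c + P c)) c \<in> fatou_comp ((f ^^ I c) c)"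
    by metis
  \<comment> \<open>Among frontier points of \<open>U\<close>, a returning orbit can accumulate only
    at fixed points of \<open>f ^^ P c\<close>. Off the countable set \<open>Z\<close> it keeps a
    positive distance.\<close>
  define Z where "Z = (\<Union>c\<in>{c\<in>?CV. returning c}. {z. (f ^^ P c) z = z})"
  have "countable Z"
    unfolding Z_def using finite_crit IP fixed_points_countable
    by (intro countable_UN) (auto intro: countable_finite)
  then have "\<not> frontier U \<subseteq> Z" using uncountable_frontier countable_subset by metis
  then obtain \<kappa> where \<kappa>: "\<kappa> \<in> frontier U" "\<kappa> \<notin> Z" by auto
  have "\<exists>\<tau>>0. returning c \<longrightarrow> (\<forall>l. \<tau> \<le> dist ((f ^^ l) c) \<kappa>)" if "c \<in> ?CV" for c
  proof (cases "returning c")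
    case True
    then have "(f ^^ P c) \<kappa> \<noteq> \<kappa>" using \<kappa>(2) that by (auto simp: Z_def)
    show ?thesis
      by (rule returning_orbit_avoids[OF CF[OF that] conjunct2[OF IP[OF True]] \<kappa>(1) \<open>(f ^^ P c) \<kappa> \<noteq> \<kappa>\<close>]) blast
  qed (auto intro: exI[of _ 1])
  then obtain T where T: "\<And>c. c \<in> ?CV \<Longrightarrow> T c > 0" "\<And>c l. c \<in> ?CV \<Longrightarrow> returning c \<Longrightarrow> T c \<le> dist ((f ^^ l) c) \<kappa>"
    by metis
  obtain r0 where r0: "r0 > 0" "ball \<kappa> r0 \<inter> core = {}" using far_from_core[OF \<kappa>(1)] .
  define \<tau> where "\<tau> = Min (insert r0 (T ` ?CV))"
  have \<tau>: "\<tau> > 0" "\<tau> \<le> r0" "\<And>c. c \<in> ?CV \<Longrightarrow> \<tau> \<le> T c"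
    using finite_crit T(1) r0 by (auto simp: \<tau>_def)
  define J where "J = - fatou_set f"
  have J: "closed J" "J \<noteq> {}" "\<kappa> \<in> J"
    using closed_julia frontier_notin_fatou \<kappa>(1) by (auto simp: J_def)
  define E where "E = (\<lambda>z. infdist z J)"
  have Epos: "E z > 0" if "z \<in> fatou_set f" for z
    unfolding E_def using infdist_pos_not_in_closed[OF J(1,2)] that by (auto simp: J_def)
  have Ele: "E z \<le> dist z y" if "y \<in> J" for z y
    unfolding E_def using infdist_le[OF that] .
  let ?W = "{c\<in>?CV. \<not> returning c}"
  define \<omega> where "\<omega> = (\<lambda>c l. E ((f ^^ l) c) / (\<tau> - dist ((f ^^ l) c) \<kappa>))"
  have \<omega>pos: "\<omega> c l > 0" if "c \<in> ?CV" "dist ((f ^^ l) c) \<kappa> < \<tau>" for c l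
    unfolding \<omega>_def using Epos[OF fatou_iter[OF CF[OF that(1)]]] that(2) by simp
  \<comment> \<open>Besides being small, the quotient at time \<open>i\<close> is minimal over all
    nonreturning orbits up to time \<open>i\<close> within distance \<open>\<tau>\<close> of
    \<open>\<kappa>\<close>. Later times are left out because only earlier ones obstruct inverse
    branches of the iterate.\<close>
  define Q where "Q = (\<lambda>c \<delta> i. dist ((f ^^ i) c) \<kappa> < \<tau> \<and> \<omega> c i < \<delta> \<and>
     (\<forall>c'\<in>?W. \<forall>l\<le>i. dist ((f ^^ l) c') \<kappa> < \<tau> \<longrightarrow> \<omega> c i \<le> \<omega> c' l))"
  have Qex: "\<exists>c\<in>?W. \<exists>i. Q c \<delta> i" if \<delta>: "\<delta> > 0" for \<delta>
  proof -
    define \<epsilon> where "\<epsilon> = min (\<tau> / 2) (\<delta> * \<tau> / 4)"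
    have \<epsilon>: "\<epsilon> > 0" using \<tau> \<delta> by (simp add: \<epsilon>_def)
    obtain y where "y \<in> postcritical" "dist y \<kappa> < \<epsilon>"
      using frontier_subset_closure_postcritical[OF \<kappa>(1)] \<epsilon> closure_approachable by metis
    then obtain c0 l0 where c0: "c0 \<in> ?CV" "dist ((f ^^ l0) c0) \<kappa> < \<epsilon>"
      by (auto simp: postcritical_def)
    have lt: "dist ((f ^^ l0) c0) \<kappa> < \<tau> / 2" using c0(2) by (simp add: \<epsilon>_def)
    have c0W: "c0 \<in> ?W"
      using c0(1) T(2)[OF c0(1), of l0] \<tau>(3)[OF c0(1)] lt \<tau>(1) by fastforce
    have "\<omega> c0 l0 \<le> \<epsilon> / (\<tau> / 2)"
      unfolding \<omega>_def using lt \<tau>(1) c0(2) Ele[OF J(3), of "(f ^^ l0) c0"] \<epsilon>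
      by (intro frac_le) auto
    also have "\<dots> \<le> (\<delta> * \<tau> / 4) / (\<tau> / 2)"
      using \<tau>(1) by (intro divide_right_mono) (auto simp: \<epsilon>_def)
    also have "\<dots> < \<delta>" using \<tau>(1) \<delta> by simp
    finally have small: "\<omega> c0 l0 < \<delta>" .
    define A where "A = {(c, l). c \<in> ?W \<and> l \<le> l0 \<and> dist ((f ^^ l) c) \<kappa> < \<tau>}"
    have "finite A"
      by (rule finite_subset[of _ "?W \<times> {..l0}"]) (use finite_crit in \<open>auto simp: A_def\<close>)
    moreover have A0: "(c0, l0) \<in> A" using c0W lt \<tau>(1) by (auto simp: A_def)
    ultimately obtain ci where ci: "ci \<in> A" "\<And>a. a \<in> A \<Longrightarrow> (case_prod \<omega>) ci \<le> (case_prod \<omega>) a"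
      using arg_min_if_finite[of A "case_prod \<omega>"] by (metis empty_iff not_less)
    obtain c i where "ci = (c, i)" by (cases ci)
    then have c: "c \<in> ?W" "i \<le> l0" "dist ((f ^^ i) c) \<kappa> < \<tau>"
        "\<And>c' l. (c', l) \<in> A \<Longrightarrow> \<omega> c i \<le> \<omega> c' l"
      using ci by (auto simp: A_def)
    have "Q c \<delta> i"
      unfolding Q_def
    proof (intro conjI ballI allI impI)
      show "\<omega> c i < \<delta>" using c(4)[OF A0] small by simp
      show "\<omega> c i \<le> \<omega> c' l" if "c' \<in> ?W" "l \<le> i" "dist ((f ^^ l) c') \<kappa> < \<tau>" for c' l
        by (rule c(4)) (use that c(2) in \<open>auto simp: A_def\<close>)
    qed (rule c(3))
    then show ?thesis using c(1) by blast
  qed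
  have "\<exists>c\<in>?W. \<forall>\<delta>>0. \<exists>i. Q c \<delta> i"
  proof (rule ccontr)
    assume "\<not> ?thesis"
    then obtain d where d: "\<And>c. c \<in> ?W \<Longrightarrow> d c > 0 \<and> (\<forall>i. \<not> Q c (d c) i)" by metis
    define \<delta> where "\<delta> = Min (insert 1 (d ` ?W))"
    have "\<delta> > 0" "\<And>c. c \<in> ?W \<Longrightarrow> \<delta> \<le> d c" using d finite_crit by (auto simp: \<delta>_def)
    moreover from this obtain c i where "c \<in> ?W" "Q c \<delta> i" using Qex by blast
    ultimately have "Q c (d c) i" "c \<in> ?W" by (fastforce simp: Q_def)+
    then show False using d by blast
  qed
  then obtain c where c: "c \<in> ?CV" "\<not> returning c" and Qc: "\<And>\<delta>. \<delta> > 0 \<Longrightarrow> \<exists>i. Q c \<delta> i" by blast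
  \<comment> \<open>\<open>\<omega>\<close> is positive at the finitely many relevant times below
    \<open>N\<close>, so a \<open>\<delta>\<close> not exceeding any of these values forces
    \<open>i \<ge> N\<close>.\<close>
  have Qlarge: "\<exists>i\<ge>N. Q c (1/8) i" for N
  proof -
    define L where "L = {l. l < N \<and> dist ((f ^^ l) c) \<kappa> < \<tau>}"
    define \<delta> where "\<delta> = Min (insert (1/8) (\<omega> c ` L))"
    have fL: "finite L" by (auto simp: L_def)
    have "\<And>l. l \<in> L \<Longrightarrow> \<omega> c l > 0" using \<omega>pos[OF c(1)] by (auto simp: L_def)
    then have \<delta>: "\<delta> > 0" "\<And>l. l \<in> L \<Longrightarrow> \<delta> \<le> \<omega> c l"
      using fL by (auto simp: \<delta>_def)
    have \<delta>8: "\<delta> \<le> 1/8" unfolding \<delta>_def using fL by (intro Min_le) auto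
    obtain i where i: "Q c \<delta> i" using Qc[OF \<delta>(1)] by blast
    have "i \<notin> L" using i \<delta>(2)[of i] by (auto simp: Q_def)
    then have "i \<ge> N" using i by (auto simp: Q_def L_def)
    moreover have "Q c (1/8) i" using i \<delta>8 by (auto simp: Q_def)
    ultimately show ?thesis by blast
  qed
  have "\<exists>s. \<forall>i l. (f ^^ l) c' \<in> fatou_comp ((f ^^ i) c) \<longrightarrow> i \<le> l + s" if "c' \<in> ?CV" for c'
    using nonreturning_shift[OF c(2) CF[OF c(1)] CF[OF that]] by metis
  then obtain s where s: "\<And>c' i l. c' \<in> ?CV \<Longrightarrow> (f ^^ l) c' \<in> fatou_comp ((f ^^ i) c) \<Longrightarrow> i \<le> l + s c'"
    by metis
  define I0 where "I0 = Max (s ` ?CV)"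
  have I0: "i \<le> l + I0" if "c' \<in> ?CV" "(f ^^ l) c' \<in> fatou_comp ((f ^^ i) c)" for c' i l
  proof -
    have "s c' \<le> I0" using that(1) finite_crit by (auto simp: I0_def)
    then show ?thesis using s[OF that] by simp
  qed
  have "\<exists>im. \<forall>m. im m \<ge> I0 + m \<and> Q c (1/8) (im m)"
    by (rule choice) (use Qlarge in blast)
  then obtain im where im: "\<And>m. im m \<ge> I0 + m" "\<And>m. Q c (1/8) (im m)" by blast
  define y where "y = (\<lambda>m. (f ^^ im m) c)"
  have yF: "y m \<in> fatou_set f" for m unfolding y_def using fatou_iter CF c(1) by blast
  have "\<exists>a\<in>J. E (y m) = dist (y m) a" for m
    unfolding E_def using infdist_attains_inf[OF J(1,2)] by metis
  then obtain a where a: "\<And>m. a m \<in> J" "\<And>m. E (y m) = dist (y m) (a m)" by metis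
  define A where "A = (\<lambda>m s. a m + s * (y m - a m))"
  \<comment> \<open>In the rescaled coordinate 0 is the nearest Julia point \<open>a m\<close> and 1
    is \<open>y m\<close>. The first disk corresponds to \<open>ball (y m) (e m)\<close>, inside one
    Fatou component; the second makes the Julia point an interior point of the domain.\<close>
  define D where "D = ball (1::complex) 1 \<union> ball 0 (3/4)"
  define e where "e = (\<lambda>m. E (y m))"
  have epos: "e m > 0" for m using Epos yF by (simp add: e_def)
  have ne: "norm (y m - a m) = e m" for m using a(2)[of m] by (simp add: e_def dist_norm)
  \<comment> \<open>This restates that the quotient is below 1/8: the scale \<open>e m\<close> is
    small compared with the distance to the circle, so nearby points have nearly the same
    denominator in \<open>\<omega>\<close>.\<close>
  have e8: "8 * e m < \<tau> - dist (y m) \<kappa>" and y\<tau>: "dist (y m) \<kappa> < \<tau>" for m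
  proof -
    have q: "dist (y m) \<kappa> < \<tau>" "\<omega> c (im m) < 1/8" using im(2)[of m] by (auto simp: Q_def y_def)
    then show "8 * e m < \<tau> - dist (y m) \<kappa>" "dist (y m) \<kappa> < \<tau>"
      by (auto simp: \<omega>_def e_def y_def field_simps)
  qed
  have AD: "A m t \<in> ball (y m) (e m) \<or> A m t \<in> ball (a m) (3/4 * e m)" if "t \<in> D" for m t
  proof -
    have "t \<in> ball 1 1 \<or> t \<in> ball 0 (3/4)" using that by (auto simp: D_def)
    then show ?thesis
    proof
      assume "t \<in> ball 1 1"
      then have "norm (1 - t) < 1" by (simp add: dist_norm)
      moreover have "y m - A m t = (1 - t) * (y m - a m)" by (simp add: A_def algebra_simps)
      ultimately have "norm (y m - A m t) < 1 * e m"
        using epos[of m] by (simp add: norm_mult ne)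
      then show ?thesis by (simp add: dist_norm)
    next
      assume "t \<in> ball 0 (3/4)"
      then have "norm t * e m < 3/4 * e m" using epos[of m] by simp
      then show ?thesis by (simp add: A_def dist_norm norm_mult ne)
    qed
  qed
  have Ae: "dist (A m t) (y m) < 2 * e m" if "t \<in> D" for m t
    using AD[OF that, of m]
  proof
    assume "A m t \<in> ball (a m) (3/4 * e m)"
    then have "dist (A m t) (y m) < 3/4 * e m + e m"
      using dist_triangle[of "A m t" "y m" "a m"] ne[of m] by (simp add: dist_norm norm_minus_commute)
    then show ?thesis using epos[of m] by simp
  qed (use epos[of m] in \<open>simp add: dist_commute\<close>)
  have A\<kappa>: "A m t \<in> ball \<kappa> \<tau>" if "t \<in> D" for m t
    using Ae[OF that, of m] e8[of m] epos[of m] dist_triangle[of "A m t" \<kappa> "y m"] by (simp add: dist_commute)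
  \<comment> \<open>An orbit point in the disk about \<open>y m\<close> shares its Fatou component,
    so its time is at least \<open>im m - I0\<close>. One in the disk about \<open>a m\<close> has
    numerator below 3/4 of that at \<open>y m\<close>; its denominator stays above 3/4 of the one at
    \<open>y m\<close>, having changed by less than \<open>2 * e m\<close>, a quarter of it. Its
    quotient would then violate minimality.\<close>
  have nosing: "(f ^^ l) c' \<notin> A m ` D" if l: "l < im m - I0" and c': "c' \<in> ?CV" for l c' m
  proof
    assume "(f ^^ l) c' \<in> A m ` D"
    then obtain t where t: "t \<in> D" "(f ^^ l) c' = A m t" by blast
    have "(f ^^ l) c' \<in> ball \<kappa> \<tau>" using A\<kappa>[OF t(1), of m] t(2) by simp
    then have dl: "dist ((f ^^ l) c') \<kappa> < \<tau>" by (simp add: dist_commute)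
    then have nr: "\<not> returning c'" using T(2)[OF c', of l] \<tau>(3)[OF c'] by linarith
    from AD[OF t(1), of m] show False
    proof
      assume "A m t \<in> ball (y m) (e m)"
      moreover have "ball (y m) (e m) \<subseteq> fatou_comp (y m)"
      proof (rule connected_component_maximal)
        show "ball (y m) (e m) \<subseteq> fatou_set f"
        proof
          fix z assume "z \<in> ball (y m) (e m)"
          then show "z \<in> fatou_set f" using Ele[of z "y m"] by (auto simp: J_def e_def dest!: not_less[THEN iffD2, rotated])
        qed
      qed (use epos in auto)
      ultimately have "(f ^^ l) c' \<in> fatou_comp ((f ^^ im m) c)" using t(2) by (auto simp: y_def)
      then have "im m \<le> l + I0" by (rule I0[OF c'])
      then show False using l by simp
    next
      assume "A m t \<in> ball (a m) (3/4 * e m)"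
      then have El: "E ((f ^^ l) c') < 3/4 * e m"
        using Ele[OF a(1)[of m], of "(f ^^ l) c'"] t(2) by (simp add: dist_commute)
      define R where "R = \<tau> - dist (y m) \<kappa>"
      have R: "R > 0" "8 * e m < R" using e8[of m] y\<tau>[of m] by (auto simp: R_def)
      have "dist ((f ^^ l) c') \<kappa> < 2 * e m + dist (y m) \<kappa>"
        using Ae[OF t(1), of m] t(2) dist_triangle[of "A m t" \<kappa> "y m"] by simp
      then have Rl: "\<tau> - dist ((f ^^ l) c') \<kappa> > 3/4 * R" using R(2) by (simp add: R_def)
      have "\<omega> c' l < (3/4 * e m) / (3/4 * R)"
        unfolding \<omega>_def
      proof (rule frac_less)
        show "0 \<le> E ((f ^^ l) c')" by (simp add: E_def infdist_nonneg)
      qed (use El Rl R in auto)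
      also have "\<dots> = e m / R" by (simp add: mult_divide_mult_cancel_left)
      also have "\<dots> = \<omega> c (im m)" by (simp add: \<omega>_def R_def e_def y_def)
      also have "\<dots> \<le> \<omega> c' l"
        using im(2)[of m] c' nr l dl by (auto simp: Q_def)
      finally show False by simp
    qed
  qed
  have D: "open D" "connected D" "simply_connected D" "0 \<in> D" "1 \<in> D"
  proof -
    have "starlike D"
      unfolding starlike_def
    proof (intro bexI ballI)
      show "(1/2::complex) \<in> D" by (auto simp: D_def dist_norm)
      fix x assume "x \<in> D"
      then show "closed_segment (1/2) x \<subseteq> D"
      proof (unfold D_def, elim UnE)
        assume "x \<in> ball 1 1"
        moreover have "1/2 \<in> ball (1::complex) 1" by (auto simp: dist_norm)
        ultimately have "closed_segment (1/2) x \<subseteq> ball 1 1" using closed_segment_subset convex_ball by blast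
        then show "closed_segment (1 / 2) x \<subseteq> ball 1 1 \<union> ball 0 (3 / 4)" by blast
      next
        assume "x \<in> ball 0 (3/4)"
        moreover have "1/2 \<in> ball (0::complex) (3/4)" by (auto simp: dist_norm)
        ultimately have "closed_segment (1/2) x \<subseteq> ball 0 (3/4)" using closed_segment_subset convex_ball by blast
        then show "closed_segment (1 / 2) x \<subseteq> ball 1 1 \<union> ball 0 (3 / 4)" by blast
      qed
    qed
    then show "simply_connected D" "connected D"
      by (auto intro: starlike_imp_simply_connected starlike_imp_connected)
  qed (auto simp: D_def)
  \<comment> \<open>Only \<open>im m - I0\<close> steps are undone, so all branches take the same
    Fatou point as value at 1. This bounds the family there and makes its limit nonconstant.\<close>
  define x1 where "x1 = (f ^^ I0) c"
  have "\<exists>g. g holomorphic_on D \<and> g 1 = x1 \<and> (\<forall>t\<in>D. (f ^^ (im m - I0)) (g t) = A m t)" for m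
  proof -
    have "A m holomorphic_on D" unfolding A_def by (intro holomorphic_intros)
    moreover have "(f ^^ (im m - I0)) x1 = A m 1"
      using im(1)[of m] by (simp add: x1_def iter_add A_def y_def)
    ultimately show ?thesis
      using iter_lift_exists[OF D(1,3) _ nosing D(5)] by metis
  qed
  then have "\<exists>g. \<forall>m. g m holomorphic_on D \<and> g m 1 = x1 \<and> (\<forall>t\<in>D. (f ^^ (im m - I0)) (g m t) = A m t)"
    by (intro choice allI)
  then obtain g where g: "\<And>m. g m holomorphic_on D" "\<And>m. g m 1 = x1"
      "\<And>m t. t \<in> D \<Longrightarrow> (f ^^ (im m - I0)) (g m t) = A m t" by blast
  have Acore: "A m t \<notin> core" if "t \<in> D" for m t
    using A\<kappa>[OF that, of m] r0(2) \<tau>(2) by (meson disjoint_iff subsetD subset_ball)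
  have nf: "normal_family_on D (range g)"
    by (rule normal_family_omitting_two[OF D(1,2) _ core_points(3)])
      (use g section_omits_core Acore in \<open>blast+\<close>)
  have bd: "norm (g m 1) \<le> norm x1" for m using g(2) by simp
  obtain G r where G: "G holomorphic_on D" "strict_mono (r :: nat \<Rightarrow> nat)"
      "\<And>K. compact K \<Longrightarrow> K \<subseteq> D \<Longrightarrow> uniform_limit K (\<lambda>k. g (r k)) G sequentially"
    by (rule normal_family_converges[OF nf D(5) bd], rule that) blast+
  have lim: "(\<lambda>k. g (r k) x) \<longlonglongrightarrow> G x" if "x \<in> D" for x
    by (rule locally_uniform_limit_pointwise[OF G(3) that])
  have "G 1 = x1" using lim[OF D(5)] g(2) by (simp add: LIMSEQ_const_iff)
  moreover have "x1 \<in> fatou_set f" unfolding x1_def using fatou_iter CF c(1) by blast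
  moreover have G0: "G 0 \<notin> fatou_set f"
  proof -
    have "g (r k) 0 \<in> - fatou_set f" for k
      using fatou_iter[of "g (r k) 0" "im (r k) - I0"] g(3)[OF D(4), of "r k"] a(1)[of "r k"] by (auto simp: A_def J_def)
    then show ?thesis using closed_sequentially[OF closed_julia _ lim[OF D(4)]] by blast
  qed
  ultimately have nc: "\<not> G constant_on D" using D(4,5) unfolding constant_on_def by metis
  obtain \<eta> where \<eta>: "\<eta> > 0" "\<forall>\<^sub>F k in sequentially. ball (G 0) \<eta> \<subseteq> g (r k) ` D"
    using common_disk_in_images[OF _ G(1) D(1,2) G(3) nc D(4)] g(1) by metis
  obtain v t where v: "v \<in> ball (G 0) \<eta>" "\<And>k. k \<ge> t \<Longrightarrow> (f ^^ k) v \<in> core"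
    using blow_up[OF G0 \<eta>(1)] by metis
  obtain k where k: "k \<ge> t" "ball (G 0) \<eta> \<subseteq> g (r k) ` D"
    using \<eta>(2) unfolding eventually_sequentially by (metis max.cobounded1 max.cobounded2)
  then obtain x where x: "x \<in> D" "v = g (r k) x" using v(1) by blast
  have "r k \<ge> k" using seq_suble[OF G(2)] .
  then have "im (r k) - I0 \<ge> t" using im(1)[of "r k"] k(1) by linarith
  then have "A (r k) x \<in> core" using v(2)[of "im (r k) - I0"] x g(3) by auto
  then show False using Acore[OF x(1)] by blast
qed

end

section \<open>Tracts in logarithmic coordinates\<close>

lemma exp_eq_iff_int:
  "exp (w::complex) = exp z \<longleftrightarrow> (\<exists>k::int. w = z + of_int k * (2 * of_real pi * \<i>))"
  unfolding exp_eq by (auto simp: mult_ac)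

lemma exp_add_int [simp]: "exp (z + of_int k * (2 * of_real pi * \<i>)) = exp z"
  using exp_eq_iff_int by metis

lemma vertical_period_reduce:
  fixes \<phi> :: "complex \<Rightarrow> complex"
  assumes shift: "\<And>s t. s \<in> S \<Longrightarrow> s + of_real t * \<i> \<in> S"
    and per: "\<And>s. s \<in> S \<Longrightarrow> \<phi> (s + of_real y * \<i>) = \<phi> s" and y: "y \<noteq> 0" and s: "s \<in> S"
  shows "\<exists>s'\<in>S. \<phi> s' = \<phi> s \<and> Re s' = Re s \<and> \<bar>Im s'\<bar> \<le> \<bar>y\<bar>"
proof -
  define p where "p = of_real y * \<i>"
  have p: "Re p = 0" "Im p = y" by (simp_all add: p_def)
  have shift': "\<zeta> + of_real t * p \<in> S" if "\<zeta> \<in> S" for \<zeta> t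
    using shift[OF that, of "t * y"] by (simp add: p_def mult_ac)
  have pern: "\<phi> (\<zeta> + of_nat l * p) = \<phi> \<zeta>" if "\<zeta> \<in> S" for \<zeta> l
  proof (induction l)
    case (Suc l)
    then show ?case
      using per[of "\<zeta> + of_nat l * p"] shift'[OF that, of "of_nat l"] by (simp add: algebra_simps p_def)
  qed simp
  have perz: "\<phi> (\<zeta> + of_int l * p) = \<phi> \<zeta>" if "\<zeta> \<in> S" for \<zeta> l
  proof (cases "0 \<le> l")
    case True
    then show ?thesis using pern[OF that, of "nat l"] by simp
  next
    case False
    then have "of_nat (nat (- l)) = (- of_int l :: complex)" by simp
    then show ?thesis
      using pern[of "\<zeta> + of_int l * p" "nat (- l)"] shift'[OF that, of "of_int l"] by simp
  qed
  define l where "l = - \<lfloor>Im s / y\<rfloor>"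
  have "Im s + of_int l * y = y * frac (Im s / y)"
    using y by (simp add: l_def frac_def field_simps)
  then have "\<bar>Im (s + of_int l * p)\<bar> = \<bar>y\<bar> * frac (Im s / y)"
    by (simp add: p abs_mult)
  also have "\<dots> \<le> \<bar>y\<bar> * 1" by (intro mult_left_mono) (auto simp: less_imp_le frac_lt_1)
  finally show ?thesis
    using perz[OF s, of l] shift'[OF s, of "of_int l"] p by (intro bexI[of _ "s + of_int l * p"]) auto
qed

text \<open>The first bound on \<open>R\<close> keeps the critical values out of the region covered
  by tracts. The second keeps \<open>b\<close> out of the tracts themselves, since their points have
  images at distance more than \<open>R\<close> from \<open>b\<close>; so a logarithm of
  \<open>z - b\<close> exists on each tract.\<close>

locale two_singular = tame_entire f for f +
  fixes a b :: complex and R :: real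
  assumes CV: "critical_values f = {a, b}" and R: "dist a b < R" "dist (f b) b < R"
begin

definition H :: "complex set" where "H = {z. ln R < Re z}"

lemma R_pos: "0 < R"
  using R(1) zero_le_dist[of a b] by linarith

lemma H: "open H" "convex H" "simply_connected H" "connected H"
proof -
  show "open H" "convex H"
    unfolding H_def by (simp_all add: open_halfspace_Re_gt convex_halfspace_Re_gt)
  then show "simply_connected H" "connected H"
    by (simp_all add: convex_imp_simply_connected convex_connected)
qed

lemma norm_exp_H: "\<zeta> \<in> H \<Longrightarrow> R < norm (exp \<zeta>)"
  using R_pos exp_less_mono[of "ln R" "Re \<zeta>"] by (simp add: H_def norm_exp_eq_Re)

lemma H_image: "(\<lambda>\<zeta>. b + exp \<zeta>) ` H \<inter> critical_values f = {}"
  using norm_exp_H R R_pos by (fastforce simp: CV dist_norm)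

lemma tract_map:
  assumes "\<zeta>0 \<in> H" "f x = b + exp \<zeta>0"
  obtains \<phi> where "\<phi> holomorphic_on H" "\<phi> \<zeta>0 = x" "\<And>\<zeta>. \<zeta> \<in> H \<Longrightarrow> f (\<phi> \<zeta>) = b + exp \<zeta>"
proof -
  have "(\<lambda>\<zeta>. b + exp \<zeta>) holomorphic_on H" by (intro holomorphic_intros)
  from lift_exists[OF H(1,3) this H_image assms] show ?thesis using that by blast
qed

lemma tract_map_unique:
  assumes "g1 holomorphic_on H" "g2 holomorphic_on H"
    "\<And>\<zeta>. \<zeta> \<in> H \<Longrightarrow> f (g1 \<zeta>) = b + exp \<zeta>" "\<And>\<zeta>. \<zeta> \<in> H \<Longrightarrow> f (g2 \<zeta>) = b + exp \<zeta>"
    "z \<in> H" "g1 z = g2 z" "\<zeta> \<in> H"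
  shows "g1 \<zeta> = g2 \<zeta>"
proof (rule lift_unique[of H g1 g2 z \<zeta>])
  show "deriv f (g1 x) \<noteq> 0" if "x \<in> H" for x
    using H_image assms(3)[OF that] that by (intro not_crit) auto
qed (use assms H in \<open>auto simp: holomorphic_on_imp_continuous_on\<close>)

text \<open>A periodic \<open>\<phi>\<close> maps a half-plane onto a neighbourhood of infinity.\<close>

lemma noninjective_tract:
  assumes \<phi>: "\<phi> holomorphic_on H" "\<And>\<zeta>. \<zeta> \<in> H \<Longrightarrow> f (\<phi> \<zeta>) = b + exp \<zeta>" and ninj: "\<not> inj_on \<phi> H"
  shows "filterlim f at_infinity at_infinity"
proof -
  obtain \<zeta>1 \<zeta>2 where \<zeta>: "\<zeta>1 \<in> H" "\<zeta>2 \<in> H" "\<zeta>1 \<noteq> \<zeta>2" "\<phi> \<zeta>1 = \<phi> \<zeta>2"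
    using ninj by (auto simp: inj_on_def)
  then have "exp \<zeta>1 = exp \<zeta>2" using \<phi>(2) by (metis add_left_cancel)
  then obtain k :: int where k: "\<zeta>1 = \<zeta>2 + of_int k * (2 * of_real pi * \<i>)"
    unfolding exp_eq_iff_int by blast
  define y where "y = 2 * pi * of_int k"
  have y0: "y \<noteq> 0" using k \<zeta>(3) by (auto simp: y_def)
  have ky: "of_int k * (2 * of_real pi * \<i>) = of_real y * \<i>" by (simp add: y_def)
  have shift: "\<zeta> + of_real t * \<i> \<in> H" if "\<zeta> \<in> H" for \<zeta> t
    using that by (simp add: H_def)
  have per: "\<phi> (\<zeta> + of_real y * \<i>) = \<phi> \<zeta>" if "\<zeta> \<in> H" for \<zeta>
  proof (rule tract_map_unique[of "\<lambda>\<zeta>. \<phi> (\<zeta> + of_real y * \<i>)" \<phi> \<zeta>2 \<zeta>])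
    show "(\<lambda>\<zeta>. \<phi> (\<zeta> + of_real y * \<i>)) holomorphic_on H"
      by (rule holomorphic_on_compose_gen[OF _ \<phi>(1), of "\<lambda>\<zeta>. \<zeta> + of_real y * \<i>", unfolded o_def])
        (use shift in \<open>auto intro!: holomorphic_intros\<close>)
    show "f (\<phi> (z + of_real y * \<i>)) = b + exp z" if "z \<in> H" for z
      using \<phi>(2)[OF shift[OF that, of y]] exp_add_int[of z k] by (simp only: ky)
    show "\<phi> (\<zeta>2 + of_real y * \<i>) = \<phi> \<zeta>2" using \<zeta>(4) k ky by simp
  qed (use \<phi> \<zeta> that in auto)
  have reduce: "\<exists>\<zeta>'\<in>H. \<phi> \<zeta>' = \<phi> \<zeta> \<and> Re \<zeta>' = Re \<zeta> \<and> \<bar>Im \<zeta>'\<bar> \<le> \<bar>y\<bar>" if "\<zeta> \<in> H" for \<zeta>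
    by (rule vertical_period_reduce[of H \<phi> y, OF shift per y0 that])
  have large: "\<exists>K. \<forall>z. K \<le> norm z \<longrightarrow> r \<le> norm (f z)" for r
  proof -
    define \<rho> where "\<rho> = max (ln R + 1) (r + norm b)"
    define T where "T = \<phi> ` {\<zeta>. \<rho> < Re \<zeta>}"
    define \<Gamma> where "\<Gamma> = \<phi> ` cbox (Complex \<rho> (-\<bar>y\<bar>)) (Complex \<rho> \<bar>y\<bar>)"
    have \<rho>H: "\<rho> \<le> Re \<zeta> \<Longrightarrow> \<zeta> \<in> H" for \<zeta> by (auto simp: H_def \<rho>_def)
    have "compact \<Gamma>"
      unfolding \<Gamma>_def
      by (intro compact_continuous_image compact_cbox holomorphic_on_imp_continuous_on holomorphic_on_subset[OF \<phi>(1)])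
        (auto simp: in_cbox_complex_iff intro: \<rho>H)
    then obtain K where K: "\<And>z. z \<in> \<Gamma> \<Longrightarrow> norm z \<le> K"
      using compact_imp_bounded bounded_iff by metis
    have nc: "\<not> \<phi> constant_on H"
    proof
      assume "\<phi> constant_on H"
      then obtain c where "\<And>\<zeta>. \<zeta> \<in> H \<Longrightarrow> \<phi> \<zeta> = c" by (auto simp: constant_on_def)
      then have "b + exp (of_real (\<rho>+1)) = b + exp (of_real \<rho> :: complex)"
        using \<phi>(2)[of "of_real (\<rho> + 1)"] \<phi>(2)[of "of_real \<rho>"] \<rho>H[of "of_real (\<rho>+1)"] \<rho>H[of "of_real \<rho>"] by simp
      then have "norm (exp (of_real (\<rho>+1) :: complex)) = norm (exp (of_real \<rho> :: complex))" by simp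
      then show False by (simp only: norm_exp_eq_Re) simp
    qed
    have openT: "open T"
      unfolding T_def
      by (rule open_mapping_thm[OF \<phi>(1) H(1,4) open_halfspace_Re_gt _ nc]) (auto intro: \<rho>H)
    have closT: "\<exists>\<zeta>. \<rho> \<le> Re \<zeta> \<and> \<phi> \<zeta> = w" if w: "w \<in> closure T" for w
    proof -
      obtain z where z: "\<And>k. z k \<in> T" "z \<longlonglongrightarrow> w" using w closure_sequential by metis
      have "\<exists>\<zeta>. \<rho> \<le> Re \<zeta> \<and> \<phi> \<zeta> = z k \<and> \<bar>Im \<zeta>\<bar> \<le> \<bar>y\<bar>" for k
      proof -
        obtain \<zeta> where "\<rho> < Re \<zeta>" "z k = \<phi> \<zeta>" using z(1)[of k] by (auto simp: T_def)
        moreover from this obtain \<zeta>' where "\<phi> \<zeta>' = \<phi> \<zeta>" "Re \<zeta>' = Re \<zeta>" "\<bar>Im \<zeta>'\<bar> \<le> \<bar>y\<bar>"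
          using reduce[OF \<rho>H[of \<zeta>]] by auto
        ultimately show ?thesis by (intro exI[of _ \<zeta>']) auto
      qed
      then obtain \<xi> where \<xi>: "\<And>k. \<rho> \<le> Re (\<xi> k)" "\<And>k. \<phi> (\<xi> k) = z k" "\<And>k. \<bar>Im (\<xi> k)\<bar> \<le> \<bar>y\<bar>" by metis
      have "(\<lambda>k. f (z k) - b) \<longlonglongrightarrow> f w - b"
        using z(2) isCont_f isCont_tendsto_compose by (intro tendsto_intros) blast
      then obtain B where B: "\<And>k. norm (f (z k) - b) \<le> B"
        using convergent_imp_Bseq convergentI BseqE by metis
      have "norm (\<xi> k) \<le> (\<bar>\<rho>\<bar> + \<bar>B\<bar>) + \<bar>y\<bar>" for k
      proof -
        have "f (z k) - b = exp (\<xi> k)" using \<phi>(2)[OF \<rho>H[OF \<xi>(1)], of k] \<xi>(2)[of k] by simp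
        then have "exp (Re (\<xi> k)) \<le> B" using B[of k] by (simp add: norm_exp_eq_Re)
        then have "Re (\<xi> k) \<le> B" using exp_ge_add_one_self[of "Re (\<xi> k)"] by linarith
        then show ?thesis using \<xi>(1)[of k] \<xi>(3)[of k] cmod_le[of "\<xi> k"] by linarith
      qed
      then obtain l r where l: "strict_mono (r :: nat \<Rightarrow> nat)" "(\<lambda>k. \<xi> (r k)) \<longlonglongrightarrow> l"
        using bounded_subsequence by metis
      have "(\<lambda>k. Re (\<xi> (r k))) \<longlonglongrightarrow> Re l" using l(2) by (intro tendsto_intros)
      then have Rel: "\<rho> \<le> Re l" using \<xi>(1) by (intro LIMSEQ_le_const) auto
      have "continuous_on H \<phi>" using \<phi>(1) by (simp add: holomorphic_on_imp_continuous_on)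
      then have "isCont \<phi> l" using \<rho>H[OF Rel] H(1) continuous_on_eq_continuous_at by blast
      then have "(\<lambda>k. \<phi> (\<xi> (r k))) \<longlonglongrightarrow> \<phi> l" using l(2) isCont_tendsto_compose by blast
      moreover have "(\<lambda>k. z (r k)) \<longlonglongrightarrow> w" using LIMSEQ_subseq_LIMSEQ[OF z(2) l(1)] by (simp add: o_def)
      ultimately have "\<phi> l = w" using \<xi>(2) LIMSEQ_unique by simp
      then show ?thesis using Rel by blast
    qed
    have front: "norm w \<le> K" if "w \<in> frontier T" for w
    proof -
      have w: "w \<in> closure T" "w \<notin> T" using that openT by (auto simp: frontier_def interior_open)
      obtain \<zeta> where \<zeta>: "\<rho> \<le> Re \<zeta>" "\<phi> \<zeta> = w" using closT[OF w(1)] by blast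
      then have "Re \<zeta> = \<rho>" using w(2) by (force simp: T_def)
      then obtain \<zeta>' where "\<phi> \<zeta>' = w" "Re \<zeta>' = \<rho>" "\<bar>Im \<zeta>'\<bar> \<le> \<bar>y\<bar>" using reduce[OF \<rho>H[OF \<zeta>(1)]] \<zeta>(2) by auto
      then have "w \<in> \<Gamma>" unfolding \<Gamma>_def by (intro image_eqI[of _ _ \<zeta>']) (auto simp: in_cbox_complex_iff)
      then show ?thesis using K by blast
    qed
    have ne: "\<not> T \<subseteq> cball 0 K"
    proof
      assume T: "T \<subseteq> cball 0 K"
      have "compact (f ` cball 0 K)" by (intro compact_continuous_image cont_on compact_cball)
      then obtain B where B: "\<And>z. z \<in> cball 0 K \<Longrightarrow> norm (f z) \<le> B"
        using compact_imp_bounded bounded_iff by (metis image_eqI)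
      define t where "t = max (\<rho> + 1) (B + norm b)"
      have "\<phi> (of_real t) \<in> T" by (auto simp: T_def t_def)
      then have "norm (f (\<phi> (of_real t))) \<le> B" using T B by blast
      moreover have "norm (exp (of_real t :: complex)) \<le> norm (f (\<phi> (of_real t))) + norm b"
        using \<phi>(2)[of "of_real t"] \<rho>H[of "of_real t"] norm_triangle_ineq4[of "b + exp (of_real t)" b]
        by (simp add: t_def)
      moreover have "exp t \<ge> 1 + t" by (rule exp_ge_add_one_self)
      moreover have "B + norm b \<le> t" by (simp add: t_def)
      moreover have "norm (exp (of_real t :: complex)) = exp t" by (simp add: norm_exp_eq_Re)
      ultimately show False by linarith
    qed
    \<comment> \<open>\<open>T\<close> is open and not contained in \<open>cball 0 K\<close>, and by
      periodicity its frontier lies in a compact set inside this ball. It therefore contains the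
      connected exterior.\<close>
    have "connected (- cball (0::complex) K)"
      by (intro connected_complement_bounded_convex) auto
    moreover have "- cball 0 K \<inter> frontier T = {}" using front by auto
    moreover have "- cball 0 K \<inter> T \<noteq> {}" using ne by blast
    ultimately have sub: "- cball 0 K \<subseteq> T"
      using connected_Int_frontier[of "- cball 0 K" T] by blast
    show ?thesis
    proof (intro exI allI impI)
      fix z :: complex assume "K + 1 \<le> norm z"
      then have "z \<in> T" using sub by auto
      then obtain \<zeta> where \<zeta>: "\<rho> < Re \<zeta>" "z = \<phi> \<zeta>" by (auto simp: T_def)
      have "norm (exp \<zeta>) \<le> norm (f z) + norm b"
        using \<phi>(2)[OF \<rho>H[of \<zeta>]] \<zeta> norm_triangle_ineq4[of "b + exp \<zeta>" b] by simp
      moreover have "exp (Re \<zeta>) \<ge> 1 + Re \<zeta>" by (rule exp_ge_add_one_self)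
      moreover have "r + norm b < Re \<zeta>" using \<zeta>(1) by (simp add: \<rho>_def)
      ultimately show "r \<le> norm (f z)" unfolding norm_exp_eq_Re by linarith
    qed
  qed
  show ?thesis
    unfolding filterlim_at_infinity[OF order.refl] eventually_at_infinity using large by blast
qed

end

text \<open>\<open>\<phi>\<close> uniformizes a tract over the exterior of the disk of radius \<open>R\<close> about \<open>b\<close>; \<open>G\<close> is the corresponding
  inverse branch of \<open>f\<close> in the logarithmic coordinate \<open>ln (z - b)\<close>.\<close>

locale tract = two_singular +
  fixes \<phi> G :: "complex \<Rightarrow> complex"
  assumes hol_\<phi>: "\<phi> holomorphic_on H" and lift: "\<And>\<zeta>. \<zeta> \<in> H \<Longrightarrow> f (\<phi> \<zeta>) = b + exp \<zeta>"
    and inj_\<phi>: "inj_on \<phi> H"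
    and hol_G: "G holomorphic_on H" and exp_G: "\<And>\<zeta>. \<zeta> \<in> H \<Longrightarrow> exp (G \<zeta>) = \<phi> \<zeta> - b"
begin

lemma exp_G_inj: "\<zeta> \<in> H \<Longrightarrow> \<zeta>' \<in> H \<Longrightarrow> exp (G \<zeta>) = exp (G \<zeta>') \<Longrightarrow> \<zeta> = \<zeta>'"
  using inj_\<phi> exp_G by (simp add: inj_on_def)

text \<open>The margin 100 puts disks of radius 100 about points of \<open>P\<close> inside
  \<open>H\<close>. A derivative above 1/2 would then yield, with the Bloch constant 1/12, a disk of
  radius 4 in the image of \<open>G\<close>, and 4 exceeds pi.\<close>

definition \<rho> :: real where "\<rho> = ln R + 100"
definition P :: "complex set" where "P = {\<zeta>. \<rho> \<le> Re \<zeta>}"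

lemma P_H: "P \<subseteq> H" by (auto simp: P_def H_def \<rho>_def)

lemma closed_P: "closed P" and convex_P: "convex P"
  unfolding P_def by (simp_all add: closed_halfspace_Re_ge convex_halfspace_Re_ge)

text \<open>The image of \<open>G\<close> contains no two points differing by \<open>2 * pi * \<i>\<close>, so Bloch's theorem applies.\<close>

lemma deriv_G:
  assumes "\<zeta> \<in> P" shows "norm (deriv G \<zeta>) \<le> 1/2"
proof (rule ccontr)
  assume "\<not> ?thesis"
  then have 4: "4 \<le> 100 * norm (deriv G \<zeta>) / 12" by simp
  have ball: "ball \<zeta> 100 \<subseteq> H"
  proof
    fix z assume "z \<in> ball \<zeta> 100"
    then have "\<bar>Re (\<zeta> - z)\<bar> < 100" using abs_Re_le_cmod[of "\<zeta> - z"] by (simp add: dist_norm)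
    then show "z \<in> H" using assms by (auto simp: P_def H_def \<rho>_def)
  qed
  obtain c where c: "ball c 4 \<subseteq> G ` ball \<zeta> 100"
    using Bloch[OF holomorphic_on_subset[OF hol_G ball] _ 4] by auto
  have "c + of_real pi * \<i> \<in> ball c 4" "c - of_real pi * \<i> \<in> ball c 4"
    using pi_less_4 by (auto simp: dist_norm norm_mult)
  then obtain x1 x2 where x: "x1 \<in> H" "x2 \<in> H" "G x1 = c + of_real pi * \<i>" "G x2 = c - of_real pi * \<i>"
  proof -
    obtain x1 where "x1 \<in> ball \<zeta> 100" "c + of_real pi * \<i> = G x1"
      using subsetD[OF c \<open>c + of_real pi * \<i> \<in> _\<close>] by blast
    moreover obtain x2 where "x2 \<in> ball \<zeta> 100" "c - of_real pi * \<i> = G x2"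
      using subsetD[OF c \<open>c - of_real pi * \<i> \<in> _\<close>] by blast
    ultimately show ?thesis using ball by (intro that[of x1 x2]) auto
  qed
  then have "G x1 = G x2 + of_int 1 * (2 * of_real pi * \<i>)" by simp
  then have "exp (G x1) = exp (G x2)" using exp_eq_iff_int by blast
  then have "x1 = x2" using exp_G_inj x by blast
  then show False using x by simp
qed

lemma G_lipschitz: "\<zeta> \<in> P \<Longrightarrow> \<zeta>' \<in> P \<Longrightarrow> norm (G \<zeta> - G \<zeta>') \<le> 1/2 * norm (\<zeta> - \<zeta>')"
proof (rule field_differentiable_bound[OF convex_P, of G "deriv G"])
  fix z assume z: "z \<in> P"
  then have "G field_differentiable at z"
    using holomorphic_on_imp_differentiable_at[OF hol_G H(1)] P_H by blast
  then show "(G has_field_derivative deriv G z) (at z within P)"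
    using field_differentiable_derivI has_field_derivative_at_within by blast
qed (use deriv_G in auto)

lemma cont_\<phi>: "S \<subseteq> H \<Longrightarrow> continuous_on S \<phi>"
  using hol_\<phi> holomorphic_on_imp_continuous_on continuous_on_subset by blast

lemma cont_G: "S \<subseteq> H \<Longrightarrow> continuous_on S G"
  using hol_G holomorphic_on_imp_continuous_on continuous_on_subset by blast

text \<open>If \<open>\<phi> (x m)\<close> tends to \<open>z\<close> along a subsequence, then
  \<open>exp (x m)\<close> tends to \<open>f z - b = exp s\<close> with \<open>s\<close> in
  \<open>H\<close>. As \<open>z\<close> is isolated among the preimages of \<open>f z\<close>,
  trapping forces \<open>\<phi>\<close> to take the value \<open>z\<close> at a translate of
  \<open>s\<close> close to \<open>x m\<close>. By injectivity this translate is always the same, so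
  the subsequence is bounded.\<close>

lemma \<phi>_proper: "bounded {\<zeta> \<in> P. norm (\<phi> \<zeta>) \<le> K}"
proof (rule ccontr)
  assume "\<not> ?thesis"
  then have "\<exists>\<zeta>\<in>P. norm (\<phi> \<zeta>) \<le> K \<and> norm \<zeta> > real m" for m
    unfolding bounded_iff by (auto simp: not_le)
  then obtain x where x: "\<And>m. x m \<in> P" "\<And>m. norm (\<phi> (x m)) \<le> K" "\<And>m. norm (x m) > real m" by metis
  have xH: "x m \<in> H" for m using x(1) P_H by blast
  obtain z r where r: "strict_mono (r :: nat \<Rightarrow> nat)" and z: "(\<lambda>m. \<phi> (x (r m))) \<longlonglongrightarrow> z"
    using bounded_subsequence[of "\<lambda>m. \<phi> (x m)"] x(2) by metis
  define u where "u = f z - b"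
  have "(\<lambda>m. f (\<phi> (x (r m))) - b) \<longlonglongrightarrow> f z - b"
    using z isCont_f isCont_tendsto_compose by (intro tendsto_intros) blast
  then have ex: "(\<lambda>m. exp (x (r m))) \<longlonglongrightarrow> u"
    using lift xH by (simp add: u_def)
  have "R * exp 100 \<le> norm (exp (x m))" for m
  proof -
    have "exp \<rho> \<le> exp (Re (x m))" using x(1)[of m] by (simp add: P_def)
    then show ?thesis using R_pos by (simp add: \<rho>_def exp_add)
  qed
  then have nu: "R * exp 100 \<le> norm u"
    using ex by (intro LIMSEQ_le_const[OF tendsto_norm]) auto
  have u0: "u \<noteq> 0" using nu R_pos by (smt (verit) exp_gt_zero mult_pos_pos norm_zero)
  define s where "s = Ln u"
  have es: "exp s = u" using u0 by (simp add: s_def)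
  have "R * 1 < R * exp 100" using R_pos by (intro mult_strict_left_mono) auto
  then have "R < exp (Re s)" using nu es by (metis mult_1_right norm_exp_eq_Re order_less_le_trans)
  then have "ln R < Re s" using R_pos by (metis ln_exp ln_less_cancel_iff exp_gt_zero)
  then have sH: "s \<in> H" by (simp add: H_def)
  have fz: "f z = b + exp s" by (simp add: es u_def)
  obtain \<epsilon> \<mu> where \<epsilon>: "\<epsilon> > 0" "\<And>y. y \<in> cball z \<epsilon> \<Longrightarrow> y \<noteq> z \<Longrightarrow> f y \<noteq> f z"
    and \<mu>: "\<mu> > 0" "\<And>y. y \<in> sphere z \<epsilon> \<Longrightarrow> \<mu> \<le> dist (f y) (f z)"
    using isolating_sphere[of 1 z] by (metis zero_less_one)
  have "isCont (\<lambda>t. b + exp t) s" by (intro continuous_intros)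
  then obtain d1 where d1: "d1 > 0" "\<And>t. dist t s < d1 \<Longrightarrow> dist (b + exp t) (b + exp s) < \<mu>"
    unfolding continuous_at_eps_delta using \<mu>(1) by blast
  obtain d2 where d2: "d2 > 0" "ball s d2 \<subseteq> H" using H(1) sH open_contains_ball by blast
  define d where "d = min d1 d2"
  have d: "d > 0" using d1 d2 by (simp add: d_def)
  have large: "\<exists>N. \<forall>m\<ge>N. \<exists>k::int. dist (x (r m)) (s + of_int k * (2 * of_real pi * \<i>)) < d \<and>
      \<phi> (s + of_int k * (2 * of_real pi * \<i>)) = z"
  proof -
    have "(\<lambda>m. exp (x (r m) - s)) \<longlonglongrightarrow> u / exp s"
      unfolding exp_diff by (intro tendsto_intros ex) auto
    then have 1: "(\<lambda>m. exp (x (r m) - s)) \<longlonglongrightarrow> 1" using es u0 by simp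
    then have "(\<lambda>m. Ln (exp (x (r m) - s))) \<longlonglongrightarrow> Ln 1"
      by (intro tendsto_Ln) auto
    then obtain N1 where N1: "\<And>m. m \<ge> N1 \<Longrightarrow> norm (Ln (exp (x (r m) - s))) < d"
      using d by (auto simp: lim_sequentially dist_norm)
    obtain N2 where N2: "\<And>m. m \<ge> N2 \<Longrightarrow> dist (\<phi> (x (r m))) z < \<epsilon>"
      using z \<epsilon>(1) unfolding lim_sequentially by blast
    have "\<exists>k::int. dist (x (r m)) (s + of_int k * (2 * of_real pi * \<i>)) < d \<and>
      \<phi> (s + of_int k * (2 * of_real pi * \<i>)) = z" if m: "m \<ge> max N1 N2" for m
    proof -
      define v where "v = Ln (exp (x (r m) - s))"
      have "exp (x (r m)) = exp (s + v)" by (simp add: v_def exp_add exp_diff)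
      then obtain k :: int where k: "x (r m) = s + v + of_int k * (2 * of_real pi * \<i>)"
        unfolding exp_eq_iff_int by blast
      let ?w = "of_int k * (2 * of_real pi * \<i>)"
      have nv: "norm v < d" using N1 m by (simp add: v_def)
      then have dx: "dist (x (r m)) (s + ?w) < d" using k by (simp add: dist_norm)
      have inH: "t + ?w \<in> H" if "t \<in> ball s d" for t
        using d2(2) that by (auto simp: d_def H_def subset_iff)
      have "\<phi> (s + ?w) \<in> ball z \<epsilon>"
      proof (rule trapped[of "ball s d" "\<lambda>t. \<phi> (t + ?w)" "f z" \<mu> z \<epsilon> "s + v" s])
        show "continuous_on (ball s d) (\<lambda>t. \<phi> (t + ?w))"
          by (rule continuous_on_compose2[OF cont_\<phi>[OF order.refl]]) (use inH in \<open>auto intro!: continuous_intros\<close>)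
        show "dist (f (\<phi> (t + ?w))) (f z) < \<mu>" if "t \<in> ball s d" for t
        proof -
          have "dist t s < d1" using that by (simp add: d_def dist_commute)
          then show ?thesis using d1(2)[of t] lift[OF inH[OF that]] fz by simp
        qed
        show "\<phi> (s + v + ?w) \<in> ball z \<epsilon>" using N2[of m] m k by (simp add: dist_commute)
      qed (use \<mu> d nv in \<open>auto simp: dist_norm\<close>)
      moreover have "f (\<phi> (s + ?w)) = f z" using lift[OF inH[of s]] d fz by simp
      ultimately have "\<phi> (s + ?w) = z" using \<epsilon>(2)[of "\<phi> (s + ?w)"] by auto
      then show ?thesis using dx by blast
    qed
    then show ?thesis by blast
  qed
  then obtain N where N: "\<And>m. m \<ge> N \<Longrightarrow> \<exists>k::int. dist (x (r m)) (s + of_int k * (2 * of_real pi * \<i>)) < d \<and>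
      \<phi> (s + of_int k * (2 * of_real pi * \<i>)) = z" by blast
  obtain k where k: "\<phi> (s + of_int k * (2 * of_real pi * \<i>)) = z" using N by blast
  define M where "M = max N (nat \<lceil>norm (s + of_int k * (2 * of_real pi * \<i>)) + d\<rceil>)"
  obtain k' where k': "dist (x (r M)) (s + of_int k' * (2 * of_real pi * \<i>)) < d"
      "\<phi> (s + of_int k' * (2 * of_real pi * \<i>)) = z"
    using N[of M] by (auto simp: M_def)
  have "s + of_int j * (2 * of_real pi * \<i>) \<in> H" for j :: int using sH by (simp add: H_def)
  then have eq: "s + of_int k' * (2 * of_real pi * \<i>) = s + of_int k * (2 * of_real pi * \<i>)"
    using k k'(2) inj_\<phi> unfolding inj_on_def by metis
  have "norm (s + of_int k * (2 * of_real pi * \<i>)) + d \<le> real M"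
    unfolding M_def by linarith
  also have "\<dots> \<le> real (r M)" using seq_suble[OF r, of M] by simp
  also have "\<dots> < norm (x (r M))" using x(3) .
  also have "\<dots> \<le> norm (s + of_int k * (2 * of_real pi * \<i>)) + dist (x (r M)) (s + of_int k' * (2 * of_real pi * \<i>))"
    unfolding eq dist_norm by norm
  finally show False using k'(1) by simp
qed

lemma G_proper: "bounded {\<zeta> \<in> P. Re (G \<zeta>) \<le> K}"
proof (rule bounded_subset[OF \<phi>_proper[of "exp K + norm b"]], safe)
  fix \<zeta> assume \<zeta>: "\<zeta> \<in> P" "Re (G \<zeta>) \<le> K"
  have "norm (\<phi> \<zeta> - b) \<le> exp K" using \<zeta> exp_G[of \<zeta>] P_H by (auto simp flip: exp_G simp: norm_exp_eq_Re)
  then show "norm (\<phi> \<zeta>) \<le> exp K + norm b" using norm_triangle_sub[of "\<phi> \<zeta>" b] by simp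
qed

end

section \<open>Invariant hairs\<close>

text \<open>If the component stayed inside the open ball, the Sura-Bura theorem would give a
  compact, relatively open part of \<open>X\<close> inside the ball, and this would disconnect
  \<open>X\<close>.\<close>

lemma boundary_bumping:
  fixes X :: "complex set"
  assumes X: "closed X" "connected X" "x \<in> X" "\<not> X \<subseteq> ball x r" and r: "r > 0"
  shows "connected_component_set (X \<inter> cball x r) x \<inter> sphere x r \<noteq> {}"
proof
  let ?Z = "X \<inter> cball x r"
  let ?C = "connected_component_set ?Z x"
  assume empty: "?C \<inter> sphere x r = {}"
  have xZ: "x \<in> ?Z" using X(3) r by simp
  have Z: "compact ?Z" using X(1) by (simp add: closed_Int_compact)
  have "?C \<in> components ?Z" using xZ by (auto simp: components_def)
  moreover have "compact ?C" using Z compact_components calculation by blast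
  moreover have "?C \<subseteq> ball x r"
    using empty connected_component_subset[of ?Z x] by (force simp: less_le)
  ultimately obtain K where K: "openin (top_of_set ?Z) K" "compact K" "?C \<subseteq> K" "K \<subseteq> ball x r"
    using Sura_Bura_clopen_subset[OF closed_imp_locally_compact[OF compact_imp_closed[OF Z]] _ _ open_ball] by metis
  obtain T where T: "open T" "K = ?Z \<inter> T" using K(1) openin_open by blast
  have "K = X \<inter> (T \<inter> ball x r)" using T(2) K(4) by auto
  then have "openin (top_of_set X) K" using T(1) by (metis open_Int open_ball openin_open_Int)
  moreover have "closedin (top_of_set X) K"
    using K(2) T(2) compact_imp_closed closed_subset by (metis Int_lower1 le_infI1)
  moreover have "x \<in> K" using K(3) xZ connected_component_refl by fastforce
  ultimately have "K = X" using X(2) unfolding connected_clopen by blast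
  then show False using X(4) K(4) by blast
qed

lemma closed_proper_image:
  fixes g :: "complex \<Rightarrow> complex"
  assumes D: "closed D" and cont: "continuous_on D g" and bd: "\<And>K. bounded {x \<in> D. norm (g x) \<le> K}"
  shows "closed (g ` D)"
proof (rule closed_sequential_limits[THEN iffD2], safe)
  fix x l assume x: "\<forall>k. x k \<in> g ` D" "x \<longlonglongrightarrow> l"
  then have "\<exists>y. \<forall>k. y k \<in> D \<and> x k = g (y k)" by (intro choice) blast
  then obtain y where y: "\<And>k. y k \<in> D" "\<And>k. x k = g (y k)" by blast
  obtain K where K: "\<And>k. norm (x k) \<le> K"
    using convergent_imp_Bseq convergentI[OF x(2)] BseqE by metis
  obtain L where "\<And>z. z \<in> D \<Longrightarrow> norm (g z) \<le> K \<Longrightarrow> norm z \<le> L"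
    using bd[of K] by (auto simp: bounded_iff)
  then have "norm (y k) \<le> L" for k using y K by metis
  then obtain z r where r: "strict_mono (r :: nat \<Rightarrow> nat)" "(\<lambda>k. y (r k)) \<longlonglongrightarrow> z"
    using bounded_subsequence by metis
  have zD: "z \<in> D" using closed_sequentially[OF D _ r(2)] y(1) by blast
  have "(\<lambda>k. g (y (r k))) \<longlonglongrightarrow> g z"
    by (rule continuous_on_tendsto_compose[OF cont r(2) zD]) (simp add: y(1))
  moreover have "(\<lambda>k. x (r k)) \<longlonglongrightarrow> l" using LIMSEQ_subseq_LIMSEQ[OF x(2) r(1)] by (simp add: o_def)
  ultimately have "g z = l" using y(2) LIMSEQ_unique by simp
  then show "l \<in> g ` D" using zD by blast
qed

context tract begin

definition Y :: "real \<Rightarrow> complex set" where "Y M = {\<zeta> \<in> P. M \<le> Im \<zeta> \<or> M \<le> Re \<zeta>}"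
text \<open>Since \<open>exp\<close> forgets the translation, every \<open>S m\<close> represents
  the same inverse branch of \<open>f\<close>; different \<open>m\<close> produce different
  invariant sets for it.\<close>

definition S :: "nat \<Rightarrow> complex \<Rightarrow> complex" where "S m \<zeta> = G \<zeta> + of_nat m * (2 * of_real pi * \<i>)"

lemma exp_S: "exp (S m \<zeta>) = exp (G \<zeta>)"
  unfolding S_def using exp_add_int[of "G \<zeta>" "int m"] by simp

lemma \<phi>_S: "\<zeta> \<in> H \<Longrightarrow> \<phi> \<zeta> = b + exp (S m \<zeta>)"
  using exp_G by (simp add: exp_S)

lemma S_lipschitz: "\<zeta> \<in> P \<Longrightarrow> \<zeta>' \<in> P \<Longrightarrow> dist (S m \<zeta>) (S m \<zeta>') \<le> 1/2 * dist \<zeta> \<zeta>'"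
  using G_lipschitz[of \<zeta> \<zeta>'] by (simp add: S_def dist_norm)

lemma cont_S: "A \<subseteq> H \<Longrightarrow> continuous_on A (S m)"
  unfolding S_def by (intro continuous_intros cont_G)

lemma S_proper: "bounded {\<zeta> \<in> P. norm (S m \<zeta>) \<le> K}"
proof (rule bounded_subset[OF G_proper[of K]], safe)
  fix \<zeta> assume "norm (S m \<zeta>) \<le> K"
  then show "Re (G \<zeta>) \<le> K" using complex_Re_le_cmod[of "S m \<zeta>"] by (simp add: S_def)
qed

lemma Y_properties:
  assumes "\<rho> \<le> M"
  shows "closed (Y M)" "connected (Y M)" "Y M \<subseteq> P" "of_real M \<in> Y M" "\<not> bounded (Y M)"
proof -
  have Y: "Y M = (P \<inter> {\<zeta>. M \<le> Im \<zeta>}) \<union> {\<zeta>. M \<le> Re \<zeta>}"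
    using assms by (auto simp: Y_def P_def)
  then show "closed (Y M)"
    by (simp add: closed_Un closed_Int closed_P closed_halfspace_Im_ge closed_halfspace_Re_ge)
  have "Complex M M \<in> (P \<inter> {\<zeta>. M \<le> Im \<zeta>}) \<inter> {\<zeta>. M \<le> Re \<zeta>}" using assms by (simp add: P_def)
  then show "connected (Y M)"
    unfolding Y
    by (intro connected_Un convex_connected convex_Int convex_P convex_halfspace_Im_ge convex_halfspace_Re_ge) blast
  show "Y M \<subseteq> P" "of_real M \<in> Y M" using assms by (auto simp: Y_def P_def)
  show "\<not> bounded (Y M)"
  proof
    assume "bounded (Y M)"
    then obtain B where B: "\<And>z. z \<in> Y M \<Longrightarrow> norm z \<le> B" by (auto simp: bounded_iff)
    have "of_real (max M (B + 1)) \<in> Y M" using assms by (auto simp: Y_def P_def)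
    from B[OF this] show False unfolding norm_of_real by linarith
  qed
qed

text \<open>Properness of \<open>G\<close> is used twice: far points have
  \<open>Re (G \<zeta>) > \<rho>\<close>, so their images stay in \<open>P\<close>; and points with
  \<open>Re (G \<zeta>) \<le> M\<close> form a bounded set, so a large translation lifts the
  imaginary parts of their images above \<open>M\<close>.\<close>

lemma hair_domain:
  obtains M m0 where "\<rho> \<le> M" "\<And>m. m \<ge> m0 \<Longrightarrow> S m ` Y M \<subseteq> Y M"
proof -
  obtain M1 where M1: "\<And>\<zeta>. \<zeta> \<in> P \<Longrightarrow> Re (G \<zeta>) \<le> \<rho> \<Longrightarrow> norm \<zeta> \<le> M1"
    using G_proper[of \<rho>] by (auto simp: bounded_iff)
  define M where "M = max (M1 + 1) \<rho>"
  obtain L where L: "\<And>\<zeta>. \<zeta> \<in> P \<Longrightarrow> Re (G \<zeta>) \<le> M \<Longrightarrow> norm \<zeta> \<le> L"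
    using G_proper[of M] by (auto simp: bounded_iff)
  have \<rho>P: "of_real \<rho> \<in> P" by (simp add: P_def)
  define M2 where "M2 = norm (G (of_real \<rho>)) + (L + \<bar>\<rho>\<bar>)"
  have M2: "norm (G \<zeta>) \<le> M2" if "\<zeta> \<in> P" "Re (G \<zeta>) \<le> M" for \<zeta>
  proof -
    have "norm (G \<zeta>) \<le> norm (G (of_real \<rho>)) + norm (G \<zeta> - G (of_real \<rho>))"
      by (rule norm_triangle_sub)
    moreover have "norm (G \<zeta> - G (of_real \<rho>)) \<le> 1/2 * norm (\<zeta> - of_real \<rho>)"
      by (rule G_lipschitz[OF that(1) \<rho>P])
    moreover have "norm (\<zeta> - of_real \<rho>) \<le> L + \<bar>\<rho>\<bar>"
      using norm_triangle_ineq4[of \<zeta> "of_real \<rho>"] L[OF that] by simp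
    ultimately show ?thesis unfolding M2_def using norm_ge_zero[of "\<zeta> - of_real \<rho>"] by linarith
  qed
  show ?thesis
  proof (rule that[of M "nat \<lceil>M + M2\<rceil>"])
    show "\<rho> \<le> M" by (simp add: M_def)
    fix m :: nat assume "nat \<lceil>M + M2\<rceil> \<le> m"
    then have m: "M + M2 \<le> real m" by linarith
    show "S m ` Y M \<subseteq> Y M"
    proof safe
      fix \<zeta> assume \<zeta>: "\<zeta> \<in> Y M"
      then have \<zeta>P: "\<zeta> \<in> P" by (simp add: Y_def)
      have "M \<le> norm \<zeta>"
        using \<zeta> complex_Re_le_cmod[of \<zeta>] abs_Im_le_cmod[of \<zeta>] by (auto simp: Y_def)
      then have 1: "\<rho> < Re (G \<zeta>)" using M1[OF \<zeta>P] by (force simp: M_def)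
      have Re: "Re (S m \<zeta>) = Re (G \<zeta>)" and Im: "Im (S m \<zeta>) = Im (G \<zeta>) + 2 * pi * real m"
        by (simp_all add: S_def)
      have "M \<le> Im (S m \<zeta>)" if "Re (G \<zeta>) \<le> M"
      proof -
        have "- Im (G \<zeta>) \<le> M2" using M2[OF \<zeta>P that] abs_Im_le_cmod[of "G \<zeta>"] by linarith
        moreover have "1 * real m \<le> 2 * pi * real m" using pi_ge_two by (intro mult_right_mono) linarith+
        ultimately show ?thesis using m Im by linarith
      qed
      then show "S m \<zeta> \<in> Y M" using 1 Re by (force simp: Y_def P_def)
    qed
  qed
qed

lemma closed_S_image:
  assumes "closed A" "A \<subseteq> P"
  shows "closed (S m ` A)"
proof (rule closed_proper_image[OF assms(1)])
  show "continuous_on A (S m)" using cont_S assms(2) P_H by blast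
  show "bounded {\<zeta> \<in> A. norm (S m \<zeta>) \<le> K}" for K
    by (rule bounded_subset[OF S_proper[of m K]]) (use assms(2) in blast)
qed

lemma unbounded_S_image:
  assumes "\<not> bounded A" "A \<subseteq> P"
  shows "\<not> bounded (S m ` A)"
proof
  assume "bounded (S m ` A)"
  then obtain K where "\<And>\<zeta>. \<zeta> \<in> A \<Longrightarrow> norm (S m \<zeta>) \<le> K" by (auto simp: bounded_iff)
  then have "bounded A" using assms(2) by (intro bounded_subset[OF S_proper[of m K]]) blast
  then show False using assms(1) by simp
qed

text \<open>The points whose backward orbits under the contraction \<open>S m\<close> stay in \<open>Y M\<close> form a closed
  set; the component of the fixed point in it reaches infinity, since each \<open>(S m ^^ k) ` Y M\<close> is connected
  and unbounded.\<close>

lemma hair: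
  assumes M: "\<rho> \<le> M" "S m ` Y M \<subseteq> Y M"
  obtains C where "closed C" "connected C" "\<not> bounded C" "C \<subseteq> P" "\<And>\<zeta>. \<zeta> \<in> C \<Longrightarrow> \<exists>\<zeta>'\<in>C. \<zeta> = S m \<zeta>'"
proof -
  note YM = Y_properties[OF M(1)]
  obtain p where p: "p \<in> Y M" "S m p = p"
  proof -
    have "\<exists>!x\<in>Y M. S m x = x"
    proof (rule Banach_fix[of _ "1/2"])
      show "dist (S m x) (S m y) \<le> 1/2 * dist x y" if "x \<in> Y M" "y \<in> Y M" for x y
        using that YM(3) by (intro S_lipschitz) auto
    qed (use YM M(2) in \<open>auto simp: complete_eq_closed\<close>)
    then show ?thesis using that by blast
  qed
  define X where "X = (\<lambda>k. (S m ^^ k) ` Y M)"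
  have X0: "X 0 = Y M" and XSuc: "X (Suc k) = S m ` X k" for k by (auto simp: X_def image_image)
  have XY: "X k \<subseteq> Y M" for k
    by (induction k) (use M(2) in \<open>auto simp: X0 XSuc\<close>)
  have XSuc_sub: "X (Suc k) \<subseteq> X k" for k
    by (induction k) (use M(2) in \<open>auto simp: X0 XSuc\<close>)
  have Xdec: "X l \<subseteq> X k" if "k \<le> l" for k l
    using lift_Suc_antimono_le[of X, OF XSuc_sub that] .
  have XP: "X k \<subseteq> P" for k using XY YM(3) by blast
  have X: "closed (X k) \<and> connected (X k) \<and> p \<in> X k \<and> \<not> bounded (X k)" for k
  proof (induction k)
    case 0
    then show ?case using YM p by (simp add: X0)
  next
    case (Suc k)
    then show ?case
      using closed_S_image[OF _ XP] unbounded_S_image[OF _ XP] p(2)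
        connected_continuous_image[OF cont_S[OF order.trans[OF XP P_H]]]
      by (auto simp: XSuc intro!: image_eqI[of p _ p])
  qed
  define Q where "Q = (\<Inter>k. X k)"
  define C where "C = connected_component_set Q p"
  have pQ: "p \<in> Q" using X by (auto simp: Q_def)
  have "closed Q" unfolding Q_def using X by (intro closed_INT) blast
  then have "closed C" unfolding C_def by (rule closed_connected_component)
  moreover have "connected C" by (simp add: C_def)
  moreover have CQ: "C \<subseteq> Q" by (simp add: C_def connected_component_subset)
  moreover have "\<exists>z\<in>C. dist p z = K" if K: "K > 0" for K
  proof -
    define D where "D = (\<lambda>k. connected_component_set (X k \<inter> cball p K) p)"
    have comp: "compact (X k \<inter> cball p K)" for k using X by (simp add: closed_Int_compact)
    have "p \<in> X k \<inter> cball p K" for k using X K by simp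
    then have "D k \<in> components (X k \<inter> cball p K)" "p \<in> D k" for k
      unfolding D_def by (auto simp: components_def intro: connected_component_refl)
    then have D: "compact (D k)" "connected (D k)" "p \<in> D k" "D k \<subseteq> X k \<inter> cball p K" for k
      using compact_components[OF comp] in_components_connected in_components_subset by blast+
    have Ddec: "D l \<subseteq> D k" if "k \<le> l" for k l
      unfolding D_def using Xdec[OF that] by (intro connected_component_mono) auto
    have "\<not> X k \<subseteq> ball p K" for k using X bounded_subset bounded_ball by metis
    then have "D k \<inter> sphere p K \<noteq> {}" for k
      unfolding D_def using X K by (intro boundary_bumping) auto
    note ne = this
    have "(\<Inter>k. D k \<inter> sphere p K) \<noteq> {}"
    proof (rule compact_nest)
      show "D l \<inter> sphere p K \<subseteq> D k \<inter> sphere p K" if "k \<le> l" for k l using Ddec[OF that] by blast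
    qed (use D(1) ne in \<open>auto simp: compact_Int\<close>)
    then obtain z where "\<forall>k. z \<in> D k \<inter> sphere p K" by blast
    then have z: "\<And>k. z \<in> D k" "dist p z = K" by auto
    have "connected (\<Inter>(range D))" by (rule connected_nest[OF D(1,2) Ddec])
    moreover have "\<Inter>(range D) \<subseteq> Q" using D(4) by (auto simp: Q_def)
    ultimately have "\<Inter>(range D) \<subseteq> C"
      unfolding C_def using D(3) by (intro connected_component_maximal) auto
    then show ?thesis using z by blast
  qed
  then have "\<not> bounded C"
  proof -
    assume reach: "\<And>K. 0 < K \<Longrightarrow> \<exists>z\<in>C. dist p z = K"
    show ?thesis
    proof
      assume "bounded C"
      then obtain B where B: "\<And>z. z \<in> C \<Longrightarrow> dist p z \<le> B" unfolding bounded_any_center[where a=p] by blast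
      obtain z where "z \<in> C" "dist p z = \<bar>B\<bar> + 1" using reach[of "\<bar>B\<bar> + 1"] by force
      then show False using B[of z] by simp
    qed
  qed
  \<comment> \<open>On the hair \<open>f\<close> acts as the inverse of \<open>S m\<close>, so this
    clause will become forward invariance. The inverse \<open>h\<close> maps \<open>Q\<close> into
    itself because \<open>X (Suc k)\<close> is the injective image of \<open>X k\<close>, and it
    fixes \<open>p\<close>, hence preserves the component of \<open>p\<close>.\<close>
  moreover have "\<exists>\<zeta>'\<in>C. \<zeta> = S m \<zeta>'" if \<zeta>: "\<zeta> \<in> C" for \<zeta>
  proof -
    have "inj_on (S m) H"
    proof (rule inj_onI)
      fix x y assume "x \<in> H" "y \<in> H" "S m x = S m y"
      then show "x = y" using exp_G_inj[of x y] exp_S by metis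
    qed
    moreover have "S m holomorphic_on H"
      unfolding S_def by (intro holomorphic_intros hol_G)
    ultimately obtain h where h: "h holomorphic_on S m ` H" "\<And>z. z \<in> H \<Longrightarrow> h (S m z) = z"
      using holomorphic_has_inverse[OF _ H(1)] by metis
    have hQ: "h z \<in> Q \<and> S m (h z) = z" if "z \<in> Q" for z
    proof -
      have "z \<in> S m ` X k" for k using that XSuc[of k] unfolding Q_def by blast
      then have ex: "\<exists>y\<in>X k. z = S m y" for k by blast
      have hz: "h z = y \<and> S m (h z) = z" if "y \<in> X k" "z = S m y" for y k
        using h(2)[of y] that XP[of k] P_H by auto
      have "h z \<in> X k \<and> S m (h z) = z" for k
        using ex[of k] hz[of _ k] by metis
      then show ?thesis unfolding Q_def by blast
    qed
    have "Q \<subseteq> P" using XP[of 0] by (auto simp: Q_def)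
    then have QH: "Q \<subseteq> S m ` H" using hQ P_H by (metis image_eqI subset_eq)
    have "connected (h ` C)"
      by (intro connected_continuous_image holomorphic_on_imp_continuous_on holomorphic_on_subset[OF h(1)])
        (use QH CQ in \<open>auto simp: C_def\<close>)
    moreover have "h p = p" using h(2)[of p] p YM(3) P_H by auto
    then have "p \<in> h ` C" using pQ unfolding C_def by (metis connected_component_refl image_eqI mem_Collect_eq)
    moreover have "h ` C \<subseteq> Q" using hQ CQ by blast
    ultimately have "h ` C \<subseteq> C"
      using connected_component_maximal[of p "h ` C" Q] by (simp add: C_def)
    then show ?thesis using hQ[of \<zeta>] \<zeta> CQ by (metis image_subset_iff subsetD)
  qed
  moreover have "C \<subseteq> P" using CQ XP unfolding Q_def by blast
  ultimately show ?thesis using that by blast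
qed

text \<open>Two consecutive translates give the two hairs. By injectivity of \<open>\<phi>\<close> a
  common point comes from a point of both \<open>C 0\<close> and \<open>C 1\<close>; its preimages
  under the two translates coincide, which is impossible for different translations.\<close>

lemma hairs:
  obtains A1 A2 where "A1 \<inter> A2 = {}"
    "\<And>A. A \<in> {A1, A2} \<Longrightarrow> closed A \<and> connected A \<and> \<not> bounded A \<and> f ` A \<subseteq> A \<and> (\<forall>z\<in>A. R \<le> dist z b)"
proof -
  obtain M m0 where M: "\<rho> \<le> M" "\<And>m. m \<ge> m0 \<Longrightarrow> S m ` Y M \<subseteq> Y M" using hair_domain by metis
  have "\<exists>C. closed C \<and> connected C \<and> \<not> bounded C \<and> C \<subseteq> P \<and> (\<forall>\<zeta>\<in>C. \<exists>\<zeta>'\<in>C. \<zeta> = S (m0 + i) \<zeta>')" for i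
    using hair[OF M(1) M(2)[of "m0 + i"]] by (metis le_add1)
  then have "\<exists>C. \<forall>i. closed (C i) \<and> connected (C i) \<and> \<not> bounded (C i) \<and> C i \<subseteq> P \<and>
      (\<forall>\<zeta>\<in>C i. \<exists>\<zeta>'\<in>C i. \<zeta> = S (m0 + i) \<zeta>')"
    by (intro choice allI)
  then obtain C where C: "\<And>i. closed (C i)" "\<And>i. connected (C i)" "\<And>i. \<not> bounded (C i)" "\<And>i. C i \<subseteq> P"
    and preim: "\<And>i \<zeta>. \<zeta> \<in> C i \<Longrightarrow> \<exists>\<zeta>'\<in>C i. \<zeta> = S (m0 + i) \<zeta>'" by blast
  define A where "A = (\<lambda>i. (\<lambda>\<zeta>. b + exp \<zeta>) ` C i)"
  have CH: "\<zeta> \<in> C i \<Longrightarrow> \<zeta> \<in> H" for \<zeta> i using C(4) P_H by blast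
  have hairs: "closed (A i) \<and> connected (A i) \<and> \<not> bounded (A i) \<and> f ` A i \<subseteq> A i \<and> (\<forall>z\<in>A i. R \<le> dist z b)" for i
  proof (intro conjI)
    show "connected (A i)"
      unfolding A_def by (intro connected_continuous_image C continuous_intros)
    show "\<forall>z\<in>A i. R \<le> dist z b"
      using norm_exp_H CH by (auto simp: A_def dist_norm less_imp_le)
    show "f ` A i \<subseteq> A i"
    proof safe
      fix z assume "z \<in> A i"
      then obtain \<zeta> where "\<zeta> \<in> C i" "z = b + exp \<zeta>" by (auto simp: A_def)
      moreover from this obtain \<zeta>' where "\<zeta>' \<in> C i" "\<zeta> = S (m0 + i) \<zeta>'" using preim by blast
      ultimately have "f z = b + exp \<zeta>'" using \<phi>_S[OF CH] lift[OF CH] by metis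
      then show "f z \<in> A i" using \<open>\<zeta>' \<in> C i\<close> by (auto simp: A_def)
    qed
    show "\<not> bounded (A i)"
    proof
      assume "bounded (A i)"
      then obtain K where K: "\<And>z. z \<in> A i \<Longrightarrow> norm z \<le> K" by (auto simp: bounded_iff)
      obtain L where L: "\<And>\<zeta>. \<zeta> \<in> P \<Longrightarrow> norm (\<phi> \<zeta>) \<le> K \<Longrightarrow> norm \<zeta> \<le> L"
        using \<phi>_proper[of K] by (auto simp: bounded_iff)
      \<comment> \<open>\<open>exp\<close> may map unbounded sets to bounded ones. But each point of
        \<open>C i\<close> is the image under \<open>S (m0 + i)\<close> of a point where
        \<open>\<phi>\<close> has its value in \<open>A i\<close>, and \<open>\<phi>\<close> is
        proper on \<open>P\<close>. Closedness of \<open>A i\<close> is obtained through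
        \<open>\<phi>\<close> for the same reason.\<close>
      have "C i \<subseteq> S (m0 + i) ` (P \<inter> cball 0 L)"
      proof
        fix \<zeta> assume \<zeta>: "\<zeta> \<in> C i"
        then obtain \<zeta>' where \<zeta>': "\<zeta>' \<in> C i" "\<zeta> = S (m0 + i) \<zeta>'" using preim by blast
        have "\<phi> \<zeta>' \<in> A i" using \<phi>_S[OF CH[OF \<zeta>'(1)]] \<zeta> \<zeta>'(2) unfolding A_def by auto
        then have "\<zeta>' \<in> P \<inter> cball 0 L" using K L[of \<zeta>'] C(4) \<zeta>'(1) by auto
        then show "\<zeta> \<in> S (m0 + i) ` (P \<inter> cball 0 L)" using \<zeta>'(2) by blast
      qed
      moreover have "compact (S (m0 + i) ` (P \<inter> cball 0 L))"
        using P_H by (intro compact_continuous_image cont_S) (auto intro: closed_Int_compact closed_P)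
      ultimately show False using C(3) compact_imp_bounded bounded_subset by metis
    qed
    show "closed (A i)"
    proof -
      define D where "D = C i \<inter> S (m0 + i) -` C i"
      have DP: "D \<subseteq> P" "D \<subseteq> H" using C(4) P_H by (auto simp: D_def)
      have "closed D"
        unfolding D_def using C(1,4) P_H by (intro continuous_closed_preimage cont_S) auto
      moreover have "bounded {\<zeta> \<in> D. norm (\<phi> \<zeta>) \<le> K}" for K
        by (rule bounded_subset[OF \<phi>_proper[of K]]) (use DP in blast)
      ultimately have "closed (\<phi> ` D)" by (intro closed_proper_image cont_\<phi> DP)
      moreover have "\<phi> ` D = A i"
      proof
        show "\<phi> ` D \<subseteq> A i"
        proof safe
          fix x assume x: "x \<in> D"
          then have "\<phi> x = b + exp (S (m0 + i) x)" using DP(2) by (intro \<phi>_S) blast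
          then show "\<phi> x \<in> A i" using x by (auto simp: D_def A_def)
        qed
        show "A i \<subseteq> \<phi> ` D"
        proof
          fix z assume "z \<in> A i"
          then obtain \<zeta> where \<zeta>: "\<zeta> \<in> C i" "z = b + exp \<zeta>" by (auto simp: A_def)
          obtain \<zeta>' where "\<zeta>' \<in> C i" "\<zeta> = S (m0 + i) \<zeta>'" using preim[OF \<zeta>(1)] by blast
          then show "z \<in> \<phi> ` D"
            using \<zeta> \<phi>_S[OF CH, of \<zeta>' i "m0 + i"] by (intro image_eqI[of _ _ \<zeta>']) (auto simp: D_def)
        qed
      qed
      ultimately show ?thesis by simp
    qed
  qed
  have same: "i = j" if "\<zeta> \<in> C i" "\<zeta> \<in> C j" for i j \<zeta>
  proof -
    obtain x y where x: "x \<in> C i" "\<zeta> = S (m0 + i) x" and y: "y \<in> C j" "\<zeta> = S (m0 + j) y"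
      using preim[OF \<open>\<zeta> \<in> C i\<close>] preim[OF \<open>\<zeta> \<in> C j\<close>] by blast
    have "x = y" using exp_G_inj[OF CH[OF x(1)] CH[OF y(1)]] x(2) y(2) exp_S by metis
    then have "of_nat (m0 + i) * (2 * of_real pi * \<i>) = (of_nat (m0 + j) * (2 * of_real pi * \<i>) :: complex)"
      using x(2) y(2) by (simp add: S_def)
    then show ?thesis by (simp del: of_nat_add)
  qed
  have "A 0 \<inter> A 1 = {}"
  proof (rule ccontr)
    assume "A 0 \<inter> A 1 \<noteq> {}"
    then obtain z where "z \<in> A 0" "z \<in> A 1" by blast
    then obtain u v where u: "u \<in> C 0" "z = b + exp u" and v: "v \<in> C 1" "z = b + exp v"
      by (auto simp: A_def)
    obtain x y where x: "x \<in> C 0" "u = S (m0 + 0) x" and y: "y \<in> C 1" "v = S (m0 + 1) y"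
      using preim[OF u(1)] preim[OF v(1)] by blast
    have "\<phi> x = z" "\<phi> y = z" using \<phi>_S CH x y u v by metis+
    then have "x = y" using inj_\<phi> CH[OF x(1)] CH[OF y(1)] by (simp add: inj_on_def)
    then show False using same[OF x(1)] y(1) by fastforce
  qed
  then show ?thesis using hairs that[of "A 0" "A 1"] by blast
qed

end

section \<open>Barriers between the Siegel disks\<close>

lemma rotation_dense:
  assumes "\<theta> \<notin> \<rat>" "norm u = 1" "\<epsilon> > 0"
  obtains k where "dist (cis (2 * pi * \<theta>) ^ k) u < \<epsilon>"
proof -
  have u: "u = cis (Arg u)" using assms(2) cis_Arg[of u] by (cases "u = 0") (auto simp: sgn_eq)
  define x where "x = Arg u / (2 * pi)"
  have frac: "cis (2 * pi * frac t) = cis (2 * pi * t)" for t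
    using cis_multiple_2pi[of "of_int \<lfloor>t\<rfloor>"] by (simp add: frac_def right_diff_distrib flip: cis_divide)
  have ux: "u = cis (2 * pi * frac x)" unfolding frac using u by (simp add: x_def)
  have "isCont (\<lambda>t. cis (2 * pi * t)) (frac x)"
    unfolding cis_conv_exp by (intro continuous_intros)
  then obtain d where d: "d > 0" "\<And>t. dist t (frac x) < d \<Longrightarrow> dist (cis (2 * pi * t)) u < \<epsilon>"
    unfolding continuous_at_eps_delta ux using assms(3) by blast
  obtain k where "\<bar>frac (real k * \<theta>) - frac x\<bar> < d"
    using Kronecker_approx_1_explicit[OF assms(1), of "frac x" d] d(1) by (auto simp: less_imp_le frac_lt_1)
  then have "dist (cis (2 * pi * frac (real k * \<theta>))) u < \<epsilon>" using d(2) by (simp add: dist_real_def)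
  moreover have "cis (2 * pi * \<theta>) ^ k = cis (2 * pi * (real k * \<theta>))" by (simp add: Complex.DeMoivre mult_ac)
  ultimately show ?thesis using that[of k] by (simp only: frac)
qed

text \<open>The complement of \<open>\<Omega>\<close> is connected and contains the unbounded set
  \<open>E\<close>, so it has no bounded component.\<close>

lemma simply_connected_component_Compl:
  fixes E :: "complex set"
  assumes "closed E" "connected E" "\<not> bounded E" "\<Omega> \<in> components (- E)"
  shows "simply_connected \<Omega>"
proof -
  have "open \<Omega>" using assms(1,4) open_components by blast
  moreover have "connected \<Omega>" using assms(4) in_components_connected by blast
  moreover have con: "connected (- \<Omega>)"
    by (rule component_complement_connected[OF assms(2,4)])
  moreover have "\<forall>C\<in>components (- \<Omega>). \<not> bounded C"
  proof (cases "\<Omega> = UNIV")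
    case False
    have "E \<subseteq> - \<Omega>" using assms(4) in_components_subset by blast
    then have "\<not> bounded (- \<Omega>)" using assms(3) bounded_subset by blast
    then show ?thesis using con False
      by (metis Compl_empty_eq components_eq_sing_iff double_complement singletonD)
  qed auto
  ultimately show ?thesis using simply_connected_eq_unbounded_complement_components by blast
qed

context tame_entire begin

text \<open>A bounded component would lie in a compact, relatively open part of the preimage. The
  image of this part under the open map \<open>f ^^ k\<close> is compact and open in
  \<open>A\<close>, hence all of \<open>A\<close>, which is unbounded.\<close>

lemma preimage_component_unbounded:
  assumes A: "closed A" "connected A" "\<not> bounded A" and x: "(f ^^ k) x \<in> A"
    and nc: "\<not> (f ^^ k) constant_on UNIV"
  shows "\<not> bounded (connected_component_set ((f ^^ k) -` A) x)"
proof
  let ?Z = "(f ^^ k) -` A"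
  let ?C = "connected_component_set ?Z x"
  assume bd: "bounded ?C"
  have Z: "closed ?Z" by (rule closed_vimage[OF A(1) cont_iter])
  have C: "?C \<in> components ?Z" "x \<in> ?C" using x by (auto simp: components_def)
  have comp: "compact ?C" using bd closed_connected_component[OF Z] compact_eq_bounded_closed by blast
  obtain K where K: "openin (top_of_set ?Z) K" "compact K" "?C \<subseteq> K"
    by (rule Sura_Bura_clopen_subset[OF closed_imp_locally_compact[OF Z] C(1) comp open_UNIV subset_UNIV])
  obtain T where T: "open T" "K = ?Z \<inter> T" using K(1) unfolding openin_open by blast
  have "open ((f ^^ k) ` T)"
    by (rule open_mapping_thm[OF hol_iter open_UNIV connected_UNIV T(1) subset_UNIV nc])
  moreover have "(f ^^ k) ` K = A \<inter> (f ^^ k) ` T" using T(2) by blast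
  ultimately have "openin (top_of_set A) ((f ^^ k) ` K)" by (metis openin_open)
  moreover have comp: "compact ((f ^^ k) ` K)"
    by (rule compact_continuous_image[OF cont_iter K(2)])
  then have "closedin (top_of_set A) ((f ^^ k) ` K)"
    using T(2) by (intro closed_subset compact_imp_closed) auto
  moreover have "(f ^^ k) ` K \<noteq> {}" using K(3) C(2) by blast
  ultimately have "(f ^^ k) ` K = A" using A(2) unfolding connected_clopen by blast
  then show False using comp A(3) compact_imp_bounded by auto
qed

end

text \<open>\<open>R_\<psi>\<close> keeps the centres of the disks off the hairs and outside the
  region where the contraction is used. For the nonconstant entire \<open>f\<close>,
  \<open>transcendental\<close> says exactly that \<open>f\<close> is not a polynomial.\<close>

locale siegel_two = siegel_cycle f U n \<phi> \<theta> + two_singular f a b R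
  for f :: "complex \<Rightarrow> complex" and U n \<phi> \<theta> a b R +
  assumes R_\<psi>: "\<And>j. dist (\<psi> j 0) b < R" and b_julia: "b \<notin> fatou_set f"
    and b_boundary: "\<And>j. b \<notin> closure (\<psi> j ` ball 0 1)"
    and transcendental: "\<not> filterlim f at_infinity at_infinity"
begin

lemma iter_nonconst: "\<not> (f ^^ k) constant_on UNIV"
proof
  assume "(f ^^ k) constant_on UNIV"
  then have "\<psi> k 0 = \<psi> k (1/2)" using \<psi>_add[of k 0] by (auto simp: constant_on_def)
  then show False using inj_onD[OF inj_\<psi>[of k], of 0 "1/2"] by auto
qed

lemma tract_exists:
  assumes "\<zeta>0 \<in> H" "f x = b + exp \<zeta>0"
  obtains \<Phi> G where "tract f a b R \<Phi> G" "\<Phi> \<zeta>0 = x"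
proof -
  obtain \<Phi> where \<Phi>: "\<Phi> holomorphic_on H" "\<Phi> \<zeta>0 = x" "\<And>\<zeta>. \<zeta> \<in> H \<Longrightarrow> f (\<Phi> \<zeta>) = b + exp \<zeta>"
    using tract_map[OF assms] by blast
  have "\<Phi> \<zeta> \<noteq> b" if "\<zeta> \<in> H" for \<zeta>
    using norm_exp_H[OF that] \<Phi>(3)[OF that] R(2) by (auto simp: dist_norm)
  then have nz: "\<And>\<zeta>. \<zeta> \<in> H \<Longrightarrow> \<Phi> \<zeta> - b \<noteq> 0" by simp
  have hol: "(\<lambda>\<zeta>. \<Phi> \<zeta> - b) holomorphic_on H" by (intro holomorphic_intros \<Phi>(1))
  have "\<exists>G. G holomorphic_on H \<and> (\<forall>\<zeta>\<in>H. exp (G \<zeta>) = \<Phi> \<zeta> - b)"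
    by (rule holomorphic_logarithm_exists[OF H(2,1) hol nz assms(1)]) auto
  then obtain G where "G holomorphic_on H" "\<And>\<zeta>. \<zeta> \<in> H \<Longrightarrow> exp (G \<zeta>) = \<Phi> \<zeta> - b" by auto
  moreover have "inj_on \<Phi> H" using noninjective_tract[OF \<Phi>(1,3)] transcendental by blast
  ultimately have "tract f a b R \<Phi> G" using \<Phi> by unfold_locales auto
  then show ?thesis using that \<Phi>(2) by blast
qed

lemma hairs_exist:
  "\<exists>A1 A2. A1 \<inter> A2 = {} \<and>
    (\<forall>A\<in>{A1, A2}. closed A \<and> connected A \<and> \<not> bounded A \<and> f ` A \<subseteq> A \<and> (\<forall>z\<in>A. R \<le> dist z b))"
proof -
  have \<zeta>: "of_real (ln R + 1) \<in> H" by (simp add: H_def)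
  then have "b + exp (of_real (ln R + 1)) \<in> f ` {z. f z \<notin> critical_values f}"
    unfolding surj_off_critical using H_image by blast
  then obtain x where "f x = b + exp (of_real (ln R + 1))" by auto
  then obtain \<Phi> G where "tract f a b R \<Phi> G" using tract_exists[OF \<zeta>] by metis
  then interpret tract f a b R \<Phi> G .
  show ?thesis
  proof (rule hairs)
    fix A1 A2
    assume h: "A1 \<inter> A2 = {}" "\<And>A. A \<in> {A1, A2} \<Longrightarrow>
      closed A \<and> connected A \<and> \<not> bounded A \<and> f ` A \<subseteq> A \<and> (\<forall>z\<in>A. R \<le> dist z b)"
    show ?thesis
      using h(1) h(2)[of A1] h(2)[of A2] by (intro exI[of _ A1] exI[of _ A2]) simp
  qed
qed

text \<open>If the orbit of a rotation circle stayed away from \<open>b\<close>, so would the whole circle, and the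
  minimum principle would push the centre of the disk away as well.\<close>

lemma \<psi>_near_b:
  assumes "norm \<zeta> < 1"
  obtains k where "dist (\<psi> 0 (rot ^ k * \<zeta>)) b < R"
proof (rule ccontr)
  assume "\<not> thesis"
  then have far: "R \<le> dist (\<psi> 0 (rot ^ k * \<zeta>)) b" for k using that by (meson not_less)
  have circle: "R \<le> dist (\<psi> 0 (u * \<zeta>)) b" if u: "norm u = 1" for u
  proof (rule ccontr)
    assume "\<not> ?thesis"
    then have pos: "R - dist (\<psi> 0 (u * \<zeta>)) b > 0" by simp
    have "continuous_on (sphere 0 1) (\<lambda>u. \<psi> 0 (u * \<zeta>))"
      by (rule continuous_on_compose2[OF cont_\<psi>[OF order.refl]])
        (use assms in \<open>auto intro!: continuous_intros simp: norm_mult\<close>)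
    then obtain d where d: "d > 0"
      "\<And>v. norm v = 1 \<Longrightarrow> dist v u < d \<Longrightarrow> dist (\<psi> 0 (v * \<zeta>)) (\<psi> 0 (u * \<zeta>)) < R - dist (\<psi> 0 (u * \<zeta>)) b"
      unfolding continuous_on_iff using pos u by (metis mem_sphere_0)
    obtain k where "dist (rot ^ k) u < d" using rotation_dense[OF \<theta> u d(1)] by (auto simp: rot_def)
    then have "dist (\<psi> 0 (rot ^ k * \<zeta>)) (\<psi> 0 (u * \<zeta>)) < R - dist (\<psi> 0 (u * \<zeta>)) b" using d(2) by simp
    then show False using far[of k] dist_triangle[of "\<psi> 0 (rot ^ k * \<zeta>)" b "\<psi> 0 (u * \<zeta>)"] by simp
  qed
  have sphere: "R \<le> norm (\<psi> 0 z - b)" if "norm z = norm \<zeta>" for z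
  proof (cases "\<zeta> = 0")
    case True
    then show ?thesis using circle[of 1] that by (simp add: dist_norm)
  next
    case False
    then have "z = z / \<zeta> * \<zeta>" "norm (z / \<zeta>) = 1" using that by (simp_all add: norm_divide)
    then show ?thesis using circle[of "z / \<zeta>"] by (simp add: dist_norm)
  qed
  have b: "\<psi> 0 z - b \<noteq> 0" if "norm z < 1" for z
    using \<psi>_fatou[OF that, of 0] b_julia by auto
  have hol: "(\<lambda>z. 1 / (\<psi> 0 z - b)) holomorphic_on ball 0 1"
    using b by (intro holomorphic_intros hol_\<psi>) auto
  have "norm (1 / (\<psi> 0 0 - b)) \<le> 1 / R"
  proof (rule maximum_modulus_frontier[of "\<lambda>z. 1 / (\<psi> 0 z - b)" "cball 0 (norm \<zeta>)" "1 / R" 0])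
    show "(\<lambda>z. 1 / (\<psi> 0 z - b)) holomorphic_on interior (cball 0 (norm \<zeta>))"
      by (rule holomorphic_on_subset[OF hol]) (use assms in auto)
    show "continuous_on (closure (cball 0 (norm \<zeta>))) (\<lambda>z. 1 / (\<psi> 0 z - b))"
      by (rule continuous_on_subset[OF holomorphic_on_imp_continuous_on[OF hol]]) (use assms in auto)
    show "norm (1 / (\<psi> 0 z - b)) \<le> 1 / R" if "z \<in> frontier (cball 0 (norm \<zeta>))" for z
    proof -
      have "norm z = norm \<zeta>" using that by simp
      from sphere[OF this] show ?thesis using R_pos by (simp add: norm_divide frac_le)
    qed
  qed auto
  moreover have "norm (\<psi> 0 0 - b) > 0" using b[of 0] by simp
  ultimately show False using R_\<psi>[of 0] R_pos by (simp add: norm_divide dist_norm field_simps)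
qed

lemma closure_\<psi>_subset: "\<exists>i<n. \<psi> j ` ball 0 1 \<subseteq> \<psi> i ` ball 0 1"
proof (intro exI conjI)
  show "j mod n < n" using n by simp
  show "\<psi> j ` ball 0 1 \<subseteq> \<psi> (j mod n) ` ball 0 1"
  proof safe
    fix \<zeta> :: complex assume "\<zeta> \<in> ball 0 1"
    then have "\<psi> j \<zeta> = \<psi> (j mod n) (rot ^ (j div n) * \<zeta>)" "rot ^ (j div n) * \<zeta> \<in> ball 0 1"
      using \<psi>_mod[of \<zeta> j] by (simp_all add: norm_mult)
    then show "\<psi> j \<zeta> \<in> \<psi> (j mod n) ` ball 0 1" by blast
  qed
qed

text \<open>Preimages of the two hairs that meet a small disk about \<open>b\<close>, together with that disk, are disjoint from
  the Siegel disks, and a point of the closure of a Siegel disk can lie on at most one of the two.\<close>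

lemma barriers:
  obtains E1 E2 where
    "\<And>E. E \<in> {E1, E2} \<Longrightarrow> closed E \<and> connected E \<and> \<not> bounded E \<and> b \<in> E \<and> (\<forall>j. E \<inter> \<psi> j ` ball 0 1 = {})"
    "\<And>j. E1 \<inter> E2 \<inter> closure (\<psi> j ` ball 0 1) = {}"
proof -
  obtain A1 A2 where A12: "A1 \<inter> A2 = {}"
    and A: "\<And>A. A \<in> {A1, A2} \<Longrightarrow> closed A \<and> connected A \<and> \<not> bounded A \<and> f ` A \<subseteq> A \<and> (\<forall>z\<in>A. R \<le> dist z b)"
    using hairs_exist by (elim exE conjE) (rule that, assumption, drule bspec, assumption+)
  have iterA: "(f ^^ k) z \<in> A" if "A \<in> {A1, A2}" "z \<in> A" for A k z
  proof (induction k)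
    case (Suc k)
    have "f ` A \<subseteq> A" using A[OF that(1)] by simp
    then show ?case using Suc.IH by auto
  qed (use that in simp)
  let ?W = "\<Union>i<n. closure (\<psi> i ` ball 0 1)"
  have sub: "closure (\<psi> j ` ball 0 1) \<subseteq> ?W" for j
    using closure_\<psi>_subset[of j] closure_mono by blast
  have "closed ?W" by (intro closed_UN) auto
  then have "open (- ?W)" by (rule open_Compl)
  moreover have "b \<in> - ?W" using b_boundary by blast
  ultimately obtain e where e: "e > 0" "ball b e \<subseteq> - ?W" by (rule openE)
  define d where "d = e / 2"
  have d: "d > 0" "cball b d \<inter> ?W = {}" using e by (auto simp: d_def subset_iff)
  have ex: "\<exists>E k. closed E \<and> connected E \<and> \<not> bounded E \<and> E \<inter> cball b d \<noteq> {} \<and>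
      (\<forall>z\<in>E. (f ^^ k) z \<in> A) \<and> (\<forall>j. E \<inter> \<psi> j ` ball 0 1 = {})" if AA: "A \<in> {A1, A2}" for A
  proof -
    note A = A[OF AA]
    have "\<not> (\<exists>z. A \<subseteq> {z})" using A bounded_subset finite_imp_bounded by (metis finite.emptyI finite.insertI)
    moreover have "A \<noteq> {}" using A by auto
    ultimately obtain \<alpha> \<beta> where ab: "\<alpha> \<in> A" "\<beta> \<in> A" "\<alpha> \<noteq> \<beta>" by blast
    \<comment> \<open>As \<open>b\<close> lies in the Julia set, the iterates of the small disk
      cannot omit two points of the hair, so some preimage of the hair enters the disk.\<close>
    have "\<not> (\<forall>k z. z \<in> ball b d \<longrightarrow> (f ^^ k) z \<noteq> \<alpha> \<and> (f ^^ k) z \<noteq> \<beta>)"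
      using fatou_if_omitting_two[OF d(1) ab(3)] b_julia by blast
    then obtain k x where x: "x \<in> ball b d" "(f ^^ k) x \<in> A" using ab by blast
    let ?Z = "(f ^^ k) -` A"
    define E where "E = connected_component_set ?Z x"
    have EZ: "E \<subseteq> ?Z" by (simp add: E_def connected_component_subset)
    have "closed ?Z" using A by (intro closed_vimage cont_iter) simp
    then have "closed E" unfolding E_def by (rule closed_connected_component)
    moreover have "connected E" by (simp add: E_def)
    moreover have "\<not> bounded E"
      unfolding E_def using A x iter_nonconst by (intro preimage_component_unbounded) auto
    moreover have "x \<in> E" using x by (simp add: E_def connected_component_refl)
    then have "E \<inter> cball b d \<noteq> {}" using x by auto
    \<comment> \<open>A common point would enter the hair after \<open>k\<close> steps and stay
      there, at distance at least \<open>R\<close> from \<open>b\<close>; yet the rotated points on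
      its orbit come closer to \<open>b\<close> than \<open>R\<close>.\<close>
    moreover have "E \<inter> \<psi> j ` ball 0 1 = {}" for j
    proof (rule ccontr)
      assume "E \<inter> \<psi> j ` ball 0 1 \<noteq> {}"
      then obtain \<zeta> where \<zeta>: "norm \<zeta> < 1" "\<psi> j \<zeta> \<in> E" by auto
      have "(f ^^ t) (\<psi> (k + j) \<zeta>) \<in> A" for t
        using iterA[OF AA, of "\<psi> (k + j) \<zeta>"] EZ \<zeta>(2) \<psi>_add[of k j \<zeta>] by auto
      then have inA: "\<psi> (t + (k + j)) \<zeta> \<in> A" for t by (simp add: \<psi>_add)
      have "\<psi> 0 (rot ^ i * (rot ^ (k + j) * \<zeta>)) \<in> A" for i
      proof -
        have "k + j \<le> n * (i + (k + j))" using n by (metis le_add2 mult_le_mono nat_mult_1)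
        then have "\<psi> (n * (i + (k + j)) + 0) \<zeta> \<in> A" using inA[of "n * (i + (k + j)) - (k + j)"] by simp
        then show ?thesis unfolding \<psi>_period[OF \<zeta>(1)] by (simp add: power_add mult_ac)
      qed
      moreover obtain i where "dist (\<psi> 0 (rot ^ i * (rot ^ (k + j) * \<zeta>))) b < R"
        using \<psi>_near_b[of "rot ^ (k + j) * \<zeta>"] \<zeta>(1) by (auto simp: norm_mult)
      ultimately show False using A by (meson not_less)
    qed
    ultimately show ?thesis using EZ by blast
  qed
  obtain B1 k1 where B1: "closed B1" "connected B1" "\<not> bounded B1" "B1 \<inter> cball b d \<noteq> {}"
      "\<And>z. z \<in> B1 \<Longrightarrow> (f ^^ k1) z \<in> A1" "\<And>j. B1 \<inter> \<psi> j ` ball 0 1 = {}"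
    using ex[of A1, OF insertI1] by (elim exE conjE) (rule that, (assumption | blast)+)
  obtain B2 k2 where B2: "closed B2" "connected B2" "\<not> bounded B2" "B2 \<inter> cball b d \<noteq> {}"
      "\<And>z. z \<in> B2 \<Longrightarrow> (f ^^ k2) z \<in> A2" "\<And>j. B2 \<inter> \<psi> j ` ball 0 1 = {}"
    using ex[of A2, OF insertI2[OF insertI1]] by (elim exE conjE) (rule that, (assumption | blast)+)
  \<comment> \<open>The exponents \<open>k1\<close> and \<open>k2\<close> may differ; forward
    invariance puts a common point into both hairs after \<open>k1 + k2\<close> steps.\<close>
  have "B1 \<inter> B2 = {}"
  proof (rule ccontr)
    assume "B1 \<inter> B2 \<noteq> {}"
    then obtain z where z: "z \<in> B1" "z \<in> B2" by blast
    have "(f ^^ (k2 + k1)) z \<in> A1" using iterA[of A1 "(f ^^ k1) z" k2] B1(5)[OF z(1)] by (simp add: iter_add)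
    moreover have "(f ^^ (k1 + k2)) z \<in> A2" using iterA[of A2 "(f ^^ k2) z" k1] B2(5)[OF z(2)] by (simp add: iter_add)
    ultimately show False using A12 by (auto simp: add.commute)
  qed
  moreover have W: "cball b d \<inter> closure (\<psi> j ` ball 0 1) = {}" for j using sub[of j] d(2) by blast
  ultimately have "(B1 \<union> cball b d) \<inter> (B2 \<union> cball b d) \<inter> closure (\<psi> j ` ball 0 1) = {}" for j by blast
  moreover have "closed E \<and> connected E \<and> \<not> bounded E \<and> b \<in> E \<and> (\<forall>j. E \<inter> \<psi> j ` ball 0 1 = {})"
    if "E \<in> {B1 \<union> cball b d, B2 \<union> cball b d}" for E
  proof -
    have "closed (B \<union> cball b d) \<and> connected (B \<union> cball b d) \<and> \<not> bounded (B \<union> cball b d) \<and> b \<in> B \<union> cball b d \<and>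
       (\<forall>j. (B \<union> cball b d) \<inter> \<psi> j ` ball 0 1 = {})"
      if "closed B" "connected B" "\<not> bounded B" "B \<inter> cball b d \<noteq> {}" "\<And>j. B \<inter> \<psi> j ` ball 0 1 = {}" for B
    proof (intro conjI allI)
      show "(B \<union> cball b d) \<inter> \<psi> j ` ball 0 1 = {}" for j
        using that(5)[of j] W[of j] closure_subset[of "\<psi> j ` ball 0 1"] by blast
    qed (use that d(1) in \<open>auto intro: connected_Un\<close>)
    then show ?thesis using that B1 B2 by blast
  qed
  ultimately show ?thesis using that by blast
qed

end

section \<open>Bounded preimages\<close>

lemma logs_differ_by_constant:
  fixes g1 g2 :: "complex \<Rightarrow> complex"
  assumes S: "connected S" "continuous_on S g1" "continuous_on S g2"
    and eq: "\<And>x. x \<in> S \<Longrightarrow> exp (g1 x) = exp (g2 x)" and xy: "x \<in> S" "y \<in> S"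
  shows "g1 x - g2 x = g1 y - g2 y"
proof -
  have "(\<lambda>x. g1 x - g2 x) constant_on S"
  proof (rule continuous_discrete_range_constant[OF S(1)])
    show "continuous_on S (\<lambda>x. g1 x - g2 x)" by (intro continuous_intros S)
    fix u assume u: "u \<in> S"
    have "1 \<le> norm ((g1 v - g2 v) - (g1 u - g2 u))"
      if v: "v \<in> S" "g1 v - g2 v \<noteq> g1 u - g2 u" for v
    proof -
      obtain k l :: int where kl: "g1 v = g2 v + of_int k * (2 * of_real pi * \<i>)"
          "g1 u = g2 u + of_int l * (2 * of_real pi * \<i>)"
        using eq[OF v(1)] eq[OF u] unfolding exp_eq_iff_int by blast
      then have "k \<noteq> l" using v(2) by auto
      then have "1 \<le> \<bar>real_of_int (k - l)\<bar>" by linarith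
      moreover have "norm ((g1 v - g2 v) - (g1 u - g2 u)) = \<bar>real_of_int (k - l)\<bar> * (2 * pi)"
      proof -
        have "(g1 v - g2 v) - (g1 u - g2 u) = of_int (k - l) * (2 * of_real pi * \<i>)"
          using kl by (simp add: algebra_simps)
        then show ?thesis by (simp only: norm_mult norm_of_int) simp
      qed
      moreover have "1 \<le> 2 * pi" using pi_ge_two by simp
      ultimately show ?thesis using mult_mono[of 1 "\<bar>real_of_int (k - l)\<bar>" 1 "2 * pi"] by simp
    qed
    then show "\<exists>e>0. \<forall>v. v \<in> S \<and> g1 v - g2 v \<noteq> g1 u - g2 u \<longrightarrow> e \<le> norm (g1 v - g2 v - (g1 u - g2 u))"
      by (intro exI[of _ 1]) auto
  qed
  then obtain c where "\<And>x. x \<in> S \<Longrightarrow> g1 x - g2 x = c" by (auto simp: constant_on_def)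
  then show ?thesis using xy by simp
qed

text \<open>Bounded sequences have convergent subsequences. The local bound is required at every
  point of the closure, and for all parameters whose images are near it, whichever piece of the
  image they belong to.\<close>

lemma bounded_from_local:
  fixes p h :: "'a \<Rightarrow> complex"
  assumes loc: "\<And>w. w \<in> closure (p ` B) \<Longrightarrow> \<exists>e>0. \<exists>C. \<forall>\<zeta>\<in>B. dist (p \<zeta>) w < e \<longrightarrow> norm (h \<zeta>) \<le> C"
  shows "\<exists>C. \<forall>\<zeta>\<in>B. norm (p \<zeta>) \<le> K \<longrightarrow> norm (h \<zeta>) \<le> C"
proof (rule ccontr)
  assume "\<not> ?thesis"
  then have "\<exists>\<zeta>\<in>B. norm (p \<zeta>) \<le> K \<and> norm (h \<zeta>) > real m" for m by (meson not_le)
  then obtain x where x: "\<And>m. x m \<in> B" "\<And>m. norm (p (x m)) \<le> K" "\<And>m. norm (h (x m)) > real m" by metis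
  obtain w r where r: "strict_mono (r :: nat \<Rightarrow> nat)" "(\<lambda>m. p (x (r m))) \<longlonglongrightarrow> w"
    using bounded_subsequence[of "\<lambda>m. p (x m)"] x(2) by metis
  have "w \<in> closure (p ` B)" unfolding closure_sequential using r(2) x(1) by (intro exI[of _ "\<lambda>m. p (x (r m))"]) auto
  then obtain e C where e: "e > 0" "\<And>\<zeta>. \<zeta> \<in> B \<Longrightarrow> dist (p \<zeta>) w < e \<Longrightarrow> norm (h \<zeta>) \<le> C" using loc by blast
  obtain N where N: "\<And>m. m \<ge> N \<Longrightarrow> dist (p (x (r m))) w < e" using r(2) e(1) unfolding lim_sequentially by blast
  define m where "m = max N (nat \<lceil>C\<rceil>)"
  have "norm (h (x (r m))) \<le> C" using N[of m] e(2)[OF x(1)] by (simp add: m_def)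
  moreover have "C \<le> real m" unfolding m_def by linarith
  moreover have "real m \<le> real (r m)" using seq_suble[OF r(1), of m] by simp
  ultimately show False using x(3)[of "r m"] by linarith
qed

lemma locally_bounded_at:
  fixes g :: "complex \<Rightarrow> complex"
  assumes "continuous_on \<Omega> g" "open \<Omega>" "w \<in> \<Omega>"
  obtains e where "e > 0" "ball w e \<subseteq> \<Omega>" "\<And>z. dist z w < e \<Longrightarrow> norm (g z) \<le> norm (g w) + 1"
proof -
  have "isCont g w" using assms continuous_on_eq_continuous_at by blast
  then obtain d where d: "d > 0" "\<And>z. dist z w < d \<Longrightarrow> dist (g z) (g w) < 1"
    unfolding continuous_at_eps_delta by (metis zero_less_one)
  obtain d' where d': "d' > 0" "ball w d' \<subseteq> \<Omega>" using assms open_contains_ball by blast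
  show ?thesis
  proof (rule that[of "min d d'"])
    show "norm (g z) \<le> norm (g w) + 1" if "dist z w < min d d'" for z
      using d(2)[of z] that norm_triangle_sub[of "g z" "g w"] by (simp add: dist_norm)
  qed (use d d' in auto)
qed

lemma normalized_riemann_map:
  assumes "open \<Omega>" "simply_connected \<Omega>" "\<Omega> \<noteq> UNIV" "a \<in> \<Omega>"
  obtains \<kappa> \<kappa>' where "\<kappa> holomorphic_on \<Omega>" "\<kappa>' holomorphic_on ball 0 1" "\<kappa> a = 0"
    "\<And>z. z \<in> \<Omega> \<Longrightarrow> norm (\<kappa> z) < 1 \<and> \<kappa>' (\<kappa> z) = z"
    "\<And>z. norm z < 1 \<Longrightarrow> \<kappa>' z \<in> \<Omega> \<and> \<kappa> (\<kappa>' z) = z"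
proof -
  obtain g h where g: "g holomorphic_on \<Omega>" and h: "h holomorphic_on ball 0 1"
    and gh: "\<And>z. z \<in> \<Omega> \<Longrightarrow> g z \<in> ball 0 1 \<and> h (g z) = z" "\<And>z. z \<in> ball 0 1 \<Longrightarrow> h z \<in> \<Omega> \<and> g (h z) = z"
    using simply_connected_eq_biholomorphic_to_disc[OF assms(1)] assms(2-4) by blast
  define w where "w = g a"
  have w: "norm w < 1" "norm (- w) < 1" using gh(1)[OF assms(4)] by (simp_all add: w_def)
  let ?M = "Moebius_function 0 w" and ?M' = "Moebius_function 0 (- w)"
  show ?thesis
  proof (rule that[of "?M \<circ> g" "h \<circ> ?M'"])
    show "(?M \<circ> g) holomorphic_on \<Omega>"
      by (rule holomorphic_on_compose_gen[OF g Moebius_function_holomorphic[OF w(1)]]) (use gh in auto)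
    show "(h \<circ> ?M') holomorphic_on ball 0 1"
      by (rule holomorphic_on_compose_gen[OF Moebius_function_holomorphic[OF w(2)] h])
        (use Moebius_function_norm_lt_1[OF w(2)] in auto)
    show "(?M \<circ> g) a = 0" by (simp add: Moebius_function_eq_zero w_def)
    show "norm ((?M \<circ> g) z) < 1 \<and> (h \<circ> ?M') ((?M \<circ> g) z) = z" if "z \<in> \<Omega>" for z
      using gh(1)[OF that] Moebius_function_norm_lt_1[OF w(1)] Moebius_function_compose[of "- w" w] w by simp
    show "(h \<circ> ?M') z \<in> \<Omega> \<and> (?M \<circ> g) ((h \<circ> ?M') z) = z" if "norm z < 1" for z
      using gh(2) Moebius_function_norm_lt_1[OF w(2) that] Moebius_function_compose[of w "- w" z] w that by simp
  qed
qed

context tame_entire begin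

text \<open>A lift along a punctured disk stays bounded near the puncture, since there are no asymptotic values;
  as a value has only finitely many preimages in a bounded set, the lift is periodic under a full turn.\<close>

lemma punctured_lift_bounded:
  assumes \<Phi>: "\<Phi> holomorphic_on {s. Re s < 0}" and q: "q holomorphic_on ball 0 1"
    and lift: "\<And>s. Re s < 0 \<Longrightarrow> f (\<Phi> s) = q (exp s)"
    and nc: "\<And>s. Re s < 0 \<Longrightarrow> q (exp s) \<notin> critical_values f" and \<delta>: "\<delta> > 0"
  obtains B where "\<And>s. Re s \<le> - \<delta> \<Longrightarrow> norm (\<Phi> s) \<le> B"
proof -
  have cont_\<Phi>: "continuous_on {s. Re s < 0} \<Phi>" using \<Phi> by (rule holomorphic_on_imp_continuous_on)
  define \<gamma> where "\<gamma> = (\<lambda>t::real. \<Phi> (of_real (- 1 - t)))"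
  have cont_q: "isCont q 0"
    using holomorphic_on_imp_continuous_on[OF q] unfolding continuous_on_eq_continuous_at[OF open_ball] by simp
  have "continuous_on {0..} \<gamma>"
    unfolding \<gamma>_def by (rule continuous_on_compose2[OF cont_\<Phi>]) (auto intro!: continuous_intros)
  moreover have "((\<lambda>t. f (\<gamma> t)) \<longlongrightarrow> q 0) at_top"
  proof -
    have "((\<lambda>t::real. exp (- 1 - t)) \<longlongrightarrow> 0) at_top" by real_asymp
    then have "((\<lambda>t. complex_of_real (exp (- 1 - t))) \<longlongrightarrow> of_real 0) at_top" by (rule tendsto_of_real)
    then have lim: "((\<lambda>t. q (of_real (exp (- 1 - t)))) \<longlongrightarrow> q 0) at_top"
      by (intro isCont_tendsto_compose[OF cont_q]) simp
    have eq: "f (\<gamma> t) = q (of_real (exp (- 1 - t)))" if "t \<ge> 0" for t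
    proof -
      have "Re (of_real (- 1 - t)) < 0" using that by simp
      from lift[OF this] show ?thesis by (simp only: \<gamma>_def exp_of_real)
    qed
    show ?thesis
      by (rule Lim_transform_eventually[OF lim], rule eventually_at_top_linorderI[of 0]) (simp add: eq)
  qed
  ultimately obtain z where z: "(\<gamma> \<longlongrightarrow> z) at_top" "f z = q 0" by (rule landing)
  obtain r \<mu> where r: "0 < r" and \<mu>: "0 < \<mu>" "\<And>y. y \<in> sphere z r \<Longrightarrow> \<mu> \<le> dist (f y) (f z)"
    using isolating_sphere[of 1 z] by (metis zero_less_one)
  obtain d where d: "d > 0" "\<And>v. dist v 0 < d \<Longrightarrow> dist (q v) (q 0) < \<mu>"
    using cont_q \<mu>(1) unfolding continuous_at_eps_delta by blast
  define C where "C = max 1 (- ln d)"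
  have ed: "norm (exp s) < d" if "Re s < - C" for s
  proof -
    have "Re s < ln d" using that by (simp add: C_def)
    then show ?thesis using d(1) by (metis exp_less_cancel_iff exp_ln norm_exp_eq_Re)
  qed
  have "\<forall>\<^sub>F t in at_top. \<gamma> t \<in> ball z r \<and> C < t"
    using z(1) r(1) by (intro eventually_conj eventually_gt_at_top) (auto dest: tendstoD simp: dist_commute)
  then obtain t0 where t0: "\<gamma> t0 \<in> ball z r" "C < t0" by (auto simp: eventually_at_top_linorder)
  have trap: "\<Phi> s \<in> ball z r" if "Re s < - C" for s
  proof (rule trapped[of "{s. Re s < - C}" \<Phi> "f z" \<mu> z r "of_real (- 1 - t0)" s])
    show "connected {s. Re s < - C}" by (intro convex_connected convex_halfspace_Re_lt)
    show "continuous_on {s. Re s < - C} \<Phi>" by (rule continuous_on_subset[OF cont_\<Phi>]) (auto simp: C_def)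
    show "dist (f (\<Phi> t)) (f z) < \<mu>" if "t \<in> {s. Re s < - C}" for t
      using d(2)[of "exp t"] ed[of t] lift[of t] z(2) that by (simp add: C_def)
    show "\<Phi> (of_real (- 1 - t0)) \<in> ball z r" using t0(1) by (simp only: \<gamma>_def)
  qed (use \<mu> that t0 in auto)
  define s where "s = (\<lambda>k::nat. of_real (- C - 1) + of_int (int k) * (2 * of_real pi * \<i>))"
  have Res: "Re (s k) = - C - 1" for k by (simp add: s_def)
  have es: "exp (s k) = exp (of_real (- C - 1))" for k unfolding s_def by (rule exp_add_int)
  have s0: "Re (s k) < 0" for k unfolding Res by (simp add: C_def)
  have "\<Phi> (s k) \<in> {y \<in> cball z r. f y = q (exp (of_real (- C - 1)))}" for k
    using trap[of "s k"] lift[OF s0, of k] es[of k] by (simp add: Res less_imp_le)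
  then have "finite (range (\<lambda>k. \<Phi> (s k)))"
    by (intro finite_subset[OF _ finite_preimage[OF compact_cball]]) blast
  then have "\<not> inj (\<lambda>k. \<Phi> (s k))" using finite_imageD infinite_UNIV_nat by metis
  then obtain k l where kl: "\<Phi> (s k) = \<Phi> (s l)" "k \<noteq> l" by (auto simp: inj_on_def)
  define y where "y = 2 * pi * of_int (int k - int l)"
  have ky: "of_int (int k - int l) * (2 * of_real pi * \<i>) = of_real y * \<i>" by (simp add: y_def)
  have y0: "y \<noteq> 0" using kl(2) by (simp add: y_def)
  have sl: "s l + of_real y * \<i> = s k" unfolding s_def ky[symmetric] by (simp add: algebra_simps)
  have per: "\<Phi> (x + of_real y * \<i>) = \<Phi> x" if "x \<in> {s. Re s < 0}" for x
  proof (rule lift_unique[of "{s. Re s < 0}" "\<lambda>x. \<Phi> (x + of_real y * \<i>)" \<Phi> "s l" x])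
    show "connected {s. Re s < 0}" by (intro convex_connected convex_halfspace_Re_lt)
    show "continuous_on {s. Re s < 0} (\<lambda>x. \<Phi> (x + of_real y * \<i>))"
      by (rule continuous_on_compose2[OF cont_\<Phi>]) (auto intro!: continuous_intros)
    have *: "f (\<Phi> (x + of_real y * \<i>)) = q (exp x)" if "Re x < 0" for x
    proof -
      have "exp (x + of_real y * \<i>) = exp x" unfolding ky[symmetric] by (rule exp_add_int)
      then show ?thesis using lift[of "x + of_real y * \<i>"] that by simp
    qed
    show "f (\<Phi> (x + of_real y * \<i>)) = f (\<Phi> x)" if "x \<in> {s. Re s < 0}" for x
      using *[of x] lift[of x] that by simp
    show "deriv f (\<Phi> (x + of_real y * \<i>)) \<noteq> 0" if "x \<in> {s. Re s < 0}" for x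
      using *[of x] nc[of x] that by (intro not_crit) simp
    show "\<Phi> (s l + of_real y * \<i>) = \<Phi> (s l)" using sl kl(1) by simp
  qed (use cont_\<Phi> s0 that in auto)
  let ?K = "cbox (Complex (- C) (- \<bar>y\<bar>)) (Complex (- \<delta>) \<bar>y\<bar>)"
  have "compact (\<Phi> ` ?K)"
    by (intro compact_continuous_image compact_cbox continuous_on_subset[OF cont_\<Phi>])
      (use \<delta> in \<open>auto simp: in_cbox_complex_iff\<close>)
  then obtain B where B: "\<And>x. x \<in> ?K \<Longrightarrow> norm (\<Phi> x) \<le> B"
    using compact_imp_bounded bounded_iff by (metis image_eqI)
  show ?thesis
  proof (rule that[of "max B (norm z + r)"])
    fix x assume x: "Re x \<le> - \<delta>"
    show "norm (\<Phi> x) \<le> max B (norm z + r)"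
    proof (cases "Re x < - C")
      case True
      then show ?thesis using trap[OF True] norm_triangle_sub[of "\<Phi> x" z] by (simp add: dist_norm norm_minus_commute)
    next
      case False
      have "\<exists>x'\<in>{s. Re s < 0}. \<Phi> x' = \<Phi> x \<and> Re x' = Re x \<and> \<bar>Im x'\<bar> \<le> \<bar>y\<bar>"
        by (rule vertical_period_reduce[of _ \<Phi> y, OF _ per y0]) (use x \<delta> in auto)
      then obtain x' where "\<Phi> x' = \<Phi> x" "Re x' = Re x" "\<bar>Im x'\<bar> \<le> \<bar>y\<bar>" by blast
      moreover from this have "x' \<in> ?K" using False x by (simp add: in_cbox_complex_iff abs_le_iff)
      ultimately show ?thesis using B[of x'] by (simp add: le_max_iff_disj)
    qed
  qed
qed

end

context siegel_two begin

text \<open>One of the two barriers misses \<open>w\<close>. The component of its complement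
  containing \<open>w\<close> contains a disk about \<open>w\<close>, which meets the connected
  image of \<open>\<psi> j\<close>; so it contains that whole image.\<close>

lemma barrier_domain:
  assumes w: "w \<in> closure (\<psi> j ` ball 0 1)"
  obtains \<Omega> where "open \<Omega>" "simply_connected \<Omega>" "w \<in> \<Omega>" "\<psi> j ` ball 0 1 \<subseteq> \<Omega>" "b \<notin> \<Omega>"
proof -
  have "\<exists>E. closed E \<and> connected E \<and> \<not> bounded E \<and> b \<in> E \<and> E \<inter> \<psi> j ` ball 0 1 = {} \<and> w \<notin> E"
  proof (rule barriers)
    fix E1 E2
    assume E: "\<And>E. E \<in> {E1, E2} \<Longrightarrow> closed E \<and> connected E \<and> \<not> bounded E \<and> b \<in> E \<and> (\<forall>j. E \<inter> \<psi> j ` ball 0 1 = {})"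
      and "\<And>j. E1 \<inter> E2 \<inter> closure (\<psi> j ` ball 0 1) = {}"
    then have "w \<notin> E1 \<or> w \<notin> E2" using w by blast
    then show ?thesis
    proof
      assume "w \<notin> E1"
      then show ?thesis using E[of E1] by (intro exI[of _ E1]) simp
    next
      assume "w \<notin> E2"
      then show ?thesis using E[of E2] by (intro exI[of _ E2]) simp
    qed
  qed
  then obtain E where E: "closed E" "connected E" "\<not> bounded E" "b \<in> E" "E \<inter> \<psi> j ` ball 0 1 = {}" "w \<notin> E"
    by blast
  define \<Omega> where "\<Omega> = connected_component_set (- E) w"
  have "open (- E)" using E(1) by auto
  then obtain e where e: "e > 0" "ball w e \<subseteq> - E" using E(6) open_contains_ball by (metis ComplI)
  have con: "connected (\<psi> j ` ball 0 1)" by (intro connected_continuous_image cont_\<psi>) auto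
  obtain y where "y \<in> \<psi> j ` ball 0 1" "dist y w < e" using w e(1) closure_approachable by metis
  then have "ball w e \<inter> \<psi> j ` ball 0 1 \<noteq> {}" by (auto simp: dist_commute)
  then have "connected (ball w e \<union> \<psi> j ` ball 0 1)" by (intro connected_Un con) auto
  then have "ball w e \<union> \<psi> j ` ball 0 1 \<subseteq> \<Omega>"
    unfolding \<Omega>_def using e E(5) by (intro connected_component_maximal) auto
  moreover have "\<Omega> \<in> components (- E)" unfolding \<Omega>_def components_def using E(6) by blast
  then have "simply_connected \<Omega>" "open \<Omega>"
    using simply_connected_component_Compl[OF E(1-3)] open_components \<open>open (- E)\<close> by blast+
  moreover have "\<Omega> \<subseteq> - E" by (simp add: \<Omega>_def connected_component_subset)
  ultimately show ?thesis using that[of \<Omega>] E(4) centre_in_ball[THEN iffD2, OF e(1)] by blast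
qed

text \<open>The domain from \<open>barrier_domain\<close> carries a logarithm of
  \<open>z - b\<close>, and \<open>l\<close> differs from it by a single constant along the whole
  disk. Continuity of that logarithm at \<open>w\<close> then bounds \<open>l\<close> near
  \<open>w\<close>.\<close>

lemma log_\<psi>_bounded:
  assumes l: "continuous_on (ball 0 1) l" "\<And>\<zeta>. norm \<zeta> < 1 \<Longrightarrow> exp (l \<zeta>) = \<psi> j \<zeta> - b"
  shows "\<exists>C. \<forall>\<zeta>\<in>ball 0 1. norm (\<psi> j \<zeta>) \<le> K \<longrightarrow> norm (l \<zeta>) \<le> C"
proof (rule bounded_from_local)
  fix w assume "w \<in> closure (\<psi> j ` ball 0 1)"
  then obtain \<Omega> where \<Omega>: "open \<Omega>" "simply_connected \<Omega>" "w \<in> \<Omega>" "\<psi> j ` ball 0 1 \<subseteq> \<Omega>" "b \<notin> \<Omega>"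
    by (rule barrier_domain)
  have "(\<lambda>z. z - b) holomorphic_on \<Omega>" "\<forall>z\<in>\<Omega>. z - b \<noteq> 0" using \<Omega>(5) by (auto intro!: holomorphic_intros)
  then obtain \<Lambda> where \<Lambda>: "\<Lambda> holomorphic_on \<Omega>" "\<And>z. z \<in> \<Omega> \<Longrightarrow> z - b = exp (\<Lambda> z)"
    using \<Omega>(2) simply_connected_eq_holomorphic_log[OF \<Omega>(1)] by metis
  have cont: "continuous_on \<Omega> \<Lambda>" using \<Lambda>(1) by (rule holomorphic_on_imp_continuous_on)
  obtain e where e: "e > 0" "\<And>z. dist z w < e \<Longrightarrow> norm (\<Lambda> z) \<le> norm (\<Lambda> w) + 1"
    using locally_bounded_at[OF cont \<Omega>(1,3)] by metis
  have const: "l \<zeta> - \<Lambda> (\<psi> j \<zeta>) = l 0 - \<Lambda> (\<psi> j 0)" if "\<zeta> \<in> ball 0 1" for \<zeta>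
  proof (rule logs_differ_by_constant[of "ball 0 1" l "\<lambda>\<zeta>. \<Lambda> (\<psi> j \<zeta>)"])
    show "continuous_on (ball 0 1) (\<lambda>\<zeta>. \<Lambda> (\<psi> j \<zeta>))"
      by (rule continuous_on_compose2[OF cont cont_\<psi>[OF order.refl] \<Omega>(4)])
    show "exp (l x) = exp (\<Lambda> (\<psi> j x))" if "x \<in> ball 0 1" for x
    proof -
      have "\<psi> j x \<in> \<Omega>" using \<Omega>(4) that by blast
      then show ?thesis using l(2)[of x] \<Lambda>(2)[of "\<psi> j x"] that by simp
    qed
  qed (use l that in auto)
  show "\<exists>e>0. \<exists>C. \<forall>\<zeta>\<in>ball 0 1. dist (\<psi> j \<zeta>) w < e \<longrightarrow> norm (l \<zeta>) \<le> C"
  proof (rule exI[of _ e], rule conjI[OF e(1)], rule exI[of _ "norm (\<Lambda> w) + 1 + norm (l 0 - \<Lambda> (\<psi> j 0))"], intro ballI impI)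
    fix \<zeta> :: complex assume "\<zeta> \<in> ball 0 1" "dist (\<psi> j \<zeta>) w < e"
    then have "norm (\<Lambda> (\<psi> j \<zeta>)) \<le> norm (\<Lambda> w) + 1" "l \<zeta> - \<Lambda> (\<psi> j \<zeta>) = l 0 - \<Lambda> (\<psi> j 0)"
      using e(2) const by blast+
    then show "norm (l \<zeta>) \<le> norm (\<Lambda> w) + 1 + norm (l 0 - \<Lambda> (\<psi> j 0))"
      using norm_triangle_sub[of "l \<zeta>" "\<Lambda> (\<psi> j \<zeta>)"] by simp
  qed
qed

lemma \<psi>_not_crit:
  assumes "norm \<zeta> < 1" "\<psi> (Suc j) \<zeta> \<noteq> a" shows "\<psi> (Suc j) \<zeta> \<notin> critical_values f"
proof -
  have "\<psi> (Suc j) \<zeta> \<noteq> b" using \<psi>_fatou[OF assms(1), of "Suc j"] b_julia by metis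
  then show ?thesis using assms(2) by (simp add: CV)
qed

text \<open>With no critical value in \<open>\<Omega>\<close>, one inverse branch of
  \<open>f\<close> carries \<open>\<psi> (Suc j)\<close> to \<open>\<psi> j\<close> on the entire
  unit disk, and it is bounded near \<open>w\<close>.\<close>

lemma \<psi>_bounded_section:
  assumes \<Omega>: "open \<Omega>" "simply_connected \<Omega>" "w \<in> \<Omega>" "\<psi> (Suc j) ` ball 0 1 \<subseteq> \<Omega>" "b \<notin> \<Omega>" "a \<notin> \<Omega>"
  shows "\<exists>e>0. \<exists>C. \<forall>\<zeta>\<in>ball 0 1. dist (\<psi> (Suc j) \<zeta>) w < e \<longrightarrow> norm (\<psi> j \<zeta>) \<le> C"
proof -
  have 0: "\<psi> (Suc j) 0 \<in> \<Omega>" using \<Omega>(4) by auto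
  have nc: "(\<lambda>z. z) ` \<Omega> \<inter> critical_values f = {}" using \<Omega>(5,6) by (auto simp: CV)
  have id: "(\<lambda>z. z) holomorphic_on \<Omega>" by (rule holomorphic_on_ident)
  have f0: "f (\<psi> j 0) = \<psi> (Suc j) 0" by (simp add: \<psi>_Suc)
  obtain h where h: "h holomorphic_on \<Omega>" "h (\<psi> (Suc j) 0) = \<psi> j 0" "\<And>s. s \<in> \<Omega> \<Longrightarrow> f (h s) = s"
    using lift_exists[OF \<Omega>(1,2) id nc 0 f0] by blast
  have cont: "continuous_on \<Omega> h" using h(1) by (rule holomorphic_on_imp_continuous_on)
  obtain e where e: "e > 0" "\<And>z. dist z w < e \<Longrightarrow> norm (h z) \<le> norm (h w) + 1"
    using locally_bounded_at[OF cont \<Omega>(1,3)] by metis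
  have "h (\<psi> (Suc j) \<zeta>) = \<psi> j \<zeta>" if \<zeta>: "\<zeta> \<in> ball 0 1" for \<zeta>
  proof (rule lift_unique[of "ball 0 1" "\<lambda>\<zeta>. h (\<psi> (Suc j) \<zeta>)" "\<psi> j" 0])
    show "continuous_on (ball 0 1) (\<lambda>\<zeta>. h (\<psi> (Suc j) \<zeta>))"
      by (rule continuous_on_compose2[OF cont cont_\<psi>[OF order.refl] \<Omega>(4)])
    have *: "f (h (\<psi> (Suc j) x)) = \<psi> (Suc j) x" "\<psi> (Suc j) x \<notin> critical_values f" if "x \<in> ball 0 1" for x
    proof -
      have "\<psi> (Suc j) x \<in> \<Omega>" using \<Omega>(4) that by blast
      then show "f (h (\<psi> (Suc j) x)) = \<psi> (Suc j) x" "\<psi> (Suc j) x \<notin> critical_values f"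
        using h(3) nc by auto
    qed
    show "f (h (\<psi> (Suc j) x)) = f (\<psi> j x)" if "x \<in> ball 0 1" for x
      using *(1)[OF that] by (simp add: \<psi>_Suc)
    show "deriv f (h (\<psi> (Suc j) x)) \<noteq> 0" if "x \<in> ball 0 1" for x
      using *[OF that] by (intro not_crit) simp
  qed (use h \<zeta> in \<open>auto intro: cont_\<psi>\<close>)
  then have "norm (\<psi> j \<zeta>) \<le> norm (h w) + 1" if "\<zeta> \<in> ball 0 1" "dist (\<psi> (Suc j) \<zeta>) w < e" for \<zeta>
    using e(2)[OF that(2)] that(1) by simp
  then show ?thesis using e(1) by blast
qed

text \<open>With \<open>a\<close> in \<open>\<Omega>\<close> an inverse branch need not exist. It is
  replaced by a lift \<open>\<Phi>\<close> on the left half-plane, which covers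
  \<open>\<Omega>\<close> without \<open>a\<close> through \<open>exp\<close> and a Riemann map
  sending 0 to \<open>a\<close>; \<open>punctured_lift_bounded\<close> bounds
  \<open>\<Phi>\<close>.\<close>

lemma \<psi>_bounded_puncture:
  assumes \<Omega>: "open \<Omega>" "simply_connected \<Omega>" "w \<in> \<Omega>" "\<psi> (Suc j) ` ball 0 1 \<subseteq> \<Omega>" "b \<notin> \<Omega>" "a \<in> \<Omega>"
  shows "\<exists>e>0. \<exists>C. \<forall>\<zeta>\<in>ball 0 1. dist (\<psi> (Suc j) \<zeta>) w < e \<longrightarrow> norm (\<psi> j \<zeta>) \<le> C"
proof -
  have "\<Omega> \<noteq> UNIV" using \<Omega>(5) by blast
  then obtain \<kappa> q where \<kappa>: "\<kappa> holomorphic_on \<Omega>" and q: "q holomorphic_on ball 0 1" and \<kappa>a: "\<kappa> a = 0"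
    and \<kappa>q: "\<And>z. z \<in> \<Omega> \<Longrightarrow> norm (\<kappa> z) < 1 \<and> q (\<kappa> z) = z"
    and q\<kappa>: "\<And>z. norm z < 1 \<Longrightarrow> q z \<in> \<Omega> \<and> \<kappa> (q z) = z"
    using normalized_riemann_map[OF \<Omega>(1,2) _ \<Omega>(6)] by metis
  let ?H = "{s. Re s < 0}"
  have ball: "norm (exp s) < 1" if "Re s < 0" for s :: complex using that by (simp add: norm_exp_eq_Re)
  have nc: "q (exp s) \<notin> critical_values f" if "Re s < 0" for s
  proof -
    have "q (exp s) \<noteq> a" using q\<kappa>[OF ball[OF that]] \<kappa>a by (metis exp_not_eq_zero)
    moreover have "q (exp s) \<noteq> b" using q\<kappa>[OF ball[OF that]] \<Omega>(5) by metis
    ultimately show ?thesis by (simp add: CV)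
  qed
  have H: "open ?H" "simply_connected ?H" "connected ?H"
    using convex_halfspace_Re_lt[of 0] open_halfspace_Re_lt[of 0]
    by (simp_all add: convex_imp_simply_connected convex_connected)
  let ?T = "ball 0 1 - {\<zeta> \<in> ball 0 1. \<psi> (Suc j) \<zeta> = a}"
  define \<kappa>\<psi> where "\<kappa>\<psi> = (\<lambda>\<zeta>. \<kappa> (\<psi> (Suc j) \<zeta>))"
  have \<psi>\<Omega>: "\<psi> (Suc j) \<zeta> \<in> \<Omega>" if "norm \<zeta> < 1" for \<zeta> using \<Omega>(4) that by auto
  have hol_\<kappa>\<psi>: "\<kappa>\<psi> holomorphic_on ball 0 1"
    unfolding \<kappa>\<psi>_def using holomorphic_on_compose_gen[OF hol_\<psi> \<kappa>, of "Suc j"] \<Omega>(4) by (simp add: o_def)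
  have \<kappa>\<psi>: "norm (\<kappa>\<psi> \<zeta>) < 1" "q (\<kappa>\<psi> \<zeta>) = \<psi> (Suc j) \<zeta>" if "norm \<zeta> < 1" for \<zeta>
    using \<kappa>q[OF \<psi>\<Omega>[OF that]] by (simp_all add: \<kappa>\<psi>_def)
  have \<kappa>\<psi>0: "\<kappa>\<psi> \<zeta> \<noteq> 0" if "\<zeta> \<in> ?T" for \<zeta>
  proof
    assume "\<kappa>\<psi> \<zeta> = 0"
    then have "q 0 = \<psi> (Suc j) \<zeta>" using \<kappa>\<psi>(2)[of \<zeta>] that by auto
    moreover have "q 0 = a" using \<kappa>q[OF \<Omega>(6)] \<kappa>a by simp
    ultimately show False using that by auto
  qed
  have Z: "\<exists>z0. {\<zeta> \<in> ball 0 1. \<psi> (Suc j) \<zeta> = a} \<subseteq> {z0}"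
    using inj_\<psi>[of "Suc j"] unfolding inj_on_def by (smt (verit, best) mem_Collect_eq singleton_iff subsetI)
  then have finZ: "finite {\<zeta> \<in> ball 0 1. \<psi> (Suc j) \<zeta> = a}" using finite_subset by auto
  have T: "open ?T" "connected ?T"
    using finZ by (auto intro!: connected_open_diff_countable open_Diff finite_imp_closed countable_finite)
  have "?T \<noteq> {}"
  proof
    assume "?T = {}"
    then have "ball (0::complex) 1 \<subseteq> {\<zeta> \<in> ball 0 1. \<psi> (Suc j) \<zeta> = a}" by blast
    then have "countable (ball (0::complex) 1)" using finZ countable_finite countable_subset by blast
    then show False using uncountable_ball[of 1 "0::complex"] by simp
  qed
  then obtain x0 where x0: "x0 \<in> ?T" by blast
  have es0: "exp (Ln (\<kappa>\<psi> x0)) = \<kappa>\<psi> x0" using \<kappa>\<psi>0[OF x0] by simp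
  have ReLn: "Re s < 0" if "exp s = \<kappa>\<psi> \<zeta>" "norm \<zeta> < 1" for s \<zeta>
  proof -
    have "exp (Re s) < 1" using \<kappa>\<psi>(1)[OF that(2)] that(1) by (metis norm_exp_eq_Re)
    then show ?thesis by simp
  qed
  have s0: "Ln (\<kappa>\<psi> x0) \<in> ?H" using ReLn[OF es0] x0 by auto
  have fs0: "f (\<psi> j x0) = q (exp (Ln (\<kappa>\<psi> x0)))" using es0 \<kappa>\<psi>(2)[of x0] x0 by (simp add: \<psi>_Suc)
  have hq: "(\<lambda>s. q (exp s)) holomorphic_on ?H"
    by (rule holomorphic_on_compose_gen[OF _ q, of exp, unfolded o_def]) (use ball in \<open>auto intro!: holomorphic_intros\<close>)
  have nc': "(\<lambda>s. q (exp s)) ` ?H \<inter> critical_values f = {}" using nc by auto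
  obtain \<Phi> where \<Phi>: "\<Phi> holomorphic_on ?H" "\<Phi> (Ln (\<kappa>\<psi> x0)) = \<psi> j x0" "\<And>s. s \<in> ?H \<Longrightarrow> f (\<Phi> s) = q (exp s)"
    using lift_exists[OF H(1,2) hq nc' s0 fs0] by blast
  have cont_\<Phi>: "continuous_on ?H \<Phi>" using \<Phi>(1) by (rule holomorphic_on_imp_continuous_on)
  \<comment> \<open>\<open>\<kappa>\<psi>\<close> need not have a single logarithm on
    \<open>?T\<close>, which may lack a point of the disk. So only the existence of a suitable value
    \<open>s\<close> is propagated; this suffices, as the bound on \<open>\<Phi>\<close> depends on
    \<open>Re s\<close> alone.\<close>
  define A where "A = (\<lambda>\<zeta>. \<exists>s. Re s < 0 \<and> exp s = \<kappa>\<psi> \<zeta> \<and> \<Phi> s = \<psi> j \<zeta>)"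
  have A: "A \<zeta>" if "\<zeta> \<in> ?T" for \<zeta>
  proof (rule connected_induction_simple[OF T(2) x0 that])
    show "A x0" unfolding A_def using s0 es0 \<Phi>(2) by auto
    fix x assume x: "x \<in> ?T"
    then obtain e where e: "e > 0" "ball x e \<subseteq> ?T" using T(1) open_contains_ball by blast
    have hol: "\<kappa>\<psi> holomorphic_on ball x e" using e(2) by (intro holomorphic_on_subset[OF hol_\<kappa>\<psi>]) blast
    have "\<exists>L. L holomorphic_on ball x e \<and> (\<forall>y\<in>ball x e. exp (L y) = \<kappa>\<psi> y)"
    proof (rule holomorphic_logarithm_exists[OF convex_ball open_ball hol, of x])
      show "\<kappa>\<psi> y \<noteq> 0" if "y \<in> ball x e" for y using e(2) that by (intro \<kappa>\<psi>0) blast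
    qed (use e(1) in auto)
    then obtain L where L: "L holomorphic_on ball x e" "\<And>y. y \<in> ball x e \<Longrightarrow> exp (L y) = \<kappa>\<psi> y" by blast
    have "A v" if uv: "u \<in> ball x e" "v \<in> ball x e" "A u" for u v
    proof -
      obtain s where s: "Re s < 0" "exp s = \<kappa>\<psi> u" "\<Phi> s = \<psi> j u" using uv(3) by (auto simp: A_def)
      then obtain k :: int where k: "s = L u + of_int k * (2 * of_real pi * \<i>)"
        using L(2)[OF uv(1)] exp_eq_iff_int by metis
      define L' where "L' = (\<lambda>y. L y + of_int k * (2 * of_real pi * \<i>))"
      have L': "exp (L' y) = \<kappa>\<psi> y" "Re (L' y) < 0" if "y \<in> ball x e" for y
      proof -
        show 1: "exp (L' y) = \<kappa>\<psi> y" using L(2)[OF that] by (simp only: L'_def exp_add_int)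
        show "Re (L' y) < 0" using ReLn[OF 1] e(2) that by auto
      qed
      have in1: "norm y < 1" "y \<in> ?T" if "y \<in> ball x e" for y using e(2) that by auto
      have "\<Phi> (L' v) = \<psi> j v"
      proof (rule lift_unique[of "ball x e" "\<lambda>y. \<Phi> (L' y)" "\<psi> j" u])
        show "continuous_on (ball x e) (\<lambda>y. \<Phi> (L' y))"
          unfolding L'_def
          by (rule continuous_on_compose2[OF cont_\<Phi>])
            (use L'(2) in \<open>auto intro!: continuous_intros holomorphic_on_imp_continuous_on[OF L(1)] simp: L'_def\<close>)
        have *: "f (\<Phi> (L' y)) = \<psi> (Suc j) y" if "y \<in> ball x e" for y
          using \<Phi>(3)[of "L' y"] L'[OF that] \<kappa>\<psi>(2)[OF in1(1)[OF that]] by simp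
        show "f (\<Phi> (L' y)) = f (\<psi> j y)" if "y \<in> ball x e" for y using *[OF that] by (simp add: \<psi>_Suc)
        show "deriv f (\<Phi> (L' y)) \<noteq> 0" if "y \<in> ball x e" for y
        proof (rule not_crit)
          have "\<psi> (Suc j) y \<noteq> a" using in1[OF that] by auto
          then show "f (\<Phi> (L' y)) \<notin> critical_values f"
            using *[OF that] \<psi>_not_crit[OF in1(1)[OF that]] by simp
        qed
        show "continuous_on (ball x e) (\<psi> j)" using in1(1) by (intro cont_\<psi>) auto
        show "\<Phi> (L' u) = \<psi> j u" using s(3) k by (simp add: L'_def)
      qed (use uv in auto)
      then show ?thesis unfolding A_def using L'[OF uv(2)] by (intro exI[of _ "L' v"]) simp
    qed
    moreover have "openin (top_of_set ?T) (ball x e)" using openin_open_eq[OF T(1)] e(2) by blast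
    moreover have "x \<in> ball x e" using e(1) by simp
    ultimately show "\<exists>V. openin (top_of_set ?T) V \<and> x \<in> V \<and> (\<forall>u\<in>V. \<forall>v\<in>V. A u \<longrightarrow> A v)"
      by blast
  qed
  obtain z0 where z0: "\<And>\<zeta>. norm \<zeta> < 1 \<Longrightarrow> \<psi> (Suc j) \<zeta> = a \<Longrightarrow> \<zeta> = z0" using Z by auto
  have \<kappa>w: "norm (\<kappa> w) < 1" using \<kappa>q[OF \<Omega>(3)] by simp
  \<comment> \<open>A radius strictly between \<open>norm (\<kappa> w)\<close> and 1: near
    \<open>w\<close> the points \<open>s\<close> satisfy \<open>Re s \<le> ln \<beta> < 0\<close>,
    and there \<open>\<Phi>\<close> is bounded.\<close>
  define \<beta> where "\<beta> = (1 + norm (\<kappa> w)) / 2"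
  have \<beta>: "0 < \<beta>" "\<beta> < 1" "norm (\<kappa> w) < \<beta>"
    using \<kappa>w norm_ge_zero[of "\<kappa> w"] by (auto simp: \<beta>_def simp del: norm_ge_zero)
  define \<delta> where "\<delta> = - ln \<beta>"
  have \<delta>: "\<delta> > 0" using \<beta> by (simp add: \<delta>_def)
  obtain B where B: "\<And>s. Re s \<le> - \<delta> \<Longrightarrow> norm (\<Phi> s) \<le> B"
    using punctured_lift_bounded[OF \<Phi>(1) q _ nc \<delta>] \<Phi>(3) by (metis mem_Collect_eq)
  have "isCont \<kappa> w"
    using holomorphic_on_imp_continuous_on[OF \<kappa>] continuous_on_eq_continuous_at[OF \<Omega>(1)] \<Omega>(3) by blast
  then obtain e where e: "e > 0" "\<And>z. dist z w < e \<Longrightarrow> dist (\<kappa> z) (\<kappa> w) < \<beta> - norm (\<kappa> w)"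
    using \<beta>(3) unfolding continuous_at_eps_delta by (metis diff_gt_0_iff_gt)
  show ?thesis
  proof (rule exI[of _ e], rule conjI[OF e(1)], rule exI[of _ "max B (norm (\<psi> j z0))"], intro ballI impI)
    fix \<zeta> :: complex assume \<zeta>: "\<zeta> \<in> ball 0 1" "dist (\<psi> (Suc j) \<zeta>) w < e"
    show "norm (\<psi> j \<zeta>) \<le> max B (norm (\<psi> j z0))"
    proof (cases "\<psi> (Suc j) \<zeta> = a")
      case True
      then have "\<zeta> = z0" using z0[of \<zeta>] \<zeta>(1) by simp
      then show ?thesis by simp
    next
      case False
      then obtain s where s: "exp s = \<kappa>\<psi> \<zeta>" "\<Phi> s = \<psi> j \<zeta>" using A[of \<zeta>] \<zeta>(1) by (auto simp: A_def)
      have "norm (\<kappa>\<psi> \<zeta>) < \<beta>"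
        using e(2)[OF \<zeta>(2)] norm_triangle_sub[of "\<kappa>\<psi> \<zeta>" "\<kappa> w"] by (simp add: \<kappa>\<psi>_def dist_norm)
      then have "norm (exp s) < \<beta>" using s(1) by simp
      then have "exp (Re s) < exp (ln \<beta>)" unfolding norm_exp_eq_Re exp_ln[OF \<beta>(1)] .
      then have "Re s \<le> - \<delta>" by (simp add: \<delta>_def)
      then show ?thesis using B[of s] s(2) by simp
    qed
  qed
qed

lemma \<psi>_bounded_if_image_bounded:
  "\<exists>C. \<forall>\<zeta>\<in>ball 0 1. norm (\<psi> (Suc j) \<zeta>) \<le> K \<longrightarrow> norm (\<psi> j \<zeta>) \<le> C"
proof (rule bounded_from_local)
  fix w assume "w \<in> closure (\<psi> (Suc j) ` ball 0 1)"
  then obtain \<Omega> where \<Omega>: "open \<Omega>" "simply_connected \<Omega>" "w \<in> \<Omega>" "\<psi> (Suc j) ` ball 0 1 \<subseteq> \<Omega>" "b \<notin> \<Omega>"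
    by (rule barrier_domain)
  show "\<exists>e>0. \<exists>C. \<forall>\<zeta>\<in>ball 0 1. dist (\<psi> (Suc j) \<zeta>) w < e \<longrightarrow> norm (\<psi> j \<zeta>) \<le> C"
    using \<psi>_bounded_section[OF \<Omega>] \<psi>_bounded_puncture[OF \<Omega>] by blast
qed

end

section \<open>Boundedness\<close>

context siegel_two begin

text \<open>Where \<open>\<psi> (Suc j)\<close> is far from \<open>b\<close>, \<open>l\<close> is \<open>G \<circ> l'\<close> up to a constant for a tract as above; the segment
  from \<open>\<zeta>\<close> towards the centre, on which this contraction is used, ends where everything is bounded.\<close>

lemma log_contraction:
  assumes l: "continuous_on (ball 0 1) l" "\<And>\<zeta>. norm \<zeta> < 1 \<Longrightarrow> exp (l \<zeta>) = \<psi> j \<zeta> - b"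
    and l': "continuous_on (ball 0 1) l'" "\<And>\<zeta>. norm \<zeta> < 1 \<Longrightarrow> exp (l' \<zeta>) = \<psi> (Suc j) \<zeta> - b"
  shows "\<exists>C. \<forall>\<zeta>\<in>ball 0 1. norm (l \<zeta>) \<le> 1/2 * norm (l' \<zeta>) + C"
proof -
  define \<rho> where "\<rho> = ln R + 100"
  obtain C1 where C1: "\<And>\<zeta>. norm \<zeta> < 1 \<Longrightarrow> norm (\<psi> (Suc j) \<zeta>) \<le> exp \<rho> + norm b \<Longrightarrow> norm (\<psi> j \<zeta>) \<le> C1"
    using \<psi>_bounded_if_image_bounded[of j "exp \<rho> + norm b"] unfolding Ball_def mem_ball_0 by blast
  obtain C2 where C2: "\<And>\<zeta>. norm \<zeta> < 1 \<Longrightarrow> norm (\<psi> j \<zeta>) \<le> C1 \<Longrightarrow> norm (l \<zeta>) \<le> C2"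
    using log_\<psi>_bounded[OF l, of C1] unfolding Ball_def mem_ball_0 by blast
  obtain C3 where C3: "\<And>\<zeta>. norm \<zeta> < 1 \<Longrightarrow> norm (\<psi> (Suc j) \<zeta>) \<le> exp \<rho> + norm b \<Longrightarrow> norm (l' \<zeta>) \<le> C3"
    using log_\<psi>_bounded[OF l', of "exp \<rho> + norm b"] unfolding Ball_def mem_ball_0 by blast
  have near: "norm (l \<zeta>) \<le> C2" "norm (l' \<zeta>) \<le> C3" if \<zeta>: "norm \<zeta> < 1" "Re (l' \<zeta>) \<le> \<rho>" for \<zeta>
  proof -
    have "norm (\<psi> (Suc j) \<zeta> - b) \<le> exp \<rho>" using that by (simp flip: l'(2) add: norm_exp_eq_Re)
    then have "norm (\<psi> (Suc j) \<zeta>) \<le> exp \<rho> + norm b" using norm_triangle_sub[of "\<psi> (Suc j) \<zeta>" b] by simp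
    then show "norm (l \<zeta>) \<le> C2" "norm (l' \<zeta>) \<le> C3" using C1 C2 C3 \<zeta>(1) by blast+
  qed
  have centre: "Re (l' 0) < \<rho>"
  proof -
    have "exp (Re (l' 0)) < R" using l'(2)[of 0] R_\<psi>[of "Suc j"] by (simp add: dist_norm flip: norm_exp_eq_Re)
    then have "Re (l' 0) < ln R" using R_pos by (metis exp_less_cancel_iff exp_ln)
    then show ?thesis by (simp add: \<rho>_def)
  qed
  have est: "norm (l \<zeta>) \<le> 1/2 * norm (l' \<zeta>) + (\<bar>C2\<bar> + \<bar>C3\<bar>)" if \<zeta>: "norm \<zeta> < 1" for \<zeta>
  proof (cases "Re (l' \<zeta>) \<le> \<rho>")
    case True
    then show ?thesis using near(1)[OF \<zeta> True] norm_ge_zero[of "l' \<zeta>"] by linarith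
  next
    case False
    have ball: "of_real t * \<zeta> \<in> ball 0 1" if "t \<in> {0..1}" for t
    proof -
      have "\<bar>t\<bar> * norm \<zeta> \<le> 1 * norm \<zeta>" using that by (intro mult_right_mono) auto
      then show ?thesis using \<zeta> by (simp add: norm_mult)
    qed
    have cont_g: "continuous_on {0..1} (\<lambda>t. Re (l' (of_real t * \<zeta>)))"
      by (intro continuous_intros continuous_on_compose2[OF l'(1)]) (use ball in auto)
    \<comment> \<open>\<open>t0\<close> will be the last parameter on the segment where the image is
      still in the bounded region; parameter 0 belongs to \<open>A\<close> because of
      \<open>R_\<psi>\<close>. From \<open>t0\<close> on the values of \<open>l'\<close> stay in the
      half-plane where \<open>G\<close> contracts.\<close>
    define A where "A = {0..1} \<inter> (\<lambda>t. Re (l' (of_real t * \<zeta>))) -` {..\<rho>}"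
    have "closed A" unfolding A_def by (rule continuous_closed_preimage[OF cont_g]) auto
    then have "compact A" using compact_Icc[of "0::real" 1] bounded_subset
      unfolding compact_eq_bounded_closed A_def by blast
    moreover have "0 \<in> A" using centre by (simp add: A_def)
    then have "A \<noteq> {}" by blast
    ultimately have "\<exists>t0\<in>A. \<forall>t\<in>A. t \<le> t0" by (rule compact_attains_sup)
    then obtain t0 where t0: "t0 \<in> A" "\<And>t. t \<in> A \<Longrightarrow> t \<le> t0" by blast
    have t01: "0 \<le> t0" "t0 \<le> 1" "Re (l' (of_real t0 * \<zeta>)) \<le> \<rho>" using t0(1) by (auto simp: A_def)
    have after: "\<rho> \<le> Re (l' (of_real t * \<zeta>))" if t: "t0 \<le> t" "t \<le> 1" for t
    proof (rule ccontr)
      assume neg: "\<not> ?thesis"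
      have "continuous_on {t..1} (\<lambda>t. Re (l' (of_real t * \<zeta>)))"
        by (rule continuous_on_subset[OF cont_g]) (use t t01 in auto)
      then obtain u where u: "t \<le> u" "u \<le> 1" "Re (l' (of_real u * \<zeta>)) = \<rho>"
        using IVT'[of "\<lambda>t. Re (l' (of_real t * \<zeta>))" t \<rho> 1] neg False t by auto
      then have "u \<in> A" using t t01 by (simp add: A_def)
      then have "u = t" using t0(2)[of u] u(1) t(1) by simp
      then show False using u(3) neg by simp
    qed
    define S where "S = (\<lambda>t. of_real t * \<zeta>) ` {t0..1}"
    have S: "connected S" "\<zeta> \<in> S" "of_real t0 * \<zeta> \<in> S" "S \<subseteq> ball 0 1"
    proof -
      show "connected S" unfolding S_def by (intro connected_continuous_image continuous_intros) auto
      show "\<zeta> \<in> S" unfolding S_def using t01 by (intro image_eqI[of _ _ 1]) auto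
      show "of_real t0 * \<zeta> \<in> S" unfolding S_def using t01 by (intro image_eqI[of _ _ t0]) auto
      show "S \<subseteq> ball 0 1" unfolding S_def using ball t01 by auto
    qed
    have after: "\<rho> \<le> Re (l' x)" if "x \<in> S" for x using that after by (auto simp: S_def)
    then have lH: "l' x \<in> H" if "x \<in> S" for x using that by (fastforce simp: H_def \<rho>_def)
    have lb: "b + exp (l' x) = f (\<psi> j x)" if "x \<in> S" for x
      using l'(2)[of x] S(4) that by (auto simp: \<psi>_Suc)
    obtain \<Phi> G where tract: "tract f a b R \<Phi> G" and \<Phi>0: "\<Phi> (l' \<zeta>) = \<psi> j \<zeta>"
      using tract_exists[OF lH[OF S(2)] lb[OF S(2), symmetric]] by blast
    interpret T: tract f a b R \<Phi> G by (rule tract)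
    have contl': "continuous_on S l'" using l'(1) S(4) continuous_on_subset by blast
    have \<Phi>: "\<Phi> (l' x) = \<psi> j x" if x: "x \<in> S" for x
    proof (rule lift_unique[of S "\<lambda>x. \<Phi> (l' x)" "\<psi> j" \<zeta>])
      show "continuous_on S (\<lambda>x. \<Phi> (l' x))"
        by (rule continuous_on_compose2[OF T.cont_\<phi>[OF order.refl] contl']) (use lH in auto)
      show "continuous_on S (\<psi> j)" by (rule cont_\<psi>[OF S(4)])
      show "f (\<Phi> (l' y)) = f (\<psi> j y)" if "y \<in> S" for y
        using T.lift[OF lH[OF that]] lb[OF that] by simp
      show "deriv f (\<Phi> (l' y)) \<noteq> 0" if "y \<in> S" for y
        using T.lift[OF lH[OF that]] H_image lH[OF that] by (intro not_crit) auto
    qed (use S \<Phi>0 x in auto)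
    have diff: "l \<zeta> - G (l' \<zeta>) = l (of_real t0 * \<zeta>) - G (l' (of_real t0 * \<zeta>))"
    proof (rule logs_differ_by_constant[OF S(1) _ _ _ S(2,3)])
      show "continuous_on S l" using l(1) S(4) continuous_on_subset by blast
      show "continuous_on S (\<lambda>x. G (l' x))"
        by (rule continuous_on_compose2[OF T.cont_G[OF order.refl] contl']) (use lH in auto)
      show "exp (l x) = exp (G (l' x))" if "x \<in> S" for x
        using l(2)[of x] S(4) that T.exp_G[OF lH[OF that]] \<Phi>[OF that] by auto
    qed
    have P: "l' x \<in> T.P" if "x \<in> S" for x using after[OF that] by (simp add: T.P_def T.\<rho>_def \<rho>_def)
    have "norm (G (l' \<zeta>) - G (l' (of_real t0 * \<zeta>))) \<le> 1/2 * norm (l' \<zeta> - l' (of_real t0 * \<zeta>))"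
      by (rule T.G_lipschitz[OF P[OF S(2)] P[OF S(3)]])
    moreover have "norm (l' \<zeta> - l' (of_real t0 * \<zeta>)) \<le> norm (l' \<zeta>) + norm (l' (of_real t0 * \<zeta>))"
      by (rule norm_triangle_ineq4)
    moreover have t0\<zeta>: "norm (of_real t0 * \<zeta>) < 1" using ball[of t0] t01 by simp
    ultimately have "norm (G (l' \<zeta>) - G (l' (of_real t0 * \<zeta>))) \<le> 1/2 * norm (l' \<zeta>) + \<bar>C3\<bar>"
      using near(2)[OF t0\<zeta> t01(3)] by linarith
    moreover have "l \<zeta> = l (of_real t0 * \<zeta>) + (G (l' \<zeta>) - G (l' (of_real t0 * \<zeta>)))"
      using diff by (simp add: algebra_simps)
    then have "norm (l \<zeta>) \<le> norm (l (of_real t0 * \<zeta>)) + norm (G (l' \<zeta>) - G (l' (of_real t0 * \<zeta>)))"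
      by (metis norm_triangle_ineq)
    ultimately show ?thesis using near(1)[OF t0\<zeta> t01(3)] by linarith
  qed
  show ?thesis by (rule exI[of _ "\<bar>C2\<bar> + \<bar>C3\<bar>"]) (use est in auto)
qed

lemma log_\<psi>_exists:
  "\<exists>L. L holomorphic_on ball 0 1 \<and> (\<forall>\<zeta>\<in>ball 0 1. exp (L \<zeta>) = \<psi> j \<zeta> - b)"
proof -
  have hol: "(\<lambda>\<zeta>. \<psi> j \<zeta> - b) holomorphic_on ball 0 1" by (intro holomorphic_intros hol_\<psi>)
  have nz: "\<psi> j \<zeta> - b \<noteq> 0" if "\<zeta> \<in> ball 0 1" for \<zeta>
    using \<psi>_fatou[of \<zeta> j] b_julia that by auto
  show ?thesis
    by (rule holomorphic_logarithm_exists[OF convex_ball open_ball hol nz, of 0]) auto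
qed

theorem bounded_U: "bounded U"
proof -
  have "\<exists>L. \<forall>j. L j holomorphic_on ball 0 1 \<and> (\<forall>\<zeta>\<in>ball 0 1. exp (L j \<zeta>) = \<psi> j \<zeta> - b)"
    by (intro choice allI log_\<psi>_exists)
  then obtain L where L: "\<And>j. L j holomorphic_on ball 0 1" "\<And>j \<zeta>. norm \<zeta> < 1 \<Longrightarrow> exp (L j \<zeta>) = \<psi> j \<zeta> - b"
    unfolding Ball_def mem_ball_0 by blast
  \<comment> \<open>Only the logarithms \<open>L 0\<close> to \<open>L (n - 1)\<close> occur,
    precomposed with rotations. Thus \<open>l n\<close> is \<open>L 0\<close> up to a rotation, and
    the inequalities close up around the cycle.\<close>
  define l where "l = (\<lambda>j \<zeta>. L (j mod n) (rot ^ (j div n) * \<zeta>))"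
  have contL: "continuous_on (ball 0 1) (L j)" for j using L(1) holomorphic_on_imp_continuous_on by blast
  have l: "continuous_on (ball 0 1) (l j)" for j
    unfolding l_def by (rule continuous_on_compose2[OF contL]) (auto intro!: continuous_intros simp: norm_mult)
  have exp_l: "exp (l j \<zeta>) = \<psi> j \<zeta> - b" if "norm \<zeta> < 1" for j \<zeta>
    unfolding l_def using L(2)[of "rot ^ (j div n) * \<zeta>" "j mod n"] \<psi>_mod[OF that, of j] that by (simp add: norm_mult)
  have "\<exists>C. \<forall>j. \<forall>\<zeta>\<in>ball 0 1. norm (l j \<zeta>) \<le> 1/2 * norm (l (Suc j) \<zeta>) + C j"
  proof (intro choice allI)
    show "\<exists>C. \<forall>\<zeta>\<in>ball 0 1. norm (l j \<zeta>) \<le> 1/2 * norm (l (Suc j) \<zeta>) + C" for j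
      by (rule log_contraction[OF l exp_l l exp_l])
  qed
  then obtain C where C: "\<And>j \<zeta>. norm \<zeta> < 1 \<Longrightarrow> norm (l j \<zeta>) \<le> 1/2 * norm (l (Suc j) \<zeta>) + C j"
    unfolding Ball_def mem_ball_0 by blast
  define C0 where "C0 = Max (C ` {..<n})"
  have C0: "C j \<le> C0" if "j < n" for j unfolding C0_def using that by (intro Max_ge) auto
  have bound: "norm (L 0 \<zeta>) \<le> 2 * C0" if \<zeta>: "norm \<zeta> < 1" for \<zeta>
  proof -
    \<comment> \<open>The subdisk is invariant under rotation, so \<open>l (Suc i)\<close> takes its
      absolute values in \<open>V\<close> even for \<open>i = n - 1\<close>. The maximum
      \<open>v\<close> then satisfies \<open>v \<le> v / 2 + C0\<close>, a bound independent of
      \<open>\<zeta>\<close>.\<close>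
    define V where "V = (\<Union>i<n. (\<lambda>x. norm (L i x)) ` cball 0 (norm \<zeta>))"
    have "compact V" unfolding V_def
      by (intro compact_UN compact_continuous_image continuous_on_norm continuous_on_subset[OF contL]) (use \<zeta> in auto)
    moreover have V0: "norm (L 0 \<zeta>) \<in> V" unfolding V_def using n by (intro UN_I[of 0] imageI) auto
    then have "V \<noteq> {}" by blast
    ultimately have "\<exists>v\<in>V. \<forall>u\<in>V. u \<le> v" by (intro compact_attains_sup)
    then obtain v where v: "v \<in> V" "\<And>u. u \<in> V \<Longrightarrow> u \<le> v" by blast
    obtain i x where ix: "i < n" "norm x \<le> norm \<zeta>" "v = norm (L i x)" using v(1) by (auto simp: V_def)
    have "v = norm (l i x)" using ix by (simp add: l_def)
    also have "\<dots> \<le> 1/2 * norm (l (Suc i) x) + C i" using C ix(2) \<zeta> by simp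
    also have "norm (l (Suc i) x) \<in> V"
    proof -
      have "Suc i mod n < n" using n by simp
      moreover have "rot ^ (Suc i div n) * x \<in> cball 0 (norm \<zeta>)" using ix(2) by (simp add: norm_mult)
      ultimately show ?thesis unfolding V_def l_def by blast
    qed
    then have "1/2 * norm (l (Suc i) x) + C i \<le> 1/2 * v + C0" using v(2) C0[OF ix(1)] by fastforce
    finally have "v \<le> 2 * C0" by simp
    then show ?thesis using v(2)[OF V0] by simp
  qed
  have "norm z \<le> exp (2 * C0) + norm b" if z: "z \<in> U" for z
  proof -
    have \<zeta>: "norm (\<phi> z) < 1" "\<psi> 0 (\<phi> z) = z" using \<phi>_ball[OF z] \<psi>0_\<phi>[OF z] by auto
    have "norm (z - b) = exp (Re (L 0 (\<phi> z)))" using L(2)[OF \<zeta>(1), of 0] \<zeta>(2) by (metis norm_exp_eq_Re)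
    also have "\<dots> \<le> exp (2 * C0)" using complex_Re_le_cmod[of "L 0 (\<phi> z)"] bound[OF \<zeta>(1)] by simp
    finally show ?thesis using norm_triangle_sub[of z b] by simp
  qed
  then show ?thesis by (auto simp: bounded_iff)
qed

end

section \<open>The polynomial case and the combination of both cases\<close>

context siegel_cycle begin

text \<open>A pole at infinity makes \<open>f\<close> a polynomial, and a nonconstant one with a
  critical point has degree at least 2. So \<open>f z\<close> is \<open>c 0\<close> plus
  \<open>z\<close> times a factor of modulus at least 3 far out; the surplus over 2 absorbs
  \<open>c 0\<close>.\<close>

lemma expanding_near_infinity:
  assumes "filterlim f at_infinity at_infinity"
  obtains K where "K \<ge> 1" "\<And>z. K \<le> norm z \<Longrightarrow> 2 * norm z \<le> norm (f z)"
proof -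
  have "((inverse \<circ> f) \<longlongrightarrow> 0) at_infinity"
    unfolding o_def by (rule filterlim_compose[OF tendsto_inverse_0 assms])
  then obtain c m where fc: "\<And>z. f z = (\<Sum>i\<le>m. c i * z ^ i)" using pole_at_infinity[OF hol] by metis
  have "\<exists>k. 2 \<le> k \<and> k \<le> m \<and> c k \<noteq> 0"
  proof (rule ccontr)
    assume "\<not> ?thesis"
    then have z: "c k = 0" if "k \<in> {..m} - {0, 1}" for k using that by fastforce
    define d where "d = (if m = 0 then 0 else c 1)"
    have lin: "f z = c 0 + d * z" for z
    proof -
      have "f z = (\<Sum>i\<in>{..m} \<inter> {0, 1}. c i * z ^ i)"
        unfolding fc by (rule sum.mono_neutral_right) (use z in auto)
      also have "{..m} \<inter> {0, 1} = (if m = 0 then {0} else {0, 1})" by auto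
      finally show ?thesis by (simp add: d_def)
    qed
    have D: "(f has_field_derivative d) (at z)" for z
    proof -
      have "((\<lambda>z. c 0 + d * z) has_field_derivative d) (at z)" by (auto intro!: derivative_eq_intros)
      moreover have "f = (\<lambda>z. c 0 + d * z)" using lin by blast
      ultimately show ?thesis by simp
    qed
    obtain x where "deriv f x = 0" using crit_nonempty by (auto simp: critical_values_def)
    then have "d = 0" using DERIV_imp_deriv[OF D] by metis
    then show False using nonconst lin by (auto simp: constant_on_def)
  qed
  then obtain k where k: "2 \<le> k" "k \<le> m" "c k \<noteq> 0" by blast
  then obtain m' where m: "m = Suc m'" by (cases m) auto
  have f: "f z = c 0 + z * (\<Sum>i\<le>m'. c (Suc i) * z ^ i)" for z
    unfolding fc m sum.atMost_Suc_shift by (simp add: sum_distrib_left mult_ac)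
  have "\<forall>\<^sub>F z in at_infinity. 3 \<le> norm (\<Sum>i\<le>m'. c (Suc i) * z ^ i)"
    by (rule Limits.polyfun_extremal[where k = "k - 1"]) (use k m in auto)
  then obtain K where K: "\<And>z. K \<le> norm z \<Longrightarrow> 3 \<le> norm (\<Sum>i\<le>m'. c (Suc i) * z ^ i)"
    unfolding eventually_at_infinity by blast
  show ?thesis
  proof (rule that[of "max 1 (max K (norm (c 0)))"])
    fix z :: complex assume z: "max 1 (max K (norm (c 0))) \<le> norm z"
    have "norm z * 3 \<le> norm z * norm (\<Sum>i\<le>m'. c (Suc i) * z ^ i)"
      using K[of z] z by (intro mult_left_mono) auto
    also have "\<dots> = norm (f z - c 0)" by (simp add: f norm_mult)
    also have "\<dots> \<le> norm (f z) + norm (c 0)" by (rule norm_triangle_ineq4)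
    finally show "2 * norm z \<le> norm (f z)" using z by simp
  qed simp
qed

lemma bounded_U_polynomial:
  assumes "filterlim f at_infinity at_infinity"
  shows "bounded U"
proof -
  obtain K where K: "K \<ge> 1" "\<And>z. K \<le> norm z \<Longrightarrow> 2 * norm z \<le> norm (f z)"
    using expanding_near_infinity[OF assms] by blast
  have "norm z < K" if z: "z \<in> U" for z
  proof (rule ccontr)
    assume "\<not> ?thesis"
    then have zK: "K \<le> norm z" by simp
    have grow: "2 ^ k * norm z \<le> norm ((f ^^ k) z)" for k
    proof (induction k)
      case (Suc k)
      have "1 * norm z \<le> 2 ^ k * norm z" by (intro mult_right_mono) auto
      then have "K \<le> norm ((f ^^ k) z)" using Suc zK by simp
      then show ?case using K(2)[of "(f ^^ k) z"] Suc by simp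
    qed simp
    let ?r = "norm (\<phi> z)"
    have r: "?r < 1" using \<phi>_ball[OF z] .
    obtain B where B: "\<And>x. x \<in> disc ?r \<Longrightarrow> norm x \<le> B"
      using compact_imp_bounded[OF compact_disc[OF r]] bounded_iff by metis
    have "norm ((f ^^ k) z) \<le> B" for k using B disc_iter[OF \<psi>0_disc[OF z] r] by blast
    moreover have "2 ^ k * 1 \<le> 2 ^ k * norm z" for k :: nat
      using zK K(1) by (intro mult_left_mono) auto
    ultimately have le: "2 ^ k \<le> B" for k :: nat using grow[of k] by (metis mult_1_right order_trans)
    obtain k :: nat where "B < 2 ^ k" using real_arch_pow[of 2 B] by auto
    then show False using le[of k] by simp
  qed
  then show ?thesis unfolding bounded_iff using less_imp_le by blast
qed

lemma \<psi>_image: "\<psi> j ` ball 0 1 = (f ^^ j) ` U"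
proof -
  have "\<psi> 0 ` ball 0 1 = U" using \<psi>0_U \<psi>0_\<phi> \<phi>_ball by (force simp: image_iff)
  moreover have "\<psi> j \<zeta> = (f ^^ j) (\<psi> 0 \<zeta>)" for \<zeta> using \<psi>_add[of j 0] by simp
  ultimately show ?thesis by (metis (no_types, lifting) image_cong image_image)
qed

lemma bounded_U_if_two_critical_values:
  assumes CV: "card (critical_values f) = 2"
    and front: "\<And>j. frontier ((f ^^ j) ` U) \<inter> critical_values f = {}"
  shows "bounded U"
proof (cases "filterlim f at_infinity at_infinity")
  case True
  then show ?thesis by (rule bounded_U_polynomial)
next
  case False
  obtain b where b: "b \<in> critical_values f" "b \<notin> fatou_set f" using critical_value_in_julia by blast
  obtain x y where "critical_values f = {x, y}" using CV card_2_iff by metis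
  then obtain a where a: "critical_values f = {a, b}" using b(1) insert_commute by (metis insertE singletonD)
  \<comment> \<open>\<open>disc 0\<close> is the finite set of centres of the cycle, and by
    \<open>disc_\<psi>\<close> it contains \<open>\<psi> j 0\<close> for every
    \<open>j\<close>.\<close>
  have "bounded (disc 0)" by (intro compact_imp_bounded compact_disc) simp
  then obtain B where B: "\<And>x. x \<in> disc 0 \<Longrightarrow> dist b x \<le> B" unfolding bounded_any_center[where a=b] by blast
  define R where "R = max (max (dist a b) (dist (f b) b)) B + 1"
  \<comment> \<open>The boundary hypothesis enters here: \<open>b\<close> is not in the disk, being
    in the Julia set, and not on its frontier, being a critical value.\<close>
  have notcl: "b \<notin> closure (\<psi> j ` ball 0 1)" for j
  proof -
    have "b \<notin> \<psi> j ` ball 0 1" using \<psi>_fatou[of _ j] b(2) by auto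
    then show ?thesis using front[of j] b(1) closure_Un_frontier[of "\<psi> j ` ball 0 1"] by (auto simp: \<psi>_image)
  qed
  interpret siegel_two f U n \<phi> \<theta> a b R
  proof unfold_locales
    show "dist (\<psi> j 0) b < R" for j
      using B[OF disc_\<psi>[of 0 0 j]] by (simp add: R_def dist_commute)
  qed (use a b notcl False in \<open>auto simp: R_def\<close>)
  show ?thesis by (rule bounded_U)
qed

end

theorem theorem3:
  fixes f :: "complex \<Rightarrow> complex" and U :: "complex set"
  assumes "f holomorphic_on UNIV"
    and "card (critical_values f) = 2"
    and "finite_asymptotic_values f = {}"
    and "periodic_siegel_disk f U"
    and "\<And>j. frontier ((f ^^ j) ` U) \<inter> critical_values f = {}"
  shows "bounded U"
proof -
  obtain n where n: "n \<ge> 1" "invariant_siegel_disk (f ^^ n) U" and U: "U \<in> components (fatou_set f)"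
    using assms(4) by (auto simp: periodic_siegel_disk_def)
  obtain \<phi> \<theta> where \<phi>: "\<phi> holomorphic_on U" "bij_betw \<phi> U (ball 0 1)" "\<theta> \<notin> \<rat>"
      "\<And>z. z \<in> U \<Longrightarrow> \<phi> ((f ^^ n) z) = cis (2 * pi * \<theta>) * \<phi> z"
    using n(2) unfolding invariant_siegel_disk_def by blast
  have fin: "finite (critical_values f)" "critical_values f \<noteq> {}"
    using assms(2) by (auto intro: card_ge_0_finite)
  have "\<not> f constant_on UNIV"
  proof
    assume "f constant_on UNIV"
    then obtain c where "\<And>z. f z = c" by (auto simp: constant_on_def)
    then have "critical_values f \<subseteq> {c}" by (auto simp: critical_values_def)
    then have "card (critical_values f) \<le> 1" using card_mono[of "{c}"] by simp
    then show False using assms(2) by simp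
  qed
  then interpret siegel_cycle f U n \<phi> \<theta>
    using assms(1,3) n U \<phi> fin by unfold_locales (auto simp: invariant_siegel_disk_def)
  show ?thesis by (rule bounded_U_if_two_critical_values[OF assms(2,5)])
qed

end
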